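(* Let $A$ be an associative dg-algebra (not assumed unital), i.e. $A=\Phi(1)$ for a strong symmetric monoidal dg-functor $\Phi:\mathcal{A}ss\to\mathrm{Ch}$, and let $\mathrm{End}(A)$ be its endomorphism prop, viewed as a prop with $A_\infty$-multiplication via the algebra structure of $A$. There is an inclusion $F:C^*(A,A)\hookrightarrow\mathrm{Nat}_{\mathrm{End}(A)}\big((1,0),(1,0)\big)$ such that the composition $$C_*(A,A)\otimes C^*(A,A)\xrightarrow{\ id\otimes F\ }C_*(A,A)\otimes\mathrm{Nat}_{\mathrm{End}(A)}\big((1,0),(1,0)\big)\to C_*(A,A)$$ is the cap product, where the second map is the evaluation of natural transformations on the $\mathrm{End}(A)$-algebra $A$.
   Context: Conventions: chain complexes are differential graded $\mathbb Z$-modules, $V[n]_*=V_{*-n}$; $\mathrm{Ch}$ is the dg-category of chain complexes, with $\mathrm{Hom}(V,W)$ the complex of linear maps of all degrees and $(df)(v)=(-1)^{|v|}(d_W(f(v))-f(d_Vv))$. $\mathcal{A}ss$ is the prop of (non-unital) associative algebras. The endomorphism prop $\mathrm{End}(A)$ has objects the natural numbers and $\mathrm{End}(A)(p,q)=\mathrm{Hom}(A^{\otimes p},A^{\otimes q})$; the algebra structure of $A$ gives a symmetric monoidal dg-functor $i:A_\infty\to\mathrm{End}(A)$ factoring through $\mathcal{A}ss$ (with $m_2\mapsto$ the multiplication and $m_k\mapsto 0$ for $k>2$), where $A_\infty$ is the prop encoding non-unital $A_\infty$-algebras. $A$ itself is tautologically an $\mathrm{End}(A)$-algebra, i.e. a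 strong symmetric monoidal dg-functor $\mathrm{End}(A)\to\mathrm{Ch}$, $n\mapsto A^{\otimes n}$. For a dg-functor $\Phi:\mathrm{End}(A)\to\mathrm{Ch}$, its Hochschild complex is $C(\Phi)(0)=\bigoplus_{n\ge1}\Phi(n)[n-1]$ with differential the sum of the differential of $\Phi$ and the usual Hochschild differential (alternating sum of the maps induced by multiplying cyclically consecutive entries, $\Phi(n)\to\Phi(n-1)$). For $\Phi=A$ this is the Hochschild chain complex $C_*(A,A)$, with $C_p(A,A)=A^{\otimes p+1}$. $\mathrm{Nat}_{\mathrm{End}(A)}((1,0),(1,0))$ is the chain complex of natural transformations of all degrees from the dg-functor $\mathrm{Fun}(\mathrm{End}(A),\mathrm{Ch})\to\mathrm{Ch}$, $\Phi\mapsto C(\Phi)(0)$, to itself, where $\mathrm{Fun}(\mathrm{End}(A),\mathrm{Ch})$ is the dg-category of all dg-functors. It is isomorphic to $\prod_{j\ge1}\bigoplus_{k\ge1}\mathrm{Hom}(A^{\otimes j},A^{\otimes k})[k-j]$ with differential $d_A+d_H+d^H$, where $d_H$ postcomposes and $d^H$ precomposes cyclically with multiplications. $C^*(A,A)$ is the Hochschild cochain complex, with $C^q(A,A)=\mathrm{Hom}(A^{\otimes q},A)$ and the usual Hochschild cochain differential. The cap product $\cap:C_p(A,A)\otimes C^q(A,A)\to C_{p-q}(A,A)$ is the classical chain map given, for $a=a_0\otimes\dots\otimes a_p$ and $D\in\mathrm{Hom}(A^{\otimes q},A)$, by $a\cap D=(-1)^{(|a|-|a_0|)|D|}a_0D(a_1,\dots,a_q)\otimes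 a_{q+1}\otimes\dots\otimes a_p$.
   Formalization: The chain map F with composition the cap product is proved for every A, but F is claimed to be an inclusion exactly when no nonzero x in A satisfies ax = 0 for all a; for other A (e.g. zero multiplication) the claimed injectivity fails. *)

theory Defs
  imports "HOL-Algebra.Free_Abelian_Groups"
begin

section \<open>Chain complexes\<close>

text \<open>
  Abelian groups are commutative groups of \<open>HOL-Algebra\<close>, hence written multiplicatively:
  a sum is a \<open>\<otimes>\<close> or \<open>finprod\<close>, zero is \<open>\<one>\<close>, and \<open>(-1)\<^sup>k x\<close> is \<open>kos G k x\<close>.
\<close>

definition kos :: "('a, 'm) monoid_scheme \<Rightarrow> int \<Rightarrow> 'a \<Rightarrow> 'a" where
  "kos G k x = (if even k then x else inv\<^bsub>G\<^esub> x)"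

record 'a ch =
  grp :: "int \<Rightarrow> 'a monoid"
  dif :: "int \<Rightarrow> 'a \<Rightarrow> 'a"

definition chain_complex :: "('a, 'm) ch_scheme \<Rightarrow> bool" where
  "chain_complex V \<longleftrightarrow>
     (\<forall>k. comm_group (grp V k) \<and> dif V k \<in> hom (grp V k) (grp V (k - 1)) \<and>
        (\<forall>x\<in>carrier (grp V k). dif V (k - 1) (dif V k x) = \<one>\<^bsub>grp V (k - 2)\<^esub>))"

definition chain_maps :: "('a, 'm) ch_scheme \<Rightarrow> ('b, 'n) ch_scheme \<Rightarrow> (int \<Rightarrow> 'a \<Rightarrow> 'b) set" where
  "chain_maps V W =
     {f. \<forall>k. f k \<in> hom (grp V k) (grp W k) \<and>
        (\<forall>x\<in>carrier (grp V k). f (k - 1) (dif V k x) = dif W k (f k x))}"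

text \<open>
  The complex \<open>Hom(V, W)\<close>, with \<open>(df)(v) = (-1)\<^bsup>|v|\<^esup> (d(f v) - f(d v))\<close>. With this sign it is
  \<open>v \<otimes> f \<mapsto> f v\<close> that is a chain map \<open>V \<otimes> Hom(V, W) \<rightarrow> W\<close>.
  Maps are made extensional so that equal maps are equal as HOL functions.
\<close>

definition Hom_ch :: "('a, 'm) ch_scheme \<Rightarrow> ('b, 'n) ch_scheme \<Rightarrow> (int \<Rightarrow> 'a \<Rightarrow> 'b) ch" where
  "Hom_ch V W =
     \<lparr>grp = (\<lambda>r.
        \<lparr>carrier = {f. \<forall>k. f k \<in> hom (grp V k) (grp W (k + r)) \<inter> extensional (carrier (grp V k))},
         monoid.mult = (\<lambda>f g k. \<lambda>x\<in>carrier (grp V k). f k x \<otimes>\<^bsub>grp W (k + r)\<^esub> g k x),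
         one = (\<lambda>k. \<lambda>x\<in>carrier (grp V k). \<one>\<^bsub>grp W (k + r)\<^esub>)\<rparr>),
      dif = (\<lambda>r f k. \<lambda>x\<in>carrier (grp V k).
        kos (grp W (k + r - 1)) k
          (dif W (k + r) (f k x) \<otimes>\<^bsub>grp W (k + r - 1)\<^esub>
             inv\<^bsub>grp W (k + r - 1)\<^esub> (f (k - 1) (dif V k x))))\<rparr>"

text \<open>The composite of \<open>g\<close> with a map \<open>f\<close> of degree \<open>r\<close> out of \<open>V\<close>.\<close>

definition hcomp ::
  "('a, 'm) ch_scheme \<Rightarrow> int \<Rightarrow> (int \<Rightarrow> 'b \<Rightarrow> 'c) \<Rightarrow> (int \<Rightarrow> 'a \<Rightarrow> 'b) \<Rightarrow> int \<Rightarrow> 'a \<Rightarrow> 'c" where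
  "hcomp V r g f = (\<lambda>k. \<lambda>x\<in>carrier (grp V k). g (k + r) (f k x))"

definition hid :: "('a, 'm) ch_scheme \<Rightarrow> int \<Rightarrow> 'a \<Rightarrow> 'a" where
  "hid V = (\<lambda>k. \<lambda>x\<in>carrier (grp V k). x)"


section \<open>Dg-categories and dg-functors to \<open>Ch\<close>\<close>

text \<open>
  In \<open>cmp C x y z s r g f\<close> the morphism \<open>f\<close> from \<open>x\<close> to \<open>y\<close> has degree \<open>r\<close> and
  \<open>g\<close> from \<open>y\<close> to \<open>z\<close> has degree \<open>s\<close>.
\<close>

record ('o, 'h) dgcat =
  ob :: "'o set"
  homc :: "'o \<Rightarrow> 'o \<Rightarrow> 'h ch"
  cmp :: "'o \<Rightarrow> 'o \<Rightarrow> 'o \<Rightarrow> int \<Rightarrow> int \<Rightarrow> 'h \<Rightarrow> 'h \<Rightarrow> 'h"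
  ident :: "'o \<Rightarrow> 'h"

text \<open>
  Functors with values in the chain complexes whose elements lie in the type \<open>'u\<close>;
  \<open>'u\<close> plays the role of the universe of the category \<open>Ch\<close>.
\<close>

record ('o, 'h, 'u) dgfun =
  obj :: "'o \<Rightarrow> 'u ch"
  mor :: "'o \<Rightarrow> 'o \<Rightarrow> int \<Rightarrow> 'h \<Rightarrow> int \<Rightarrow> 'u \<Rightarrow> 'u"

definition dg_functor :: "('o, 'h) dgcat \<Rightarrow> ('o, 'h, 'u) dgfun \<Rightarrow> bool" where
  "dg_functor C \<Phi> \<longleftrightarrow>
     (\<forall>x\<in>ob C. chain_complex (obj \<Phi> x) \<and> mor \<Phi> x x 0 (ident C x) = hid (obj \<Phi> x)) \<and>
     (\<forall>x\<in>ob C. \<forall>y\<in>ob C. mor \<Phi> x y \<in> chain_maps (homc C x y) (Hom_ch (obj \<Phi> x) (obj \<Phi> y))) \<and>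
     (\<forall>x\<in>ob C. \<forall>y\<in>ob C. \<forall>z\<in>ob C. \<forall>r s.
        \<forall>f\<in>carrier (grp (homc C x y) r). \<forall>g\<in>carrier (grp (homc C y z) s).
          mor \<Phi> x z (r + s) (cmp C x y z s r g f) =
          hcomp (obj \<Phi> x) r (mor \<Phi> y z s g) (mor \<Phi> x y r f))"

text \<open>
  The complex of natural transformations of all degrees: in degree \<open>r\<close>, families of degree \<open>r\<close>
  maps \<open>\<nu> x\<close> with \<open>\<nu> y \<circ> \<Phi> f = (-1)\<^bsup>r |f|\<^esup> \<Psi> f \<circ> \<nu> x\<close>.
\<close>

definition nat_ch ::
  "('o, 'h) dgcat \<Rightarrow> ('o, 'h, 'u) dgfun \<Rightarrow> ('o, 'h, 'u) dgfun \<Rightarrow> ('o \<Rightarrow> int \<Rightarrow> 'u \<Rightarrow> 'u) ch" where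
  "nat_ch C \<Phi> \<Psi> =
     \<lparr>grp = (\<lambda>r.
        \<lparr>carrier =
           {\<nu> \<in> extensional (ob C).
              (\<forall>x\<in>ob C. \<nu> x \<in> carrier (grp (Hom_ch (obj \<Phi> x) (obj \<Psi> x)) r)) \<and>
              (\<forall>x\<in>ob C. \<forall>y\<in>ob C. \<forall>s. \<forall>f\<in>carrier (grp (homc C x y) s).
                 hcomp (obj \<Phi> x) s (\<nu> y) (mor \<Phi> x y s f) =
                 kos (grp (Hom_ch (obj \<Phi> x) (obj \<Psi> y)) (r + s)) (r * s)
                   (hcomp (obj \<Phi> x) r (mor \<Psi> x y s f) (\<nu> x)))},
         monoid.mult = (\<lambda>\<mu> \<nu>. \<lambda>x\<in>ob C. \<mu> x \<otimes>\<^bsub>grp (Hom_ch (obj \<Phi> x) (obj \<Psi> x)) r\<^esub> \<nu> x),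
         one = (\<lambda>x\<in>ob C. \<one>\<^bsub>grp (Hom_ch (obj \<Phi> x) (obj \<Psi> x)) r\<^esub>)\<rparr>),
      dif = (\<lambda>r \<nu>. \<lambda>x\<in>ob C. dif (Hom_ch (obj \<Phi> x) (obj \<Psi> x)) r (\<nu> x))\<rparr>"

text \<open>The dg-category \<open>Fun(C, Ch)\<close> of all dg-functors.\<close>

definition fun_cat :: "('o, 'h) dgcat \<Rightarrow> (('o, 'h, 'u) dgfun, 'o \<Rightarrow> int \<Rightarrow> 'u \<Rightarrow> 'u) dgcat" where
  "fun_cat C =
     \<lparr>ob = {\<Phi>. dg_functor C \<Phi>},
      homc = nat_ch C,
      cmp = (\<lambda>\<Phi> \<Psi> \<Theta> s r \<theta> \<eta>. \<lambda>x\<in>ob C. hcomp (obj \<Phi> x) r (\<theta> x) (\<eta> x)),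
      ident = (\<lambda>\<Phi>. \<lambda>x\<in>ob C. hid (obj \<Phi> x))\<rparr>"


section \<open>Non-unital dg-algebras and their tensor powers\<close>

record 'a dga = "'a ch" +
  mul :: "int \<Rightarrow> int \<Rightarrow> 'a \<Rightarrow> 'a \<Rightarrow> 'a"

definition dg_algebra :: "'a dga \<Rightarrow> bool" where
  "dg_algebra A \<longleftrightarrow>
     chain_complex A \<and>
     (\<forall>i j. \<forall>a\<in>carrier (grp A i). mul A i j a \<in> hom (grp A j) (grp A (i + j))) \<and>
     (\<forall>i j. \<forall>b\<in>carrier (grp A j). (\<lambda>a. mul A i j a b) \<in> hom (grp A i) (grp A (i + j))) \<and>
     (\<forall>i j k. \<forall>a\<in>carrier (grp A i). \<forall>b\<in>carrier (grp A j). \<forall>c\<in>carrier (grp A k).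
        mul A (i + j) k (mul A i j a b) c = mul A i (j + k) a (mul A j k b c)) \<and>
     (\<forall>i j. \<forall>a\<in>carrier (grp A i). \<forall>b\<in>carrier (grp A j).
        dif A (i + j) (mul A i j a b) =
        mul A (i - 1) j (dif A i a) b \<otimes>\<^bsub>grp A (i + j - 1)\<^esub>
          kos (grp A (i + j - 1)) i (mul A i (j - 1) a (dif A j b)))"

text \<open>
  Degree \<open>k\<close> of \<open>A\<^bsup>\<otimes>n\<^esup>\<close> is the free abelian group on the lists of \<open>n\<close> homogeneous elements
  (each tagged with its degree) of total degree \<open>k\<close>, modulo additivity in each entry.
\<close>

type_synonym 'a tens = "((int \<times> 'a) list \<Rightarrow>\<^sub>0 int) set"

definition wt :: "(int \<times> 'a) list \<Rightarrow> int" where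
  "wt xs = sum_list (map fst xs)"

definition tgens :: "('a, 'm) ch_scheme \<Rightarrow> nat \<Rightarrow> int \<Rightarrow> (int \<times> 'a) list set" where
  "tgens A n k = {xs. length xs = n \<and> wt xs = k \<and> (\<forall>(i, a)\<in>set xs. a \<in> carrier (grp A i))}"

definition trels :: "('a, 'm) ch_scheme \<Rightarrow> nat \<Rightarrow> int \<Rightarrow> ((int \<times> 'a) list \<Rightarrow>\<^sub>0 int) set" where
  "trels A n k =
     {frag_of (us @ (i, a \<otimes>\<^bsub>grp A i\<^esub> b) # vs)
        - frag_of (us @ (i, a) # vs) - frag_of (us @ (i, b) # vs) | us i a b vs.
        us @ (i, a) # vs \<in> tgens A n k \<and> us @ (i, b) # vs \<in> tgens A n k}"

definition tker :: "('a, 'm) ch_scheme \<Rightarrow> nat \<Rightarrow> int \<Rightarrow> 'a tens" where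
  "tker A n k = generate (free_Abelian_group (tgens A n k)) (trels A n k)"

definition tgrp :: "('a, 'm) ch_scheme \<Rightarrow> nat \<Rightarrow> int \<Rightarrow> 'a tens monoid" where
  "tgrp A n k = free_Abelian_group (tgens A n k) Mod tker A n k"

text \<open>The pure tensor with the given entries.\<close>

definition pure :: "('a, 'm) ch_scheme \<Rightarrow> (int \<times> 'a) list \<Rightarrow> 'a tens" where
  "pure A xs =
     tker A (length xs) (wt xs) #>\<^bsub>free_Abelian_group (tgens A (length xs) (wt xs))\<^esub> frag_of xs"

text \<open>
  The homomorphism from degree \<open>k\<close> of \<open>A\<^bsup>\<otimes>n\<^esup>\<close> to \<open>H\<close> with value \<open>\<phi> xs\<close> on the pure tensor \<open>xs\<close>,
  computed on a representative; it is only used for \<open>\<phi>\<close> additive in each entry.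
\<close>

definition tlift ::
  "('a, 'm) ch_scheme \<Rightarrow> nat \<Rightarrow> int \<Rightarrow> 'b monoid \<Rightarrow> ((int \<times> 'a) list \<Rightarrow> 'b) \<Rightarrow> 'a tens \<Rightarrow> 'b" where
  "tlift A n k H \<phi> = (\<lambda>X\<in>carrier (tgrp A n k).
     (let c = (SOME c. c \<in> X)
      in finprod H (\<lambda>xs. \<phi> xs [^]\<^bsub>H\<^esub> poly_mapping.lookup c xs) (Poly_Mapping.keys c)))"

definition tpow :: "('a, 'm) ch_scheme \<Rightarrow> nat \<Rightarrow> 'a tens ch" where
  "tpow A n =
     \<lparr>grp = tgrp A n,
      dif = (\<lambda>k. tlift A n k (tgrp A n (k - 1)) (\<lambda>xs.
        finprod (tgrp A n (k - 1))
          (\<lambda>i. kos (tgrp A n (k - 1)) (wt (take i xs))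
             (pure A (xs[i := (fst (xs ! i) - 1, dif A (fst (xs ! i)) (snd (xs ! i)))])))
          {..<n}))\<rparr>"

definition mulh :: "'a dga \<Rightarrow> int \<times> 'a \<Rightarrow> int \<times> 'a \<Rightarrow> int \<times> 'a" where
  "mulh A x y = (fst x + fst y, mul A (fst x) (fst y) (snd x) (snd y))"

text \<open>The underlying dg-category of the endomorphism prop.\<close>

definition End_cat :: "'a dga \<Rightarrow> (nat, int \<Rightarrow> 'a tens \<Rightarrow> 'a tens) dgcat" where
  "End_cat A =
     \<lparr>ob = UNIV,
      homc = (\<lambda>p q. Hom_ch (tpow A p) (tpow A q)),
      cmp = (\<lambda>p q t s r g f. hcomp (tpow A p) r g f),
      ident = (\<lambda>p. hid (tpow A p))\<rparr>"

text \<open>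
  \<open>face A n i\<close> is the degree 0 morphism from \<open>n\<close> to \<open>n - 1\<close> of the prop (for \<open>n \<ge> 2\<close>) that multiplies
  the entries \<open>i\<close> and \<open>i + 1\<close> of \<open>a\<^sub>0 \<otimes> \<dots> \<otimes> a\<^bsub>n-1\<^esub>\<close>; for \<open>i = n - 1\<close> it is cyclic, with value
  \<open>\<plusminus> a\<^bsub>n-1\<^esub>a\<^sub>0 \<otimes> a\<^sub>1 \<otimes> \<dots> \<otimes> a\<^bsub>n-2\<^esub>\<close> and the Koszul sign of the cyclic permutation.
\<close>

definition face :: "'a dga \<Rightarrow> nat \<Rightarrow> nat \<Rightarrow> int \<Rightarrow> 'a tens \<Rightarrow> 'a tens" where
  "face A n i = (\<lambda>j. tlift A n j (tgrp A (n - 1) j) (\<lambda>xs.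
     if i + 1 < n
     then pure A (take i xs @ mulh A (xs ! i) (xs ! (i + 1)) # drop (i + 2) xs)
     else kos (tgrp A (n - 1) j) (fst (last xs) * wt (butlast xs))
            (pure A (mulh A (last xs) (hd xs) # tl (butlast xs)))))"


section \<open>The Hochschild complex of a dg-functor\<close>

text \<open>
  \<open>C(\<Phi>)(0) = \<Oplus>\<^bsub>n\<ge>1\<^esub> \<Phi>(n)[n - 1]\<close>. The shift is \<open>\<Phi>(n) \<otimes> \<int>[n - 1]\<close>, with the suspension on
  the right: on \<open>x \<in> \<Phi>(n)\<close> the differential is
  \<open>d x + (-1)\<^bsup>|x|\<^esup> \<Sum>\<^bsub>i<n\<^esub> (-1)\<^bsup>n-i\<^esup> \<Phi>(face n i) x\<close> where \<open>|x|\<close> is the degree in \<open>\<Phi>(n)\<close>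
  (no Hochschild term for \<open>n = 1\<close>), and a natural transformation \<open>\<eta>\<close> of degree \<open>e\<close> acts as
  \<open>(-1)\<^bsup>e(n-1)\<^esup> \<eta> n\<close>. Below, the component in \<open>\<Phi>(n)\<close> of the differential of \<open>x\<close> receives the
  Hochschild term from \<open>\<Phi>(n + 1)\<close>.
\<close>

definition hoch ::
  "'a dga \<Rightarrow> (nat, int \<Rightarrow> 'a tens \<Rightarrow> 'a tens, 'u) dgfun \<Rightarrow> (nat \<Rightarrow> 'u) ch" where
  "hoch A \<Phi> =
     \<lparr>grp = (\<lambda>k. sum_group {1..} (\<lambda>n. grp (obj \<Phi> n) (k - int n + 1))),
      dif = (\<lambda>k x. \<lambda>n\<in>{1..}.
        dif (obj \<Phi> n) (k - int n + 1) (x n) \<otimes>\<^bsub>grp (obj \<Phi> n) (k - int n)\<^esub>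
        finprod (grp (obj \<Phi> n) (k - int n))
          (\<lambda>i. kos (grp (obj \<Phi> n) (k - int n)) ((k - int n) + (int (n + 1) - int i))
             (mor \<Phi> (n + 1) n 0 (face A (n + 1) i) (k - int n) (x (n + 1))))
          {..<n + 1})\<rparr>"

text \<open>The dg-functor \<open>\<Phi> \<mapsto> C(\<Phi>)(0)\<close> from \<open>Fun(End(A), Ch)\<close> to \<open>Ch\<close>.\<close>

definition hoch_fun ::
  "'a dga \<Rightarrow> ((nat, int \<Rightarrow> 'a tens \<Rightarrow> 'a tens, 'u) dgfun, nat \<Rightarrow> int \<Rightarrow> 'u \<Rightarrow> 'u, nat \<Rightarrow> 'u) dgfun" where
  "hoch_fun A =
     \<lparr>obj = hoch A,
      mor = (\<lambda>\<Phi> \<Psi> e \<eta> k. \<lambda>x\<in>carrier (grp (hoch A \<Phi>) k). \<lambda>n\<in>{1..}.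
        kos (grp (obj \<Psi> n) (k - int n + 1 + e)) (e * (int n - 1)) (\<eta> n (k - int n + 1) (x n)))\<rparr>"

text \<open>\<open>Nat\<^bsub>End(A)\<^esub>((1,0),(1,0))\<close>\<close>

definition Nat_End ::
  "'a dga \<Rightarrow> ((nat, int \<Rightarrow> 'a tens \<Rightarrow> 'a tens, 'u) dgfun \<Rightarrow> int \<Rightarrow> (nat \<Rightarrow> 'u) \<Rightarrow> (nat \<Rightarrow> 'u)) ch" where
  "Nat_End A = nat_ch (fun_cat (End_cat A)) (hoch_fun A) (hoch_fun A)"

text \<open>The tautological \<open>End(A)\<close>-algebra \<open>n \<mapsto> A\<^bsup>\<otimes>n\<^esup>\<close>, and \<open>C\<^sub>*(A, A)\<close>.\<close>

definition taut :: "'a dga \<Rightarrow> (nat, int \<Rightarrow> 'a tens \<Rightarrow> 'a tens, 'a tens) dgfun" where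
  "taut A = \<lparr>obj = tpow A, mor = (\<lambda>p q r f. f)\<rparr>"

definition hoch_chains :: "'a dga \<Rightarrow> (nat \<Rightarrow> 'a tens) ch" where
  "hoch_chains A = hoch A (taut A)"

text \<open>Transport of a functor along an injection \<open>e\<close> of its universe into another one.\<close>

definition ch_image :: "('a \<Rightarrow> 'u) \<Rightarrow> 'a ch \<Rightarrow> 'u ch" where
  "ch_image e V =
     \<lparr>grp = (\<lambda>k.
        \<lparr>carrier = e ` carrier (grp V k),
         monoid.mult = (\<lambda>x y. e (the_inv e x \<otimes>\<^bsub>grp V k\<^esub> the_inv e y)),
         one = e \<one>\<^bsub>grp V k\<^esub>\<rparr>),
      dif = (\<lambda>k x. e (dif V k (the_inv e x)))\<rparr>"

definition dgfun_image :: "('a \<Rightarrow> 'u) \<Rightarrow> ('o, 'h, 'a) dgfun \<Rightarrow> ('o, 'h, 'u) dgfun" where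
  "dgfun_image e \<Phi> =
     \<lparr>obj = (\<lambda>x. ch_image e (obj \<Phi> x)),
      mor = (\<lambda>x y r f k. \<lambda>v\<in>carrier (grp (ch_image e (obj \<Phi> x)) k).
        e (mor \<Phi> x y r f k (the_inv e v)))\<rparr>"

definition push :: "('a \<Rightarrow> 'u) \<Rightarrow> (nat \<Rightarrow> 'a) \<Rightarrow> nat \<Rightarrow> 'u" where
  "push e x = (\<lambda>n\<in>{1..}. e (x n))"


section \<open>Hochschild cochains and the cap product\<close>

text \<open>
  For \<open>D\<close> in \<open>Hom(A\<^bsup>\<otimes>q\<^esup>, A)\<close> of degree \<open>r\<close>, \<open>hcoch_int A q r D = d \<circ> D - (-1)\<^sup>r D \<circ> d\<close>, and
  \<open>hcoch_ext A q r D\<close> maps \<open>a\<^sub>1 \<otimes> \<dots> \<otimes> a\<^bsub>q+1\<^esub>\<close> to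
  \<open>(-1)\<^bsup>r|a\<^sub>1|\<^esup> a\<^sub>1D(a\<^sub>2,\<dots>) + \<Sum>\<^bsub>1\<le>i\<le>q\<^esub> (-1)\<^sup>i D(\<dots>,a\<^sub>ia\<^bsub>i+1\<^esub>,\<dots>) + (-1)\<^bsup>q+1\<^esup> D(a\<^sub>1,\<dots>,a\<^sub>q)a\<^bsub>q+1\<^esub>\<close>.
\<close>

definition hcoch_int :: "'a dga \<Rightarrow> nat \<Rightarrow> int \<Rightarrow> (int \<Rightarrow> 'a tens \<Rightarrow> 'a) \<Rightarrow> int \<Rightarrow> 'a tens \<Rightarrow> 'a" where
  "hcoch_int A q r D = (\<lambda>k. \<lambda>x\<in>carrier (tgrp A q k).
     dif A (k + r) (D k x) \<otimes>\<^bsub>grp A (k + r - 1)\<^esub>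
       kos (grp A (k + r - 1)) (r + 1) (D (k - 1) (dif (tpow A q) k x)))"

definition app :: "'a dga \<Rightarrow> int \<Rightarrow> (int \<Rightarrow> 'a tens \<Rightarrow> 'a) \<Rightarrow> (int \<times> 'a) list \<Rightarrow> int \<times> 'a" where
  "app A r D xs = (wt xs + r, D (wt xs) (pure A xs))"

definition hcoch_ext :: "'a dga \<Rightarrow> nat \<Rightarrow> int \<Rightarrow> (int \<Rightarrow> 'a tens \<Rightarrow> 'a) \<Rightarrow> int \<Rightarrow> 'a tens \<Rightarrow> 'a" where
  "hcoch_ext A q r D = (\<lambda>k. tlift A (q + 1) k (grp A (k + r)) (\<lambda>xs.
     kos (grp A (k + r)) (r * fst (hd xs)) (snd (mulh A (hd xs) (app A r D (tl xs))))
     \<otimes>\<^bsub>grp A (k + r)\<^esub>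
     finprod (grp A (k + r))
       (\<lambda>i. kos (grp A (k + r)) (int i)
          (snd (app A r D (take (i - 1) xs @ mulh A (xs ! (i - 1)) (xs ! i) # drop (i + 1) xs))))
       {1..q}
     \<otimes>\<^bsub>grp A (k + r)\<^esub>
     kos (grp A (k + r)) (int q + 1) (snd (mulh A (app A r D (butlast xs)) (last xs)))))"

text \<open>
  \<open>C\<^sup>*(A, A)\<close>, graded homologically: its degree \<open>l\<close> part is the product over \<open>q \<ge> 0\<close> of the degree
  \<open>l + q\<close> parts of \<open>C\<^sup>q(A, A) = Hom(A\<^bsup>\<otimes>q\<^esup>, A)\<close>. The differential is
  \<open>hcoch_int D + (-1)\<^bsup>|D|\<^esup> hcoch_ext D\<close>, \<open>|D|\<close> being the degree of \<open>D\<close> in \<open>Hom(A\<^bsup>\<otimes>q\<^esup>, A)\<close>.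
\<close>

definition hoch_cochains :: "'a dga \<Rightarrow> (nat \<Rightarrow> int \<Rightarrow> 'a tens \<Rightarrow> 'a) ch" where
  "hoch_cochains A =
     \<lparr>grp = (\<lambda>l. product_group UNIV (\<lambda>q. grp (Hom_ch (tpow A q) A) (l + int q))),
      dif = (\<lambda>l D q.
        if q = 0 then hcoch_int A 0 l (D 0)
        else hcoch_int A q (l + int q) (D q) \<otimes>\<^bsub>grp (Hom_ch (tpow A q) A) (l + int q - 1)\<^esub>
          kos (grp (Hom_ch (tpow A q) A) (l + int q - 1)) (l + int q - 1)
            (hcoch_ext A (q - 1) (l + int q - 1) (D (q - 1))))\<rparr>"

text \<open>
  Cap product of \<open>a \<in> C\<^sub>p(A, A)\<close> with \<open>D\<close> in \<open>Hom(A\<^bsup>\<otimes>q\<^esup>, A)\<close> of degree \<open>r\<close>, for \<open>q \<le> p\<close>: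
  \<open>a \<inter> D = (-1)\<^bsup>(|a|-|a\<^sub>0|)|D|\<^esup> a\<^sub>0D(a\<^sub>1,\<dots>,a\<^sub>q) \<otimes> a\<^bsub>q+1\<^esub> \<otimes> \<dots> \<otimes> a\<^sub>p\<close>.
  Here \<open>|a| = j + p\<close> is the degree of \<open>a\<close> in \<open>C\<^sub>*(A, A)\<close> (\<open>j\<close> being its degree in \<open>A\<^bsup>\<otimes>p+1\<^esup>\<close>) and
  \<open>|D| = r\<close>. With the differentials above this is the reading that makes the cap product a chain map.
\<close>

definition cap_hom ::
  "'a dga \<Rightarrow> nat \<Rightarrow> nat \<Rightarrow> int \<Rightarrow> (int \<Rightarrow> 'a tens \<Rightarrow> 'a) \<Rightarrow> int \<Rightarrow> 'a tens \<Rightarrow> 'a tens" where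
  "cap_hom A p q r D = (\<lambda>j. tlift A (p + 1) j (tgrp A (p + 1 - q) (j + r)) (\<lambda>xs.
     kos (tgrp A (p + 1 - q) (j + r)) ((j + int p - fst (hd xs)) * r)
       (pure A (mulh A (hd xs) (app A r D (take q (tl xs))) # drop (q + 1) xs))))"

text \<open>
  The cap product of \<open>x\<close> of degree \<open>k\<close> in \<open>C\<^sub>*(A, A)\<close> and \<open>D\<close> of degree \<open>l\<close> in \<open>C\<^sup>*(A, A)\<close>: its
  component in \<open>A\<^bsup>\<otimes>m\<^esup>\<close> collects \<open>x\<^sub>p \<inter> D\<^sub>q\<close> for \<open>p - q + 1 = m\<close>, where \<open>x\<^sub>p\<close> is \<open>x (p + 1)\<close>.
\<close>

definition cap ::
  "'a dga \<Rightarrow> int \<Rightarrow> int \<Rightarrow> (nat \<Rightarrow> 'a tens) \<Rightarrow> (nat \<Rightarrow> int \<Rightarrow> 'a tens \<Rightarrow> 'a) \<Rightarrow> nat \<Rightarrow> 'a tens" where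
  "cap A k l x D = (\<lambda>m\<in>{1..}.
     gfinprod (tgrp A m (k + l - int m + 1))
       (\<lambda>q. cap_hom A (m + q - 1) q (l + int q) (D q) (k - int (m + q) + 1) (x (m + q)))
       UNIV)"

end

theory Submission
  imports Defs
begin

text \<open>
  A cochain \<open>D \<in> Hom(A\<^bsup>\<otimes>q\<^esup>, A)\<close> of degree \<open>r\<close> defines, for every \<open>m \<ge> 1\<close>, a morphism of degree \<open>r\<close> from
  \<open>m + q\<close> to \<open>m\<close> in the endomorphism prop, namely
  \<open>a\<^sub>0 \<otimes> \<dots> \<otimes> a\<^bsub>m+q-1\<^esub> \<mapsto> \<plusminus> a\<^sub>0D(a\<^sub>1,\<dots>,a\<^sub>q) \<otimes> a\<^bsub>q+1\<^esub> \<otimes> \<dots> \<otimes> a\<^bsub>m+q-1\<^esub>\<close> (\<open>cap_mor\<close>). So the formula of the cap product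
  makes sense for every dg-functor \<open>\<Phi>\<close> on \<open>End(A)\<close> instead of \<open>n \<mapsto> A\<^bsup>\<otimes>n\<^esup>\<close>: the images of these morphisms
  under \<open>\<Phi>\<close> are maps \<open>\<Phi>(m + q) \<rightarrow> \<Phi>(m)\<close>, and their sum is an endomorphism of \<open>C(\<Phi>)(0)\<close>. This is
  \<open>F(D)\<close>, called \<open>cap_nat\<close> below. It is natural in \<open>\<Phi>\<close> because a natural transformation commutes, up to
  the Koszul sign, with the image of any morphism of the prop (\<open>cap_nat_natural\<close>), and on \<open>A\<close> itself it is
  the cap product (\<open>cap_nat_taut\<close>).

  That \<open>F\<close> is a chain map is the Leibniz rule of the cap product, in the form of two identities between
  morphisms of the prop. Up to sign, the internal differential of \<open>cap_mor D\<close> is \<open>cap_mor\<close> of the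
  internal differential of \<open>D\<close> (\<open>cap_mor_hcoch_int\<close>), and the alternating sum of the composites of
  \<open>cap_mor D\<close> with the face morphisms on either side is \<open>cap_mor\<close> of the Hochschild coboundary of \<open>D\<close>
  (\<open>cap_mor_hcoch_ext\<close>). Both are verified on pure tensors. A dg-functor carries them over to
  \<open>C(\<Phi>)(0)\<close>, where they add up to \<open>F(dD) = d(F(D))\<close> (\<open>cap_nat_dif\<close>).

  The component in \<open>A\<close> of the cap product of \<open>a \<otimes> a\<^sub>1 \<otimes> \<dots> \<otimes> a\<^sub>q\<close> with \<open>D\<close> is \<open>\<plusminus> aD(a\<^sub>1,\<dots>,a\<^sub>q)\<close>. Hence \<open>F(D)\<close>
  determines \<open>D\<close> as soon as an element \<open>x\<close> of \<open>A\<close> with \<open>Ax = 0\<close> must vanish. Conversely such an \<open>x\<close> is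
  a cochain of arity \<open>0\<close> with \<open>F(x) = 0\<close>. This is \<open>cap_nat_inj_iff\<close>.

  The groundwork concerns maps out of \<open>A\<^bsup>\<otimes>n\<^esup>\<close>. They correspond to functions of lists of homogeneous
  elements that are additive in each entry (\<open>tlift_hom_pure\<close>), and such functions are closed under
  the insertion of an operation, such as the multiplication, the differential or a cochain, into a block
  of neighbouring entries (\<open>multiadditive_insert_op\<close>).
\<close>


section \<open>Signs and finite products in commutative groups\<close>

lemma kos_zero [simp]: "kos G 0 x = x"
  by (simp add: kos_def)

context comm_group
begin

lemma kos_closed [simp]: "x \<in> carrier G \<Longrightarrow> kos G k x \<in> carrier G"
  by (simp add: kos_def)

lemma kos_one [simp]: "kos G k \<one> = \<one>"
  by (simp add: kos_def)

lemma kos_cong: "even (a - b) \<Longrightarrow> kos G a x = kos G b x"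
  by (simp add: kos_def)

lemma kos_kos: "x \<in> carrier G \<Longrightarrow> kos G a (kos G b x) = kos G (a + b) x"
  by (simp add: kos_def)

lemma kos_mult:
  "x \<in> carrier G \<Longrightarrow> y \<in> carrier G \<Longrightarrow> kos G a (x \<otimes> y) = kos G a x \<otimes> kos G a y"
  by (simp add: kos_def inv_mult)

lemma inv_eq_kos: "inv x = kos G 1 x"
  by (simp add: kos_def)

lemma kos_cancel: "x \<in> carrier G \<Longrightarrow> odd (a - b) \<Longrightarrow> kos G a x \<otimes> kos G b x = \<one>"
  by (auto simp: kos_def)

lemma kos_finprod:
  "f \<in> I \<rightarrow> carrier G \<Longrightarrow> kos G a (finprod G f I) = finprod G (\<lambda>i. kos G a (f i)) I"
proof (induction I rule: infinite_finite_induct)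
  case (insert i I)
  then show ?case by (simp add: kos_mult Pi_iff)
qed simp_all

lemma kos_eq_iff: "x \<in> carrier G \<Longrightarrow> y \<in> carrier G \<Longrightarrow> kos G a x = kos G a y \<longleftrightarrow> x = y"
  using inv_inj by (auto simp: kos_def inj_on_def)

lemma finprod_in: "(\<And>i. i \<in> I \<Longrightarrow> f i \<in> carrier G) \<Longrightarrow> finprod G f I \<in> carrier G"
  by (auto intro: finprod_closed)

lemma finprod_eq:
  "(\<And>i. i \<in> I \<Longrightarrow> g i \<in> carrier G) \<Longrightarrow> (\<And>i. i \<in> I \<Longrightarrow> f i = g i) \<Longrightarrow> finprod G f I = finprod G g I"
  by (rule finprod_cong') auto

lemma finprod_mult:
  "(\<And>i. i \<in> I \<Longrightarrow> f i \<in> carrier G) \<Longrightarrow> (\<And>i. i \<in> I \<Longrightarrow> g i \<in> carrier G) \<Longrightarrow>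
   finprod G (\<lambda>i. f i \<otimes> g i) I = finprod G f I \<otimes> finprod G g I"
  by (rule finprod_multf) auto

lemma finprod_inv:
  assumes "\<And>i. i \<in> I \<Longrightarrow> f i \<in> carrier G"
  shows "inv (finprod G f I) = finprod G (\<lambda>i. inv f i) I"
  using kos_finprod[of f I 1] assms by (simp add: inv_eq_kos Pi_iff)

lemma kos_finprod_kos:
  assumes "\<And>i. i \<in> I \<Longrightarrow> f i \<in> carrier G" "\<And>i. i \<in> I \<Longrightarrow> even (a + s i - t i)"
  shows "kos G a (finprod G (\<lambda>i. kos G (s i) (f i)) I) = finprod G (\<lambda>i. kos G (t i) (f i)) I"
proof -
  have "kos G a (finprod G (\<lambda>i. kos G (s i) (f i)) I) = finprod G (\<lambda>i. kos G a (kos G (s i) (f i))) I"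
    using assms by (intro kos_finprod) auto
  also have "\<dots> = finprod G (\<lambda>i. kos G (t i) (f i)) I"
    using assms by (intro finprod_eq) (auto simp: kos_kos intro!: kos_cong)
  finally show ?thesis .
qed

lemma finprod_lessThan_add:
  fixes a b :: nat
  assumes "\<And>i. i < a + b \<Longrightarrow> f i \<in> carrier G"
  shows "finprod G f {..<a + b} = finprod G f {..<a} \<otimes> finprod G (\<lambda>i. f (a + i)) {..<b}"
  using assms
proof (induction b)
  case 0
  then have "finprod G f {..<a} \<in> carrier G" by (intro finprod_in) auto
  then show ?case by simp
next
  case (Suc b)
  have c: "finprod G f {..<a} \<in> carrier G" "finprod G (\<lambda>i. f (a + i)) {..<b} \<in> carrier G"
    using Suc.prems by (auto intro!: finprod_in)
  have "finprod G f {..<a + Suc b} = f (a + b) \<otimes> finprod G f {..<a + b}"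
    using Suc.prems by (simp add: lessThan_Suc Pi_iff)
  also have "\<dots> = finprod G f {..<a} \<otimes> (f (a + b) \<otimes> finprod G (\<lambda>i. f (a + i)) {..<b})"
    using Suc c by (simp add: m_lcomm)
  also have "f (a + b) \<otimes> finprod G (\<lambda>i. f (a + i)) {..<b} = finprod G (\<lambda>i. f (a + i)) {..<Suc b}"
    using Suc.prems by (simp add: lessThan_Suc Pi_iff)
  finally show ?case .
qed

lemma finprod_lessThan_Suc_shift:
  fixes n :: nat
  assumes "\<And>i. i < Suc n \<Longrightarrow> f i \<in> carrier G"
  shows "finprod G f {..<Suc n} = f 0 \<otimes> finprod G (\<lambda>i. f (Suc i)) {..<n}"
  using finprod_lessThan_add[of 1 n f] assms by (simp add: lessThan_Suc)

text \<open>
  The pattern of the simplicial cancellation: all terms of the first sum but its first one cancel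
  against the tail of the second sum.
\<close>

lemma finprod_telescope:
  fixes m q :: nat
  assumes L: "\<And>i. i < Suc m \<Longrightarrow> L i \<in> carrier G" and R: "\<And>i. i < Suc (q + m) \<Longrightarrow> R i \<in> carrier G"
    and LR: "\<And>i. 1 \<le> i \<Longrightarrow> i \<le> m \<Longrightarrow> L i \<otimes> R (q + i) = \<one>"
  shows "finprod G L {..<Suc m} \<otimes> finprod G R {..<Suc (q + m)} = L 0 \<otimes> finprod G R {..<Suc q}"
proof -
  have c: "finprod G R {..<Suc q} \<in> carrier G" "finprod G (\<lambda>i. L (Suc i)) {..<m} \<in> carrier G"
    "finprod G (\<lambda>i. R (Suc q + i)) {..<m} \<in> carrier G" "L 0 \<in> carrier G"
    using L R by (auto intro!: finprod_in)
  have "finprod G (\<lambda>i. L (Suc i)) {..<m} \<otimes> finprod G (\<lambda>i. R (Suc q + i)) {..<m} =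
      finprod G (\<lambda>i. L (Suc i) \<otimes> R (Suc q + i)) {..<m}"
    using L R by (intro finprod_mult[symmetric]) auto
  also have "\<dots> = \<one>" using LR[of "Suc _"] by (intro finprod_one_eqI) auto
  finally have 1: "finprod G (\<lambda>i. L (Suc i)) {..<m} \<otimes> finprod G (\<lambda>i. R (Suc q + i)) {..<m} = \<one>" .
  have "finprod G L {..<Suc m} = L 0 \<otimes> finprod G (\<lambda>i. L (Suc i)) {..<m}"
    using L by (rule finprod_lessThan_Suc_shift)
  moreover have "finprod G R {..<Suc (q + m)} = finprod G R {..<Suc q} \<otimes> finprod G (\<lambda>i. R (Suc q + i)) {..<m}"
    using finprod_lessThan_add[of "Suc q" m R] R by simp
  ultimately have "finprod G L {..<Suc m} \<otimes> finprod G R {..<Suc (q + m)} =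
     (L 0 \<otimes> finprod G R {..<Suc q}) \<otimes> (finprod G (\<lambda>i. L (Suc i)) {..<m} \<otimes> finprod G (\<lambda>i. R (Suc q + i)) {..<m})"
    using c by (simp add: m_ac)
  then show ?thesis using 1 c by simp
qed

lemma cancel_ends:
  assumes "x \<in> carrier G" "y \<in> carrier G" "z \<in> carrier G" "v \<in> carrier G"
  shows "(x \<otimes> y \<otimes> z) \<otimes> inv (x \<otimes> v \<otimes> z) = y \<otimes> inv v"
proof -
  have "(x \<otimes> y \<otimes> z) \<otimes> inv (x \<otimes> v \<otimes> z) = (x \<otimes> inv x) \<otimes> (z \<otimes> inv z) \<otimes> (y \<otimes> inv v)"
    using assms by (simp only: inv_mult m_ac m_closed inv_closed)
  then show ?thesis using assms by simp
qed

lemma finprod_swap: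
  assumes "finite I" "finite J" "\<And>i j. i \<in> I \<Longrightarrow> j \<in> J \<Longrightarrow> f i j \<in> carrier G"
  shows "finprod G (\<lambda>i. finprod G (f i) J) I = finprod G (\<lambda>j. finprod G (\<lambda>i. f i j) I) J"
  using assms(1,3)
proof (induction I rule: finite_induct)
  case (insert i I)
  have c: "finprod G (f i') J \<in> carrier G" if "i' \<in> insert i I" for i'
    using insert.prems that by (intro finprod_in) auto
  have "finprod G (\<lambda>i. finprod G (f i) J) (insert i I) = finprod G (f i) J \<otimes> finprod G (\<lambda>i. finprod G (f i) J) I"
    using insert.hyps c by (intro finprod_insert) auto
  also have "\<dots> = finprod G (f i) J \<otimes> finprod G (\<lambda>j. finprod G (\<lambda>i. f i j) I) J"
    using insert by simp
  also have "\<dots> = finprod G (\<lambda>j. f i j \<otimes> finprod G (\<lambda>i. f i j) I) J"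
    using insert.prems by (intro finprod_mult[symmetric] finprod_in) auto
  also have "\<dots> = finprod G (\<lambda>j. finprod G (\<lambda>i. f i j) (insert i I)) J"
    using insert.hyps insert.prems
    by (intro finprod_eq finprod_insert[symmetric] finprod_in) auto
  finally show ?case .
qed simp


text \<open>
  The boundary of a cap product minus the cap product of the boundary, regrouped such that each
  arity \<open>q\<close> of a cochain carries its own internal and its own Hochschild difference.
\<close>

lemma finprod_quotient:
  fixes N :: nat
  assumes "\<And>q. q < N \<Longrightarrow> a q \<in> carrier G" "\<And>q. q < N \<Longrightarrow> b q \<in> carrier G"
    "\<And>q. q < N \<Longrightarrow> a' q \<in> carrier G" "\<And>q. q < N \<Longrightarrow> b' q \<in> carrier G"
  shows "kos G k ((finprod G a {..<N} \<otimes> finprod G b {..<N}) \<otimes> inv (finprod G (\<lambda>q. a' q \<otimes> b' q) {..<N})) =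
    finprod G (\<lambda>q. kos G k (a q \<otimes> inv (a' q))) {..<N} \<otimes> finprod G (\<lambda>q. kos G k (b q \<otimes> inv (b' q))) {..<N}"
proof -
  have quot: "finprod G (\<lambda>q. kos G k (c q \<otimes> inv (c' q))) {..<N} = kos G k (finprod G c {..<N} \<otimes> inv (finprod G c' {..<N}))"
    if "\<And>q. q < N \<Longrightarrow> c q \<in> carrier G" "\<And>q. q < N \<Longrightarrow> c' q \<in> carrier G" for c c'
  proof -
    have "kos G k (finprod G (\<lambda>q. c q \<otimes> inv (c' q)) {..<N}) = finprod G (\<lambda>q. kos G k (c q \<otimes> inv (c' q))) {..<N}"
      using that by (intro kos_finprod) auto
    moreover have "finprod G (\<lambda>q. c q \<otimes> inv (c' q)) {..<N} = finprod G c {..<N} \<otimes> finprod G (\<lambda>q. inv (c' q)) {..<N}"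
      using that by (intro finprod_mult) auto
    moreover have "finprod G (\<lambda>q. inv (c' q)) {..<N} = inv (finprod G c' {..<N})"
      using that by (intro finprod_inv[symmetric]) auto
    ultimately show ?thesis by simp
  qed
  have c: "finprod G a {..<N} \<in> carrier G" "finprod G b {..<N} \<in> carrier G"
    "finprod G a' {..<N} \<in> carrier G" "finprod G b' {..<N} \<in> carrier G"
    using assms by (auto intro!: finprod_in)
  have "finprod G (\<lambda>q. a' q \<otimes> b' q) {..<N} = finprod G a' {..<N} \<otimes> finprod G b' {..<N}"
    using assms by (intro finprod_mult) auto
  moreover have "(x \<otimes> y) \<otimes> inv (x' \<otimes> y') = (x \<otimes> inv x') \<otimes> (y \<otimes> inv y')"
    if "x \<in> carrier G" "y \<in> carrier G" "x' \<in> carrier G" "y' \<in> carrier G" for x y x' y'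
    using that by (simp only: inv_mult m_ac m_closed inv_closed)
  ultimately show ?thesis
    using assms c by (simp add: quot kos_mult)
qed

text \<open>This is how \<open>d\<^sup>2 = 0\<close> on a tensor power reduces to \<open>d\<^sup>2 = 0\<close> on the factors.\<close>

lemma finprod_antisymmetric:
  fixes n :: nat
  assumes "\<And>i j. i < n \<Longrightarrow> j < n \<Longrightarrow> f i j \<in> carrier G"
    and "\<And>i j. i < j \<Longrightarrow> j < n \<Longrightarrow> f i j \<otimes> f j i = \<one>" and "\<And>i. i < n \<Longrightarrow> f i i = \<one>"
  shows "finprod G (\<lambda>i. finprod G (f i) {..<n}) {..<n} = \<one>"
  using assms
proof (induction n)
  case (Suc n)
  have c: "finprod G (f i) {..<n} \<in> carrier G" if "i \<le> n" for i
    using Suc.prems(1) that by (intro finprod_in) auto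
  have "finprod G (\<lambda>i. finprod G (f i) {..<Suc n}) {..<n}
      = finprod G (\<lambda>i. f i n \<otimes> finprod G (f i) {..<n}) {..<n}"
    using Suc.prems(1) c by (intro finprod_eq) (auto simp: lessThan_Suc Pi_iff)
  also have "\<dots> = finprod G (\<lambda>i. f i n) {..<n} \<otimes> finprod G (\<lambda>i. finprod G (f i) {..<n}) {..<n}"
    using Suc.prems(1) c by (intro finprod_mult) auto
  also have "\<dots> = finprod G (\<lambda>i. f i n) {..<n}"
    using Suc by (simp add: Pi_iff)
  finally have 1: "finprod G (\<lambda>i. finprod G (f i) {..<Suc n}) {..<n} = finprod G (\<lambda>i. f i n) {..<n}" .
  have "finprod G (\<lambda>i. finprod G (f i) {..<Suc n}) {..<Suc n}
      = finprod G (f n) {..<Suc n} \<otimes> finprod G (\<lambda>i. finprod G (f i) {..<Suc n}) {..<n}"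
    unfolding lessThan_Suc[of n] by (rule finprod_insert) (use Suc.prems(1) c in \<open>auto intro!: finprod_in\<close>)
  also have "finprod G (f n) {..<Suc n} = finprod G (f n) {..<n}"
    using Suc.prems(1,3) c by (simp add: lessThan_Suc Pi_iff)
  also have "\<dots> \<otimes> finprod G (\<lambda>i. finprod G (f i) {..<Suc n}) {..<n}
      = finprod G (\<lambda>i. f n i \<otimes> f i n) {..<n}"
    unfolding 1 using Suc.prems(1) by (intro finprod_mult[symmetric]) auto
  also have "\<dots> = \<one>"
    using Suc.prems(1,2) by (intro finprod_one_eqI) (auto simp: m_comm)
  finally show ?case .
qed simp

end

lemma hom_kos:
  assumes "h \<in> hom G H" "group G" "group H" "x \<in> carrier G"
  shows "h (kos G a x) = kos H a (h x)"
proof -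
  interpret group_hom G H h using assms by (simp add: group_hom_def group_hom_axioms_def)
  show ?thesis using assms(4) by (simp add: kos_def)
qed

lemma hom_m_inv:
  assumes "h \<in> hom G H" "group G" "group H" "x \<in> carrier G"
  shows "h (inv\<^bsub>G\<^esub> x) = inv\<^bsub>H\<^esub> (h x)"
  using assms by (simp add: group_hom.hom_inv group_hom_def group_hom_axioms_def)

lemma hom_finprod:
  assumes "h \<in> hom G H" "comm_group G" "comm_group H" "\<And>i. i \<in> I \<Longrightarrow> f i \<in> carrier G"
  shows "h (finprod G f I) = finprod H (\<lambda>i. h (f i)) I"
proof -
  interpret G: comm_group G by fact
  interpret H: comm_group H by fact
  interpret group_hom G H h
    using assms by (simp add: group_hom_def group_hom_axioms_def G.is_group H.is_group)
  show ?thesis using assms(4)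
    by (induction I rule: infinite_finite_induct) (auto simp: Pi_iff)
qed

lemma hom_finprod_kos:
  assumes "h \<in> hom G H" "comm_group G" "comm_group H" "\<And>i. i \<in> I \<Longrightarrow> f i \<in> carrier G"
  shows "h (finprod G (\<lambda>i. kos G (s i) (f i)) I) = finprod H (\<lambda>i. kos H (s i) (h (f i))) I"
proof -
  interpret G: comm_group G by fact
  interpret H: comm_group H by fact
  have "h (finprod G (\<lambda>i. kos G (s i) (f i)) I) = finprod H (\<lambda>i. h (kos G (s i) (f i))) I"
    using assms(4) by (intro hom_finprod[OF assms(1-3)]) auto
  also have "\<dots> = finprod H (\<lambda>i. kos H (s i) (h (f i))) I"
    using assms(4) hom_in_carrier[OF assms(1)]
    by (intro H.finprod_eq) (auto simp: hom_kos[OF assms(1) G.is_group H.is_group])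
  finally show ?thesis .
qed

lemma hom_times:
  assumes "f \<in> hom G H" "g \<in> hom G H" "comm_group H"
  shows "(\<lambda>x. f x \<otimes>\<^bsub>H\<^esub> g x) \<in> hom G H"
proof -
  interpret H: comm_group H by fact
  show ?thesis using assms(1,2) by (auto simp: hom_def Pi_iff H.m_ac)
qed

lemma hom_kos_comp:
  assumes "f \<in> hom G H" "comm_group H"
  shows "(\<lambda>x. kos H a (f x)) \<in> hom G H"
proof -
  interpret H: comm_group H by fact
  show ?thesis using assms(1) by (auto simp: hom_def Pi_iff H.kos_mult)
qed

lemma hom_comp:
  assumes "f \<in> hom G H" "g \<in> hom H K"
  shows "(\<lambda>x. g (f x)) \<in> hom G K"
  using hom_compose[OF assms] by (simp add: comp_def)


section \<open>Homomorphisms out of tensor powers\<close>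

text \<open>
  A function on lists of homogeneous elements that factors through the degree \<open>k\<close> part of
  \<open>A\<^bsup>\<otimes>n\<^esup>\<close>.
\<close>

definition multiadditive ::
  "('a, 'm) ch_scheme \<Rightarrow> nat \<Rightarrow> int \<Rightarrow> ('b, 'n) monoid_scheme \<Rightarrow> ((int \<times> 'a) list \<Rightarrow> 'b) \<Rightarrow> bool" where
  "multiadditive A n k H \<phi> \<longleftrightarrow>
     (\<forall>xs\<in>tgens A n k. \<phi> xs \<in> carrier H) \<and>
     (\<forall>us i a b vs. us @ (i, a) # vs \<in> tgens A n k \<longrightarrow> us @ (i, b) # vs \<in> tgens A n k \<longrightarrow>
        \<phi> (us @ (i, a \<otimes>\<^bsub>grp A i\<^esub> b) # vs) =
        \<phi> (us @ (i, a) # vs) \<otimes>\<^bsub>H\<^esub> \<phi> (us @ (i, b) # vs))"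

lemma multiadditiveI:
  assumes "\<And>xs. xs \<in> tgens A n k \<Longrightarrow> \<phi> xs \<in> carrier H"
    and "\<And>us i a b vs. us @ (i, a) # vs \<in> tgens A n k \<Longrightarrow> us @ (i, b) # vs \<in> tgens A n k \<Longrightarrow>
        \<phi> (us @ (i, a \<otimes>\<^bsub>grp A i\<^esub> b) # vs) =
        \<phi> (us @ (i, a) # vs) \<otimes>\<^bsub>H\<^esub> \<phi> (us @ (i, b) # vs)"
  shows "multiadditive A n k H \<phi>"
  using assms unfolding multiadditive_def by blast

lemma multiadditive_closed: "multiadditive A n k H \<phi> \<Longrightarrow> xs \<in> tgens A n k \<Longrightarrow> \<phi> xs \<in> carrier H"
  unfolding multiadditive_def by blast

lemma multiadditive_mult:
  "multiadditive A n k H \<phi> \<Longrightarrow> us @ (i, a) # vs \<in> tgens A n k \<Longrightarrow> us @ (i, b) # vs \<in> tgens A n k \<Longrightarrow>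
    \<phi> (us @ (i, a \<otimes>\<^bsub>grp A i\<^esub> b) # vs) = \<phi> (us @ (i, a) # vs) \<otimes>\<^bsub>H\<^esub> \<phi> (us @ (i, b) # vs)"
  unfolding multiadditive_def by blast

lemma tgens_append:
  "xs @ ys \<in> tgens A n k \<longleftrightarrow>
     length xs \<le> n \<and> xs \<in> tgens A (length xs) (wt xs) \<and> ys \<in> tgens A (n - length xs) (k - wt xs)"
  by (auto simp: tgens_def wt_def)

lemma tgens_Cons:
  "(i, a) # xs \<in> tgens A n k \<longleftrightarrow> n > 0 \<and> a \<in> carrier (grp A i) \<and> xs \<in> tgens A (n - 1) (k - i)"
  by (auto simp: tgens_def wt_def)

lemma wt_simps [simp]: "wt [] = 0" "wt (x # xs) = fst x + wt xs" "wt (xs @ ys) = wt xs + wt ys"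
  by (auto simp: wt_def)

locale graded_group =
  fixes A :: "('a, 'm) ch_scheme"
  assumes groups: "comm_group (grp A i)"
begin

lemma trels_subset: "trels A n k \<subseteq> carrier (free_Abelian_group (tgens A n k))"
proof
  fix c assume "c \<in> trels A n k"
  then obtain us i a b vs where c: "c = frag_of (us @ (i, a \<otimes>\<^bsub>grp A i\<^esub> b) # vs)
        - frag_of (us @ (i, a) # vs) - frag_of (us @ (i, b) # vs)"
    and 1: "us @ (i, a) # vs \<in> tgens A n k" "us @ (i, b) # vs \<in> tgens A n k"
    unfolding trels_def by blast
  interpret comm_group "grp A i" by (rule groups)
  have 2: "us @ (i, a \<otimes>\<^bsub>grp A i\<^esub> b) # vs \<in> tgens A n k"
    using 1 by (auto simp: tgens_append tgens_Cons)
  show "c \<in> carrier (free_Abelian_group (tgens A n k))"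
    unfolding c carrier_free_Abelian_group_iff
    by (intro subset_trans[OF keys_diff] Un_least) (use 1 2 in auto)
qed

lemma tker_subgroup: "subgroup (tker A n k) (free_Abelian_group (tgens A n k))"
  unfolding tker_def by (rule group.generate_is_subgroup[OF group_free_Abelian_group trels_subset])

lemma tker_normal: "tker A n k \<lhd> free_Abelian_group (tgens A n k)"
  by (rule comm_group.subgroup_imp_normal[OF abelian_free_Abelian_group tker_subgroup])

lemma tgrp_comm_group: "comm_group (tgrp A n k)"
  unfolding tgrp_def
  by (rule comm_group.abelian_FactGroup[OF abelian_free_Abelian_group tker_subgroup])

lemma pure_hom:
  "(\<lambda>c. tker A n k #>\<^bsub>free_Abelian_group (tgens A n k)\<^esub> c) \<in> hom (free_Abelian_group (tgens A n k)) (tgrp A n k)"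
  unfolding tgrp_def by (rule normal.r_coset_hom_Mod[OF tker_normal])

lemma pure_eq:
  "xs \<in> tgens A n k \<Longrightarrow> pure A xs = tker A n k #>\<^bsub>free_Abelian_group (tgens A n k)\<^esub> frag_of xs"
  by (auto simp: pure_def tgens_def)

lemma pure_closed: "xs \<in> tgens A n k \<Longrightarrow> pure A xs \<in> carrier (tgrp A n k)"
  using hom_in_carrier[OF pure_hom, of "frag_of xs"] by (simp add: pure_eq)

text \<open>The pure tensors generate the tensor power.\<close>

lemma tgrp_hom_eqI:
  assumes f: "f \<in> hom (tgrp A n k) H" and g: "g \<in> hom (tgrp A n k) H" and H: "group H"
    and eq: "\<And>xs. xs \<in> tgens A n k \<Longrightarrow> f (pure A xs) = g (pure A xs)"
    and X: "X \<in> carrier (tgrp A n k)"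
  shows "f X = g X"
proof -
  let ?F = "free_Abelian_group (tgens A n k)"
  let ?p = "\<lambda>c. tker A n k #>\<^bsub>?F\<^esub> c"
  interpret T: comm_group "tgrp A n k" by (rule tgrp_comm_group)
  interpret F: group_hom "tgrp A n k" H f using f H by (simp add: group_hom_def group_hom_axioms_def)
  interpret G: group_hom "tgrp A n k" H g using g H by (simp add: group_hom_def group_hom_axioms_def)
  interpret p: group_hom ?F "tgrp A n k" ?p
    using pure_hom by (simp add: group_hom_def group_hom_axioms_def)
  obtain c where c: "Poly_Mapping.keys c \<subseteq> tgens A n k" and X: "X = ?p c"
    using X by (auto simp: tgrp_def FactGroup_def RCOSETS_def)
  have "f (?p c) = g (?p c)"
  proof (rule free_Abelian_group_induct[where P = "\<lambda>c. f (?p c) = g (?p c)", OF c])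
    show "f (?p 0) = g (?p 0)" using p.hom_one by simp
  next
    fix x y assume 3: "Poly_Mapping.keys x \<subseteq> tgens A n k" "Poly_Mapping.keys y \<subseteq> tgens A n k"
      "f (?p x) = g (?p x)" "f (?p y) = g (?p y)"
    then have xy: "x \<in> carrier ?F" "y \<in> carrier ?F" by simp_all
    have "?p (x - y) = ?p (x \<otimes>\<^bsub>?F\<^esub> inv\<^bsub>?F\<^esub> y)" using 3 by simp
    also have "\<dots> = ?p x \<otimes>\<^bsub>tgrp A n k\<^esub> inv\<^bsub>tgrp A n k\<^esub> ?p y"
      using xy by (simp del: mult_free_Abelian_group inv_free_Abelian_group carrier_free_Abelian_group_iff)
    finally show "f (?p (x - y)) = g (?p (x - y))"
      using 3 p.hom_closed[OF xy(1)] p.hom_closed[OF xy(2)] by simp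
  next
    fix a assume "a \<in> tgens A n k"
    then show "f (?p (frag_of a)) = g (?p (frag_of a))" using eq by (simp add: pure_eq)
  qed
  then show ?thesis using X by simp
qed

text \<open>
  The function \<open>\<phi>\<close> extends to the free abelian group, and by multiadditivity this extension kills the
  relations of the tensor power. Therefore the choice of a representative in \<open>tlift\<close> does not matter.
\<close>

lemma tlift_hom_pure:
  assumes H: "comm_group H" and \<phi>: "multiadditive A n k H \<phi>"
  shows "tlift A n k H \<phi> \<in> hom (tgrp A n k) H \<and>
    (\<forall>xs\<in>tgens A n k. tlift A n k H \<phi> (pure A xs) = \<phi> xs)"
proof -
  let ?S = "tgens A n k"
  let ?F = "free_Abelian_group ?S"
  let ?p = "\<lambda>c. tker A n k #>\<^bsub>?F\<^esub> c"
  interpret H: comm_group H by fact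
  have c\<phi>: "\<phi> xs \<in> carrier H" if "xs \<in> ?S" for xs using \<phi> that by (rule multiadditive_closed)
  define h where "h = (\<lambda>c :: (int \<times> 'a) list \<Rightarrow>\<^sub>0 int. finprod H (\<lambda>xs. \<phi> xs [^]\<^bsub>H\<^esub> poly_mapping.lookup c xs) (Poly_Mapping.keys c))"
  have h_gf: "h c = gfinprod H (\<lambda>xs. \<phi> xs [^]\<^bsub>H\<^esub> poly_mapping.lookup c xs) ?S"
    if c: "Poly_Mapping.keys c \<subseteq> ?S" for c
  proof -
    have "h c = gfinprod H (\<lambda>xs. \<phi> xs [^]\<^bsub>H\<^esub> poly_mapping.lookup c xs) (Poly_Mapping.keys c)"
      unfolding h_def using c c\<phi> by (intro H.gfinprod_eq_finprod[symmetric]) (auto intro!: H.int_pow_closed)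
    also have "\<dots> = gfinprod H (\<lambda>xs. \<phi> xs [^]\<^bsub>H\<^esub> poly_mapping.lookup c xs) ?S"
      using c c\<phi> by (intro H.gfinprod_mono_neutral_cong_left) (auto simp: in_keys_iff)
    finally show ?thesis .
  qed
  have fin: "finite {x \<in> ?S. \<phi> x [^]\<^bsub>H\<^esub> poly_mapping.lookup u x \<noteq> \<one>\<^bsub>H\<^esub>}" for u :: "(int \<times> 'a) list \<Rightarrow>\<^sub>0 int"
    by (rule finite_subset[OF _ finite_keys[of u]]) (auto simp: in_keys_iff)
  have h: "h \<in> hom ?F H"
  proof (rule homI)
    fix x y assume xy: "x \<in> carrier ?F" "y \<in> carrier ?F"
    then have "x \<otimes>\<^bsub>?F\<^esub> y \<in> carrier ?F"
      by (intro monoid.m_closed group.is_monoid) auto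
    then show "h (x \<otimes>\<^bsub>?F\<^esub> y) = h x \<otimes>\<^bsub>H\<^esub> h y"
      using xy c\<phi>
      by (simp add: h_gf fin H.gfinprod_distrib lookup_add H.int_pow_mult cong: H.gfinprod_cong)
  qed (use c\<phi> in \<open>auto simp: h_def subset_iff intro!: H.finprod_in\<close>)
  interpret h: group_hom ?F H h using h by (simp add: group_hom_def group_hom_axioms_def)
  have h_of: "h (frag_of xs) = \<phi> xs" if "xs \<in> ?S" for xs
    using that c\<phi> by (simp add: h_def)
  have "h c = \<one>\<^bsub>H\<^esub>" if trel: "c \<in> trels A n k" for c
  proof -
    obtain us i a b vs where c: "c = frag_of (us @ (i, a \<otimes>\<^bsub>grp A i\<^esub> b) # vs)
        - frag_of (us @ (i, a) # vs) - frag_of (us @ (i, b) # vs)" (is "c = ?ab - ?a - ?b")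
      and 1: "us @ (i, a) # vs \<in> ?S" "us @ (i, b) # vs \<in> ?S"
      using trel unfolding trels_def by blast
    interpret comm_group "grp A i" by (rule groups)
    have 2: "us @ (i, a \<otimes>\<^bsub>grp A i\<^esub> b) # vs \<in> ?S"
      using 1 by (auto simp: tgens_append tgens_Cons)
    have "?ab = c \<otimes>\<^bsub>?F\<^esub> (?a \<otimes>\<^bsub>?F\<^esub> ?b)" by (simp add: c)
    also have "h \<dots> = h c \<otimes>\<^bsub>H\<^esub> (h ?a \<otimes>\<^bsub>H\<^esub> h ?b)"
      using 1 subsetD[OF trels_subset trel]
      by (subst h.hom_mult; (subst h.hom_mult)?)
        (simp_all del: mult_free_Abelian_group carrier_free_Abelian_group_iff add: monoid.m_closed group.is_monoid)
    finally have e: "h ?ab = h c \<otimes>\<^bsub>H\<^esub> (h ?a \<otimes>\<^bsub>H\<^esub> h ?b)" .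
    have "h ?ab = h ?a \<otimes>\<^bsub>H\<^esub> h ?b"
      using multiadditive_mult[OF \<phi> 1] 1 2 by (simp add: h_of)
    with e show ?thesis
      using 1 c\<phi> trels_subset trel by (metis H.r_cancel_one' H.m_closed h.hom_closed h_of subsetD)
  qed
  then have "trels A n k \<subseteq> kernel ?F H h"
    using subsetD[OF trels_subset] by (auto simp: kernel_def simp del: carrier_free_Abelian_group_iff)
  then have ker: "tker A n k \<subseteq> kernel ?F H h"
    unfolding tker_def by (rule group.generate_subgroup_incl[OF group_free_Abelian_group _ h.subgroup_kernel])
  have tl: "tlift A n k H \<phi> (?p c) = h c" if c: "c \<in> carrier ?F" for c
  proof -
    have X: "?p c \<in> carrier (tgrp A n k)" using hom_in_carrier[OF pure_hom c] .
    have "c \<in> ?p c" by (rule group.rcos_self[OF group_free_Abelian_group c tker_subgroup])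
    then have "(SOME c'. c' \<in> ?p c) \<in> ?p c" by (rule someI)
    then obtain z where z: "z \<in> tker A n k" "(SOME c'. c' \<in> ?p c) = z \<otimes>\<^bsub>?F\<^esub> c"
      unfolding r_coset_def by blast
    have "tlift A n k H \<phi> (?p c) = h (SOME c'. c' \<in> ?p c)"
      unfolding tlift_def Let_def using X by (simp add: h_def)
    also note z(2)
    also have "h (z \<otimes>\<^bsub>?F\<^esub> c) = h c" using z(1) ker c
      by (subst h.hom_mult) (auto simp: kernel_def)
    finally show ?thesis .
  qed
  have "tlift A n k H \<phi> \<in> hom (tgrp A n k) H"
  proof (rule homI)
    fix X assume "X \<in> carrier (tgrp A n k)"
    then obtain c where c: "c \<in> carrier ?F" "X = ?p c"
      by (auto simp: tgrp_def FactGroup_def RCOSETS_def)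
    then show "tlift A n k H \<phi> X \<in> carrier H" using tl h.hom_closed by simp
    fix Y assume "Y \<in> carrier (tgrp A n k)"
    then obtain c' where c': "c' \<in> carrier ?F" "Y = ?p c'"
      by (auto simp: tgrp_def FactGroup_def RCOSETS_def)
    have cc: "c \<otimes>\<^bsub>?F\<^esub> c' \<in> carrier ?F" using c c' by (intro monoid.m_closed group.is_monoid) auto
    have "X \<otimes>\<^bsub>tgrp A n k\<^esub> Y = ?p (c \<otimes>\<^bsub>?F\<^esub> c')"
      unfolding c(2) c'(2) by (rule hom_mult[OF pure_hom c(1) c'(1), symmetric])
    then show "tlift A n k H \<phi> (X \<otimes>\<^bsub>tgrp A n k\<^esub> Y) = tlift A n k H \<phi> X \<otimes>\<^bsub>H\<^esub> tlift A n k H \<phi> Y"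
      using tl[OF cc] tl[OF c(1)] tl[OF c'(1)] c c' h.hom_mult by simp
  qed
  moreover have "tlift A n k H \<phi> (pure A xs) = \<phi> xs" if "xs \<in> ?S" for xs
    using tl[of "frag_of xs"] that by (simp add: pure_eq h_of)
  ultimately show ?thesis by blast
qed

lemmas tlift_hom = tlift_hom_pure[THEN conjunct1]
lemmas tlift_pure = tlift_hom_pure[THEN conjunct2, THEN bspec]

lemma tlift_extensional: "tlift A n k H \<phi> \<in> extensional (carrier (tgrp A n k))"
  by (simp add: tlift_def)

lemma pure_multiadditive: "multiadditive A n k (tgrp A n k) (pure A)"
proof (rule multiadditiveI)
  fix us i a b vs
  assume 1: "us @ (i, a) # vs \<in> tgens A n k" "us @ (i, b) # vs \<in> tgens A n k"
  let ?F = "free_Abelian_group (tgens A n k)"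
  let ?p = "\<lambda>c. tker A n k #>\<^bsub>?F\<^esub> c"
  interpret comm_group "grp A i" by (rule groups)
  interpret p: group_hom ?F "tgrp A n k" ?p
    using pure_hom tgrp_comm_group by (simp add: group_hom_def group_hom_axioms_def comm_group.axioms)
  have 2: "us @ (i, a \<otimes>\<^bsub>grp A i\<^esub> b) # vs \<in> tgens A n k"
    using 1 by (auto simp: tgens_append tgens_Cons)
  let ?c = "frag_of (us @ (i, a \<otimes>\<^bsub>grp A i\<^esub> b) # vs) - frag_of (us @ (i, a) # vs) - frag_of (us @ (i, b) # vs)"
  have c: "?c \<in> trels A n k" unfolding trels_def using 1 by blast
  then have ck: "?c \<in> tker A n k" unfolding tker_def by (rule generate.incl)
  have "?p ?c = \<one>\<^bsub>tgrp A n k\<^esub>"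
    using group.coset_join2[OF group_free_Abelian_group subsetD[OF trels_subset c] tker_subgroup ck]
    by (simp add: tgrp_def FactGroup_def)
  moreover have "?p (frag_of (us @ (i, a \<otimes>\<^bsub>grp A i\<^esub> b) # vs)) = ?p (?c \<otimes>\<^bsub>?F\<^esub> (frag_of (us @ (i, a) # vs) \<otimes>\<^bsub>?F\<^esub> frag_of (us @ (i, b) # vs)))"
    by simp
  moreover have "\<dots> = ?p ?c \<otimes>\<^bsub>tgrp A n k\<^esub> (?p (frag_of (us @ (i, a) # vs)) \<otimes>\<^bsub>tgrp A n k\<^esub> ?p (frag_of (us @ (i, b) # vs)))"
    using 1 subsetD[OF trels_subset c]
    by (subst p.hom_mult; (subst p.hom_mult)?)
      (simp_all del: mult_free_Abelian_group carrier_free_Abelian_group_iff add: monoid.m_closed group.is_monoid)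
  ultimately show "pure A (us @ (i, a \<otimes>\<^bsub>grp A i\<^esub> b) # vs) =
      pure A (us @ (i, a) # vs) \<otimes>\<^bsub>tgrp A n k\<^esub> pure A (us @ (i, b) # vs)"
    using 1 2 p.hom_closed[of "frag_of (us @ (i, a) # vs)"] p.hom_closed[of "frag_of (us @ (i, b) # vs)"]
    by (simp add: pure_eq)
qed (rule pure_closed)

end


section \<open>Constructing multiadditive functions\<close>

text \<open>
  Operations of arity \<open>s\<close> and degree \<open>r\<close> on homogeneous elements. The differential of \<open>A\<close>, its
  multiplication and a Hochschild cochain are of this kind, and so are their composites. The faces,
  the differential of \<open>A\<^bsup>\<otimes>n\<^esup>\<close> and the cap product insert such an operation into a block of neighbouring
  factors.
\<close>

definition homogeneous_op ::
  "('a, 'm) ch_scheme \<Rightarrow> nat \<Rightarrow> int \<Rightarrow> ((int \<times> 'a) list \<Rightarrow> int \<times> 'a) \<Rightarrow> bool" where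
  "homogeneous_op A s r g \<longleftrightarrow>
     (\<forall>k. (\<forall>xs\<in>tgens A s k. fst (g xs) = k + r) \<and> multiadditive A s k (grp A (k + r)) (snd \<circ> g))"

definition insert_op :: "nat \<Rightarrow> nat \<Rightarrow> ('b list \<Rightarrow> 'b) \<Rightarrow> 'b list \<Rightarrow> 'b list" where
  "insert_op u s g xs = take u xs @ g (take s (drop u xs)) # drop (u + s) xs"

lemma insert_op_append:
  "length P = u \<Longrightarrow> length M = s \<Longrightarrow> insert_op u s g (P @ M @ Q) = P @ g M # Q"
  by (simp add: insert_op_def)

lemma tgens_length: "xs \<in> tgens A n k \<Longrightarrow> length xs = n"
  and tgens_wt: "xs \<in> tgens A n k \<Longrightarrow> wt xs = k"
  and tgens_nth: "xs \<in> tgens A n k \<Longrightarrow> i < n \<Longrightarrow> snd (xs ! i) \<in> carrier (grp A (fst (xs ! i)))"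
  by (auto simp: tgens_def)

lemma tgens_Nil [simp]: "[] \<in> tgens A n k \<longleftrightarrow> n = 0 \<and> k = 0"
  by (auto simp: tgens_def)

lemma tgens_Cons': "x # xs \<in> tgens A n k \<longleftrightarrow>
    n > 0 \<and> snd x \<in> carrier (grp A (fst x)) \<and> xs \<in> tgens A (n - 1) (k - fst x)"
  by (cases x) (simp add: tgens_Cons)

lemma list_split3:
  assumes "length xs = u + s + v"
  obtains P M Q where "xs = P @ M @ Q" "length P = u" "length M = s" "length Q = v"
proof
  show "xs = take u xs @ take s (drop u xs) @ drop s (drop u xs)" by (simp only: append_take_drop_id)
qed (use assms in auto)

lemma append_cases3:
  assumes eq: "us @ x # vs = P @ M @ Q"
  obtains (left) P' where "P = us @ x # P'" "vs = P' @ M @ Q"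
  | (middle) L R where "us = P @ L" "M = L @ x # R" "vs = R @ Q"
  | (right) Q' where "us = P @ M @ Q'" "Q = Q' @ x # vs"
proof -
  have "(\<exists>P'. P = us @ x # P' \<and> vs = P' @ M @ Q) \<or> (\<exists>L R. us = P @ L \<and> M = L @ x # R \<and> vs = R @ Q) \<or>
      (\<exists>Q'. us = P @ M @ Q' \<and> Q = Q' @ x # vs)"
    using eq by (auto simp: append_eq_append_conv2 append_eq_Cons_conv Cons_eq_append_conv)
  then show ?thesis using left middle right by blast
qed

context graded_group
begin

lemma tgens_mult:
  assumes "us @ (i, a) # vs \<in> tgens A n k" "us @ (i, b) # vs \<in> tgens A n k"
  shows "us @ (i, a \<otimes>\<^bsub>grp A i\<^esub> b) # vs \<in> tgens A n k"
proof -
  interpret comm_group "grp A i" by (rule groups)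
  show ?thesis using assms by (auto simp: tgens_append tgens_Cons)
qed

lemma multiadditive_cong:
  assumes "multiadditive A n k H \<psi>" "\<And>xs. xs \<in> tgens A n k \<Longrightarrow> \<phi> xs = \<psi> xs"
  shows "multiadditive A n k H \<phi>"
  using assms by (intro multiadditiveI) (auto simp: multiadditive_closed multiadditive_mult tgens_mult)

text \<open>A Koszul sign depends on the degrees of the entries only, which addition in an entry preserves.\<close>

lemma multiadditive_kos:
  assumes "multiadditive A n k H \<phi>" "comm_group H" "\<And>xs ys. map fst xs = map fst ys \<Longrightarrow> \<sigma> xs = \<sigma> ys"
  shows "multiadditive A n k H (\<lambda>xs. kos H (\<sigma> xs) (\<phi> xs))"
proof -
  interpret H: comm_group H by fact
  have s: "\<sigma> (us @ (i, a) # vs) = \<sigma> (us @ (i, b) # vs)" for us i a b vs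
    by (rule assms(3)) simp
  show ?thesis
  proof (rule multiadditiveI)
    fix us i a b vs assume 1: "us @ (i, a) # vs \<in> tgens A n k" "us @ (i, b) # vs \<in> tgens A n k"
    show "kos H (\<sigma> (us @ (i, a \<otimes>\<^bsub>grp A i\<^esub> b) # vs)) (\<phi> (us @ (i, a \<otimes>\<^bsub>grp A i\<^esub> b) # vs)) =
      kos H (\<sigma> (us @ (i, a) # vs)) (\<phi> (us @ (i, a) # vs)) \<otimes>\<^bsub>H\<^esub>
      kos H (\<sigma> (us @ (i, b) # vs)) (\<phi> (us @ (i, b) # vs))"
      unfolding s[where a = "a \<otimes>\<^bsub>grp A i\<^esub> b" and b = a] s[where a = b and b = a]
      using 1 assms(1) by (simp add: multiadditive_mult H.kos_mult multiadditive_closed)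
  qed (use multiadditive_closed[OF assms(1)] in simp)
qed

lemma multiadditive_finprod:
  assumes "\<And>j. j \<in> J \<Longrightarrow> multiadditive A n k H (\<phi> j)" "comm_group H"
  shows "multiadditive A n k H (\<lambda>xs. finprod H (\<lambda>j. \<phi> j xs) J)"
proof -
  interpret H: comm_group H by fact
  have c: "\<phi> j xs \<in> carrier H" if "j \<in> J" "xs \<in> tgens A n k" for j xs
    using assms(1)[OF that(1)] that(2) by (rule multiadditive_closed)
  show ?thesis
  proof (rule multiadditiveI)
    fix us i a b vs assume 1: "us @ (i, a) # vs \<in> tgens A n k" "us @ (i, b) # vs \<in> tgens A n k"
    then have "finprod H (\<lambda>j. \<phi> j (us @ (i, a \<otimes>\<^bsub>grp A i\<^esub> b) # vs)) J =
        finprod H (\<lambda>j. \<phi> j (us @ (i, a) # vs) \<otimes>\<^bsub>H\<^esub> \<phi> j (us @ (i, b) # vs)) J"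
      using c multiadditive_mult[OF assms(1)] by (intro H.finprod_eq) auto
    also have "\<dots> = finprod H (\<lambda>j. \<phi> j (us @ (i, a) # vs)) J \<otimes>\<^bsub>H\<^esub> finprod H (\<lambda>j. \<phi> j (us @ (i, b) # vs)) J"
      using c 1 by (intro H.finprod_mult) auto
    finally show "finprod H (\<lambda>j. \<phi> j (us @ (i, a \<otimes>\<^bsub>grp A i\<^esub> b) # vs)) J =
       finprod H (\<lambda>j. \<phi> j (us @ (i, a) # vs)) J \<otimes>\<^bsub>H\<^esub> finprod H (\<lambda>j. \<phi> j (us @ (i, b) # vs)) J" .
  qed (use c in \<open>auto intro: H.finprod_in\<close>)
qed

lemma multiadditive_times:
  assumes "multiadditive A n k H \<phi>" "multiadditive A n k H \<psi>" "comm_group H"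
  shows "multiadditive A n k H (\<lambda>xs. \<phi> xs \<otimes>\<^bsub>H\<^esub> \<psi> xs)"
proof -
  interpret H: comm_group H by fact
  show ?thesis
    using assms multiadditive_mult[OF assms(1)] multiadditive_mult[OF assms(2)]
    by (intro multiadditiveI) (simp_all add: multiadditive_closed H.m_ac)
qed

lemma multiadditive_hom:
  assumes "multiadditive A n k G \<phi>" "h \<in> hom G H"
  shows "multiadditive A n k H (\<lambda>xs. h (\<phi> xs))"
  using assms
  by (intro multiadditiveI)
     (auto simp: hom_in_carrier multiadditive_closed multiadditive_mult hom_mult[OF assms(2)])

lemma homogeneous_op_fst: "homogeneous_op A s r g \<Longrightarrow> xs \<in> tgens A s k \<Longrightarrow> fst (g xs) = k + r"
  and homogeneous_op_snd: "homogeneous_op A s r g \<Longrightarrow> multiadditive A s k (grp A (k + r)) (\<lambda>xs. snd (g xs))"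
  by (auto simp: homogeneous_op_def comp_def)

lemma homogeneous_op_closed:
  "homogeneous_op A s r g \<Longrightarrow> xs \<in> tgens A s k \<Longrightarrow> snd (g xs) \<in> carrier (grp A (fst (g xs)))"
  using homogeneous_op_fst[of s r g xs k] multiadditive_closed[OF homogeneous_op_snd, of s r g xs k] by simp

lemma tgens_insert_op:
  assumes g: "homogeneous_op A s r g" and PMQ: "P @ M @ Q \<in> tgens A n k" and M: "length M = s"
    and n: "n + 1 = n' + s" and k: "k' = k + r"
  shows "P @ g M # Q \<in> tgens A n' k'"
proof -
  have 1: "M \<in> tgens A s (wt M)" "P \<in> tgens A (length P) (wt P)" "length Q + length P + s = n"
    "Q \<in> tgens A (length Q) (wt Q)" "wt P + wt M + wt Q = k"
    using PMQ M by (auto simp: tgens_append) (auto simp: tgens_def)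
  then show ?thesis
    using homogeneous_op_closed[OF g 1(1)] homogeneous_op_fst[OF g 1(1)] n k
    by (auto simp: tgens_append tgens_Cons')
qed

lemma tgens_insert_op':
  assumes g: "homogeneous_op A s r g" and xs: "xs \<in> tgens A n k" and "u + s \<le> n"
    and "n + 1 = n' + s" and "k' = k + r"
  shows "insert_op u s g xs \<in> tgens A n' k'"
proof -
  obtain P M Q where 1: "xs = P @ M @ Q" "length P = u" "length M = s" "length Q = n - u - s"
    using list_split3[of xs u s "n - u - s"] assms tgens_length[OF xs] by auto
  then show ?thesis using assms by (simp add: insert_op_append tgens_insert_op)
qed

text \<open>
  An entry outside of the block is an entry of the new list, and an entry of the block enters the new
  list through one value of \<open>g\<close>, which is additive in it.
\<close>

lemma multiadditive_insert_op:
  assumes g: "homogeneous_op A s r g" and \<phi>: "multiadditive A n' k' H \<phi>"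
    and n: "n + 1 = n' + s" "u + s \<le> n" and k: "k' = k + r"
  shows "multiadditive A n k H (\<lambda>xs. \<phi> (insert_op u s g xs))"
proof (rule multiadditiveI)
  fix xs assume "xs \<in> tgens A n k"
  then show "\<phi> (insert_op u s g xs) \<in> carrier H"
    using tgens_insert_op'[OF g _ n(2,1) k] by (intro multiadditive_closed[OF \<phi>])
next
  fix us i a b vs
  assume a: "us @ (i, a) # vs \<in> tgens A n k" and b: "us @ (i, b) # vs \<in> tgens A n k"
  note ga = tgens_insert_op[OF g _ _ n(1) k]
  obtain P M Q where 1: "us @ (i, a) # vs = P @ M @ Q" "length P = u" "length M = s" "length Q = n - u - s"
    using list_split3[of "us @ (i, a) # vs" u s "n - u - s"] n tgens_length[OF a] by auto
  from 1(1) show "\<phi> (insert_op u s g (us @ (i, a \<otimes>\<^bsub>grp A i\<^esub> b) # vs)) =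
    \<phi> (insert_op u s g (us @ (i, a) # vs)) \<otimes>\<^bsub>H\<^esub> \<phi> (insert_op u s g (us @ (i, b) # vs))"
  proof (cases rule: append_cases3)
    case (left P')
    have e: "insert_op u s g (us @ (i, c) # vs) = us @ (i, c) # P' @ g M # Q" for c
      using insert_op_append[of "us @ (i, c) # P'" u M s g Q] left 1 by simp
    show ?thesis unfolding e
      using a b left 1 ga[of "us @ (i, a) # P'" M Q] ga[of "us @ (i, b) # P'" M Q]
      by (intro multiadditive_mult[OF \<phi>]) simp_all
  next
    case (right Q')
    have e: "insert_op u s g (us @ (i, c) # vs) = (P @ g M # Q') @ (i, c) # vs" for c
      using insert_op_append[of P u M s g "Q' @ (i, c) # vs"] right 1 by simp
    show ?thesis unfolding e
      using a b right 1 ga[of P M "Q' @ (i, a) # vs"] ga[of P M "Q' @ (i, b) # vs"]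
      by (intro multiadditive_mult[OF \<phi>]) simp_all
  next
    case (middle L R)
    let ?g = "\<lambda>c. g (L @ (i, c) # R)"
    have e: "insert_op u s g (us @ (i, c) # vs) = P @ ?g c # Q" for c
      using insert_op_append[of P u "L @ (i, c) # R" s g Q] middle 1 by simp
    define w where "w = wt (L @ (i, a) # R)"
    have m: "L @ (i, a) # R \<in> tgens A s w" "L @ (i, b) # R \<in> tgens A s w"
      using a b middle 1 by (auto simp: tgens_append tgens_Cons w_def)
    note m' = tgens_mult[OF m]
    have g1: "?g c = (w + r, snd (?g c))" if "L @ (i, c) # R \<in> tgens A s w" for c
      using homogeneous_op_fst[OF g that] by (metis prod.collapse)
    have g2: "snd (?g (a \<otimes>\<^bsub>grp A i\<^esub> b)) = snd (?g a) \<otimes>\<^bsub>grp A (w + r)\<^esub> snd (?g b)"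
      using multiadditive_mult[OF homogeneous_op_snd[OF g] m] .
    have t: "P @ ?g c # Q \<in> tgens A n' k'" if "us @ (i, c) # vs \<in> tgens A n k" for c
      using that middle 1 by (intro ga) simp_all
    have "?g (a \<otimes>\<^bsub>grp A i\<^esub> b) = (w + r, snd (?g a) \<otimes>\<^bsub>grp A (w + r)\<^esub> snd (?g b))"
      using g1[OF m'] g2 by simp
    moreover have "\<phi> (P @ (w + r, snd (?g a) \<otimes>\<^bsub>grp A (w + r)\<^esub> snd (?g b)) # Q) =
        \<phi> (P @ (w + r, snd (?g a)) # Q) \<otimes>\<^bsub>H\<^esub> \<phi> (P @ (w + r, snd (?g b)) # Q)"
      using t[OF a] t[OF b] by (intro multiadditive_mult[OF \<phi>]) (simp_all flip: g1[OF m(1)] g1[OF m(2)])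
    ultimately show ?thesis unfolding e by (simp flip: g1[OF m(1)] g1[OF m(2)])
  qed
qed

lemma tgens_rotate: "xs \<in> tgens A n k \<Longrightarrow> n > 0 \<Longrightarrow> last xs # butlast xs \<in> tgens A n k"
  by (cases xs rule: rev_cases) (auto simp: tgens_def algebra_simps)

text \<open>With this the cyclic face reduces to the multiplication of the first two factors.\<close>

lemma multiadditive_rotate:
  assumes \<phi>: "multiadditive A n k H \<phi>" and n: "n > 0"
  shows "multiadditive A n k H (\<lambda>xs. \<phi> (last xs # butlast xs))"
proof (rule multiadditiveI)
  fix xs assume "xs \<in> tgens A n k"
  then show "\<phi> (last xs # butlast xs) \<in> carrier H" using tgens_rotate multiadditive_closed[OF \<phi>] n by blast
next
  fix us i a b vs
  assume a: "us @ (i, a) # vs \<in> tgens A n k" and b: "us @ (i, b) # vs \<in> tgens A n k"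
  show "\<phi> (last (us @ (i, a \<otimes>\<^bsub>grp A i\<^esub> b) # vs) # butlast (us @ (i, a \<otimes>\<^bsub>grp A i\<^esub> b) # vs)) =
    \<phi> (last (us @ (i, a) # vs) # butlast (us @ (i, a) # vs)) \<otimes>\<^bsub>H\<^esub>
    \<phi> (last (us @ (i, b) # vs) # butlast (us @ (i, b) # vs))"
  proof (cases vs rule: rev_cases)
    case Nil
    then show ?thesis
      using multiadditive_mult[OF \<phi>, of "[]" i a us b] tgens_rotate[OF a n] tgens_rotate[OF b n] by simp
  next
    case (snoc vs' v)
    then show ?thesis
      using multiadditive_mult[OF \<phi>, of "v # us" i a vs' b] tgens_rotate[OF a n] tgens_rotate[OF b n]
      by (simp add: butlast_append)
  qed
qed

end


section \<open>Graded homomorphisms\<close>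

lemma Hom_ch_carrier:
  "f \<in> carrier (grp (Hom_ch V W) r) \<longleftrightarrow>
     (\<forall>k. f k \<in> hom (grp V k) (grp W (k + r)) \<and> f k \<in> extensional (carrier (grp V k)))"
  by (simp add: Hom_ch_def)

lemma Hom_ch_hom: "f \<in> carrier (grp (Hom_ch V W) r) \<Longrightarrow> k' = k + r \<Longrightarrow> f k \<in> hom (grp V k) (grp W k')"
  by (simp add: Hom_ch_carrier)

lemma Hom_ch_closed:
  "f \<in> carrier (grp (Hom_ch V W) r) \<Longrightarrow> x \<in> carrier (grp V k) \<Longrightarrow> k' = k + r \<Longrightarrow> f k x \<in> carrier (grp W k')"
  by (meson Hom_ch_hom hom_in_carrier)

lemma Hom_ch_mult_apply:
  "x \<in> carrier (grp V k) \<Longrightarrow> (f \<otimes>\<^bsub>grp (Hom_ch V W) r\<^esub> g) k x = f k x \<otimes>\<^bsub>grp W (k + r)\<^esub> g k x"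
  by (simp add: Hom_ch_def)

lemma Hom_ch_one_apply: "x \<in> carrier (grp V k) \<Longrightarrow> \<one>\<^bsub>grp (Hom_ch V W) r\<^esub> k x = \<one>\<^bsub>grp W (k + r)\<^esub>"
  by (simp add: Hom_ch_def)

lemma Hom_ch_eqI:
  assumes "f \<in> carrier (grp (Hom_ch V W) r)" "g \<in> carrier (grp (Hom_ch V W) r)"
    and "\<And>k x. x \<in> carrier (grp V k) \<Longrightarrow> f k x = g k x"
  shows "f = g"
proof
  fix k show "f k = g k"
    by (rule extensionalityI[of _ "carrier (grp V k)"]) (use assms in \<open>auto simp: Hom_ch_carrier\<close>)
qed

lemma Hom_ch_comm_group:
  assumes "graded_group V" "graded_group W"
  shows "comm_group (grp (Hom_ch V W) r)"
proof -
  interpret V: graded_group V by fact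
  interpret W: graded_group W by fact
  interpret Vg: comm_group "grp V k" for k by (rule V.groups)
  interpret Wg: comm_group "grp W k" for k by (rule W.groups)
  let ?H = "grp (Hom_ch V W) r"
  have m: "f \<otimes>\<^bsub>?H\<^esub> g \<in> carrier ?H" if "f \<in> carrier ?H" "g \<in> carrier ?H" for f g
    unfolding Hom_ch_carrier
  proof (intro allI conjI)
    fix k
    have f: "f k \<in> hom (grp V k) (grp W (k + r))" and g: "g k \<in> hom (grp V k) (grp W (k + r))"
      using that by (auto simp: Hom_ch_carrier)
    show "(f \<otimes>\<^bsub>?H\<^esub> g) k \<in> hom (grp V k) (grp W (k + r))"
      using f g by (auto simp: Hom_ch_mult_apply hom_def Pi_iff Wg.m_ac)
    show "(f \<otimes>\<^bsub>?H\<^esub> g) k \<in> extensional (carrier (grp V k))"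
      by (simp add: Hom_ch_def)
  qed
  have o: "\<one>\<^bsub>?H\<^esub> \<in> carrier ?H"
    by (auto simp: Hom_ch_carrier hom_def Hom_ch_one_apply) (simp add: Hom_ch_def)
  have c: "f k x \<in> carrier (grp W (k + r))" if "f \<in> carrier ?H" "x \<in> carrier (grp V k)" for f k x
    using that by (rule Hom_ch_closed) simp
  show ?thesis
  proof (rule comm_groupI)
    fix f assume f: "f \<in> carrier ?H"
    let ?g = "\<lambda>k. \<lambda>x\<in>carrier (grp V k). inv\<^bsub>grp W (k + r)\<^esub> f k x"
    have g: "?g \<in> carrier ?H"
      using f by (auto simp: Hom_ch_carrier hom_def Pi_iff Wg.inv_mult)
    have "?g \<otimes>\<^bsub>?H\<^esub> f = \<one>\<^bsub>?H\<^esub>"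
      by (rule Hom_ch_eqI[OF m[OF g f] o]) (auto simp: Hom_ch_mult_apply Hom_ch_one_apply c[OF f])
    then show "\<exists>g\<in>carrier ?H. g \<otimes>\<^bsub>?H\<^esub> f = \<one>\<^bsub>?H\<^esub>" using g by blast
    show "\<one>\<^bsub>?H\<^esub> \<otimes>\<^bsub>?H\<^esub> f = f"
      by (rule Hom_ch_eqI[OF m[OF o f] f]) (auto simp: Hom_ch_mult_apply Hom_ch_one_apply c[OF f])
    fix g assume g: "g \<in> carrier ?H"
    show "f \<otimes>\<^bsub>?H\<^esub> g = g \<otimes>\<^bsub>?H\<^esub> f"
      by (rule Hom_ch_eqI[OF m[OF f g] m[OF g f]]) (auto simp: Hom_ch_mult_apply c f g Wg.m_ac)
    fix h assume h: "h \<in> carrier ?H"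
    show "f \<otimes>\<^bsub>?H\<^esub> g \<otimes>\<^bsub>?H\<^esub> h = f \<otimes>\<^bsub>?H\<^esub> (g \<otimes>\<^bsub>?H\<^esub> h)"
      by (rule Hom_ch_eqI[OF m[OF m[OF f g] h] m[OF f m[OF g h]]]) (auto simp: Hom_ch_mult_apply c f g h Wg.m_ac)
  qed (use m o in auto)
qed

lemma eval_hom:
  assumes "x \<in> carrier (grp V k)" "k' = k + r"
  shows "(\<lambda>f. f k x) \<in> hom (grp (Hom_ch V W) r) (grp W k')"
  using assms Hom_ch_closed by (auto simp: hom_def Hom_ch_mult_apply)

lemma Hom_ch_kos_apply:
  assumes "graded_group V" "graded_group W" "f \<in> carrier (grp (Hom_ch V W) r)" "x \<in> carrier (grp V k)"
  shows "kos (grp (Hom_ch V W) r) a f k x = kos (grp W (k + r)) a (f k x)"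
  by (rule hom_kos[OF eval_hom[OF assms(4) refl] _ _ assms(3)])
     (use Hom_ch_comm_group[OF assms(1,2)] graded_group.groups[OF assms(2)] in \<open>auto intro: comm_group.axioms\<close>)

lemma Hom_ch_finprod_kos_apply:
  assumes "graded_group V" "graded_group W" "\<And>i. i \<in> I \<Longrightarrow> f i \<in> carrier (grp (Hom_ch V W) r)"
    "x \<in> carrier (grp V k)"
  shows "finprod (grp (Hom_ch V W) r) (\<lambda>i. kos (grp (Hom_ch V W) r) (s i) (f i)) I k x =
    finprod (grp W (k + r)) (\<lambda>i. kos (grp W (k + r)) (s i) (f i k x)) I"
  using hom_finprod_kos[OF eval_hom[OF assms(4) refl] Hom_ch_comm_group[OF assms(1,2)] graded_group.groups[OF assms(2)] assms(3)] .

lemma hcomp_apply: "x \<in> carrier (grp V k) \<Longrightarrow> hcomp V r g f k x = g (k + r) (f k x)"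
  by (simp add: hcomp_def)

lemma hcomp_closed:
  assumes "graded_group V" and f: "f \<in> carrier (grp (Hom_ch V W) r)"
    and g: "g \<in> carrier (grp (Hom_ch W U) s)" and "t = r + s"
  shows "hcomp V r g f \<in> carrier (grp (Hom_ch V U) t)"
  unfolding Hom_ch_carrier
proof (intro allI conjI)
  fix k
  have "(\<lambda>x. g (k + r) (f k x)) \<in> hom (grp V k) (grp U (k + t))"
    using hom_compose[OF Hom_ch_hom[OF f refl] Hom_ch_hom[OF g refl]] assms(4)
    by (simp add: comp_def add.assoc)
  then show "hcomp V r g f k \<in> hom (grp V k) (grp U (k + t))"
    by (rule group.hom_restrict[OF comm_group.axioms(2)[OF graded_group.groups[OF assms(1)]]])
       (simp add: hcomp_apply)
qed (simp add: hcomp_def)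

lemma (in graded_group) tpow_graded_group: "graded_group (tpow A n)"
  by (simp add: graded_group_def tpow_def tgrp_comm_group)

lemma grp_tpow [simp]: "grp (tpow A n) = tgrp A n"
  by (simp add: tpow_def)

context graded_group
begin

lemma tlift_Hom_ch:
  assumes "graded_group W" "\<And>k. multiadditive A n k (grp W (k + r)) (\<phi> k)"
  shows "(\<lambda>k. tlift A n k (grp W (k + r)) (\<phi> k)) \<in> carrier (grp (Hom_ch (tpow A n) W) r)"
  using tlift_hom[OF graded_group.groups[OF assms(1)] assms(2)]
  by (simp add: Hom_ch_carrier tlift_extensional)

lemma tpow_Hom_ch_eqI:
  assumes f: "f \<in> carrier (grp (Hom_ch (tpow A n) W) r)" and g: "g \<in> carrier (grp (Hom_ch (tpow A n) W) r)"
    and "graded_group W"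
    and eq: "\<And>k xs. xs \<in> tgens A n k \<Longrightarrow> f k (pure A xs) = g k (pure A xs)"
  shows "f = g"
proof (rule Hom_ch_eqI[OF f g])
  fix k X assume "X \<in> carrier (grp (tpow A n) k)"
  then have X: "X \<in> carrier (tgrp A n k)" by simp
  have "f k \<in> hom (tgrp A n k) (grp W (k + r))" "g k \<in> hom (tgrp A n k) (grp W (k + r))"
    using Hom_ch_hom[OF f refl] Hom_ch_hom[OF g refl] by simp_all
  then show "f k X = g k X"
    using tgrp_hom_eqI[where f = "f k" and g = "g k", OF _ _ _ eq X] comm_group.axioms(2)[OF graded_group.groups[OF assms(3)]] by blast
qed

end


lemma chain_complex_graded_group: "chain_complex V \<Longrightarrow> graded_group V"
  by (simp add: chain_complex_def graded_group_def)

lemma dif_hom: "chain_complex V \<Longrightarrow> k' = k - 1 \<Longrightarrow> dif V k \<in> hom (grp V k) (grp V k')"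
  by (simp add: chain_complex_def)

lemma dif_closed:
  "chain_complex V \<Longrightarrow> x \<in> carrier (grp V k) \<Longrightarrow> k' = k - 1 \<Longrightarrow> dif V k x \<in> carrier (grp V k')"
  by (meson dif_hom hom_in_carrier)

lemma Hom_ch_dif_apply:
  "x \<in> carrier (grp V k) \<Longrightarrow> dif (Hom_ch V W) r f k x =
     kos (grp W (k + r - 1)) k (dif W (k + r) (f k x) \<otimes>\<^bsub>grp W (k + r - 1)\<^esub>
       inv\<^bsub>grp W (k + r - 1)\<^esub> (f (k - 1) (dif V k x)))"
  by (simp add: Hom_ch_def)

lemma Hom_ch_dif_closed:
  assumes V: "chain_complex V" and W: "chain_complex W" and f: "f \<in> carrier (grp (Hom_ch V W) r)"
  shows "dif (Hom_ch V W) r f \<in> carrier (grp (Hom_ch V W) (r - 1))"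
  unfolding Hom_ch_carrier
proof (intro allI conjI)
  fix k
  interpret Wg: comm_group "grp W j" for j by (rule graded_group.groups[OF chain_complex_graded_group[OF W]])
  have 1: "(\<lambda>x. dif W (k + r) (f k x)) \<in> hom (grp V k) (grp W (k + r - 1))"
    by (rule hom_comp[OF Hom_ch_hom[OF f refl] dif_hom[OF W refl]])
  have 2: "(\<lambda>x. f (k - 1) (dif V k x)) \<in> hom (grp V k) (grp W (k + r - 1))"
    by (rule hom_comp[OF dif_hom[OF V refl] Hom_ch_hom[OF f]]) simp
  have "(\<lambda>x. kos (grp W (k + r - 1)) k (dif W (k + r) (f k x) \<otimes>\<^bsub>grp W (k + r - 1)\<^esub>
      kos (grp W (k + r - 1)) 1 (f (k - 1) (dif V k x)))) \<in> hom (grp V k) (grp W (k + r - 1))"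
    by (intro hom_kos_comp hom_times 1 2 Wg.comm_group_axioms)
  then have "dif (Hom_ch V W) r f k \<in> hom (grp V k) (grp W (k + r - 1))"
    by (rule group.hom_restrict[OF comm_group.axioms(2)[OF graded_group.groups[OF chain_complex_graded_group[OF V]]]])
       (simp add: Hom_ch_dif_apply Wg.inv_eq_kos)
  then show "dif (Hom_ch V W) r f k \<in> hom (grp V k) (grp W (k + (r - 1)))"
    by (simp add: algebra_simps)
qed (simp add: Hom_ch_def)


section \<open>Tensor powers of a complex\<close>

lemma (in graded_group) multiadditive_one:
  assumes "multiadditive A n k H \<phi>" "comm_group H" "us @ (i, \<one>\<^bsub>grp A i\<^esub>) # vs \<in> tgens A n k"
  shows "\<phi> (us @ (i, \<one>\<^bsub>grp A i\<^esub>) # vs) = \<one>\<^bsub>H\<^esub>"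
proof -
  interpret G: comm_group "grp A i" by (rule groups)
  interpret H: comm_group H by fact
  have "\<phi> (us @ (i, \<one>\<^bsub>grp A i\<^esub>) # vs) = \<phi> (us @ (i, \<one>\<^bsub>grp A i\<^esub>) # vs) \<otimes>\<^bsub>H\<^esub> \<phi> (us @ (i, \<one>\<^bsub>grp A i\<^esub>) # vs)"
    using multiadditive_mult[OF assms(1,3,3)] by simp
  then show ?thesis using multiadditive_closed[OF assms(1,3)] H.l_cancel_one' by metis
qed

definition dif_op :: "('a, 'm) ch_scheme \<Rightarrow> (int \<times> 'a) list \<Rightarrow> int \<times> 'a" where
  "dif_op A xs = (fst (hd xs) - 1, dif A (fst (hd xs)) (snd (hd xs)))"

locale complex =
  fixes A :: "('a, 'm) ch_scheme"
  assumes complex: "chain_complex A"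

sublocale complex \<subseteq> graded_group A
  using complex by (rule chain_complex_graded_group)

lemma length1_conv: "length xs = Suc 0 \<longleftrightarrow> (\<exists>x. xs = [x])"
  by (auto simp: length_Suc_conv)

context graded_group
begin

lemma unary_homogeneous_op:
  assumes "\<And>i a. a \<in> carrier (grp A i) \<Longrightarrow> fst (g [(i, a)]) = i + r"
    and "\<And>i. (\<lambda>a. snd (g [(i, a)])) \<in> hom (grp A i) (grp A (i + r))"
  shows "homogeneous_op A 1 r g"
  unfolding homogeneous_op_def
proof (intro allI conjI ballI)
  fix k xs assume "xs \<in> tgens A 1 k"
  then show "fst (g xs) = k + r" using assms(1) by (auto simp: tgens_def length1_conv)
next
  fix k
  show "multiadditive A 1 k (grp A (k + r)) (snd \<circ> g)"
  proof (rule multiadditiveI)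
    fix xs assume "xs \<in> tgens A 1 k"
    then show "(snd \<circ> g) xs \<in> carrier (grp A (k + r))"
      using hom_in_carrier[OF assms(2)] by (auto simp: tgens_def length1_conv)
  next
    fix us i a b vs assume ab: "us @ (i, a) # vs \<in> tgens A 1 k" "us @ (i, b) # vs \<in> tgens A 1 k"
    moreover have "us = []" "vs = []" using tgens_length[OF ab(1)] by auto
    ultimately show "(snd \<circ> g) (us @ (i, a \<otimes>\<^bsub>grp A i\<^esub> b) # vs) =
      (snd \<circ> g) (us @ (i, a) # vs) \<otimes>\<^bsub>grp A (k + r)\<^esub> (snd \<circ> g) (us @ (i, b) # vs)"
      using hom_mult[OF assms(2)] by (auto simp: tgens_append tgens_Cons)
  qed
qed

lemma hd_homogeneous_op: "homogeneous_op A 1 0 hd"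
  by (rule unary_homogeneous_op) (auto simp: hom_def)

end

context complex
begin

lemma dif_homogeneous_op: "homogeneous_op A 1 (-1) (dif_op A)"
  using dif_hom[OF complex] by (intro unary_homogeneous_op) (simp_all add: dif_op_def)

lemma list_update_dif_op:
  "i < length xs \<Longrightarrow> xs[i := (fst (xs ! i) - 1, dif A (fst (xs ! i)) (snd (xs ! i)))] = insert_op i 1 (dif_op A) xs"
  by (simp add: insert_op_def upd_conv_take_nth_drop dif_op_def take_Suc_conv_app_nth hd_drop_conv_nth take_Suc hd_conv_nth)

definition dif_entry :: "nat \<Rightarrow> (int \<times> 'a) list \<Rightarrow> (int \<times> 'a) list" where
  "dif_entry i xs = xs[i := (fst (xs ! i) - 1, dif A (fst (xs ! i)) (snd (xs ! i)))]"

lemma length_dif_entry [simp]: "length (dif_entry i xs) = length xs"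
  by (simp add: dif_entry_def)

lemma tgens_dif_entry: "xs \<in> tgens A n k \<Longrightarrow> i < n \<Longrightarrow> k' = k - 1 \<Longrightarrow> dif_entry i xs \<in> tgens A n k'"
  using tgens_insert_op'[OF dif_homogeneous_op, of xs n k i n k'] tgens_length[of xs A n k]
  by (simp add: dif_entry_def list_update_dif_op)

lemma dif_tpow_multiadditive:
  "multiadditive A n k (tgrp A n (k - 1)) (\<lambda>xs. finprod (tgrp A n (k - 1))
     (\<lambda>i. kos (tgrp A n (k - 1)) (wt (take i xs)) (pure A (dif_entry i xs))) {..<n})"
proof (intro multiadditive_finprod multiadditive_kos tgrp_comm_group)
  fix i assume i: "i \<in> {..<n}"
  have "multiadditive A n k (tgrp A n (k - 1)) (\<lambda>xs. pure A (insert_op i 1 (dif_op A) xs))"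
    using i by (intro multiadditive_insert_op[OF dif_homogeneous_op pure_multiadditive]) auto
  then show "multiadditive A n k (tgrp A n (k - 1)) (\<lambda>xs. pure A (dif_entry i xs))"
    by (rule multiadditive_cong) (use i in \<open>auto simp: dif_entry_def list_update_dif_op dest: tgens_length\<close>)
qed (metis take_map wt_def)

lemma dif_tpow: "dif (tpow A n) k = tlift A n k (tgrp A n (k - 1)) (\<lambda>xs. finprod (tgrp A n (k - 1))
     (\<lambda>i. kos (tgrp A n (k - 1)) (wt (take i xs)) (pure A (dif_entry i xs))) {..<n})"
  by (simp add: tpow_def dif_entry_def)

lemma dif_tpow_pure:
  assumes "xs \<in> tgens A n k" "k' = k - 1"
  shows "dif (tpow A n) k (pure A xs) = finprod (tgrp A n k')
     (\<lambda>i. kos (tgrp A n k') (wt (take i xs)) (pure A (dif_entry i xs))) {..<n}"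
  using tlift_pure[OF tgrp_comm_group dif_tpow_multiadditive assms(1)] assms(2) by (simp add: dif_tpow)

lemma dif_tpow_hom: "dif (tpow A n) k \<in> hom (tgrp A n k) (tgrp A n (k - 1))"
  unfolding dif_tpow by (rule tlift_hom[OF tgrp_comm_group dif_tpow_multiadditive])

text \<open>
  The terms of \<open>d\<^sup>2\<close> with differentials on two different factors cancel in pairs, since the differential on the
  left factor changes the Koszul sign of the one on the right factor.
\<close>

lemma tpow_complex: "chain_complex (tpow A n)"
  unfolding chain_complex_def
proof (intro allI conjI ballI)
  fix k
  show "comm_group (grp (tpow A n) k)" by (simp add: tgrp_comm_group)
  show "dif (tpow A n) k \<in> hom (grp (tpow A n) k) (grp (tpow A n) (k - 1))"
    using dif_tpow_hom by simp
  fix X assume "X \<in> carrier (grp (tpow A n) k)"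
  then have X: "X \<in> carrier (tgrp A n k)" by simp
  let ?T = "tgrp A n (k - 2)"
  interpret T: comm_group "tgrp A n j" for j by (rule tgrp_comm_group)
  interpret Ag: comm_group "grp A j" for j by (rule groups)
  have h: "dif (tpow A n) (k - 1) \<in> hom (tgrp A n (k - 1)) ?T"
    using dif_tpow_hom[of n "k - 1"] by simp
  have "dif (tpow A n) (k - 1) (dif (tpow A n) k (pure A xs)) = \<one>\<^bsub>?T\<^esub>" if xs: "xs \<in> tgens A n k" for xs
  proof -
    have len: "length xs = n" using tgens_length[OF xs] .
    have c1: "dif_entry i xs \<in> tgens A n (k - 1)" if "i < n" for i
      using tgens_dif_entry[OF xs that] by simp
    have c2: "dif_entry j (dif_entry i xs) \<in> tgens A n (k - 2)" if "i < n" "j < n" for i j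
      using tgens_dif_entry[OF c1[OF that(1)] that(2)] by simp
    let ?f = "\<lambda>i j. kos ?T (wt (take i xs)) (kos ?T (wt (take j (dif_entry i xs))) (pure A (dif_entry j (dif_entry i xs))))"
    have "dif (tpow A n) (k - 1) (dif (tpow A n) k (pure A xs)) =
      finprod ?T (\<lambda>i. kos ?T (wt (take i xs)) (dif (tpow A n) (k - 1) (pure A (dif_entry i xs)))) {..<n}"
      unfolding dif_tpow_pure[OF xs refl]
      by (rule hom_finprod_kos[OF h tgrp_comm_group tgrp_comm_group]) (use c1 in \<open>auto simp: pure_closed\<close>)
    also have "\<dots> = finprod ?T (\<lambda>i. finprod ?T (?f i) {..<n}) {..<n}"
    proof (rule T.finprod_eq)
      fix i assume "i \<in> {..<n}"
      then have i: "i < n" by simp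
      show "kos ?T (wt (take i xs)) (dif (tpow A n) (k - 1) (pure A (dif_entry i xs))) = finprod ?T (?f i) {..<n}"
        using c2[OF i] by (subst dif_tpow_pure[OF c1[OF i]])
          (auto simp: pure_closed intro!: T.kos_finprod)
    qed (use c2 in \<open>auto simp: pure_closed intro!: T.finprod_in\<close>)
    also have "\<dots> = \<one>\<^bsub>?T\<^esub>"
    proof (rule T.finprod_antisymmetric)
      fix i j assume ij: "i < j" "j < n"
      have "dif_entry j (dif_entry i xs) = dif_entry i (dif_entry j xs)"
        using ij len by (simp add: dif_entry_def list_update_swap)
      moreover have "take i (dif_entry j xs) = take i xs" using ij by (simp add: dif_entry_def)
      moreover have "wt (take j (dif_entry i xs)) = wt (take j xs) - 1"
      proof -
        have "take j xs \<in> tgens A j (wt (take j xs))"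
          using xs ij len tgens_append[of "take j xs" "drop j xs" A n k] by simp
        from tgens_dif_entry[OF this ij(1) refl] have "wt (dif_entry i (take j xs)) = wt (take j xs) - 1"
          by (rule tgens_wt)
        moreover have "take j (dif_entry i xs) = dif_entry i (take j xs)"
          using ij len by (simp add: dif_entry_def take_update_swap)
        ultimately show ?thesis by simp
      qed
      ultimately show "?f i j \<otimes>\<^bsub>?T\<^esub> ?f j i = \<one>\<^bsub>?T\<^esub>"
        using c2[of i j] c2[of j i] ij by (simp add: T.kos_kos pure_closed T.kos_cancel)
    next
      fix i assume i: "i < n"
      define a where "a = snd (xs ! i)"
      define l where "l = fst (xs ! i)"
      have a: "a \<in> carrier (grp A l)" using tgens_nth[OF xs i] by (simp add: a_def l_def)
      have d0: "dif A (l - 1) (dif A l a) = \<one>\<^bsub>grp A (l - 2)\<^esub>"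
        using a complex by (simp add: chain_complex_def)
      have "dif_entry i (dif_entry i xs) = xs[i := (l - 2, \<one>\<^bsub>grp A (l - 2)\<^esub>)]"
        using i len d0 by (simp add: dif_entry_def a_def l_def)
      then have e: "dif_entry i (dif_entry i xs) = take i xs @ (l - 2, \<one>\<^bsub>grp A (l - 2)\<^esub>) # drop (Suc i) xs"
        using i len by (simp add: upd_conv_take_nth_drop)
      have "pure A (dif_entry i (dif_entry i xs)) = \<one>\<^bsub>?T\<^esub>"
        unfolding e
        by (rule multiadditive_one[OF pure_multiadditive tgrp_comm_group]) (use c2[OF i i] e in simp)
      then show "?f i i = \<one>\<^bsub>?T\<^esub>" by simp
    qed (use c2 in \<open>auto simp: pure_closed\<close>)
    finally show ?thesis .
  qed
  then show "dif (tpow A n) (k - 1) (dif (tpow A n) k X) = \<one>\<^bsub>grp (tpow A n) (k - 2)\<^esub>"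
    using tgrp_hom_eqI[OF hom_comp[OF dif_tpow_hom h] _ T.is_group _ X, of "\<lambda>_. \<one>\<^bsub>?T\<^esub>"]
    by (simp add: hom_def)
qed

end


section \<open>Morphisms of the endomorphism prop\<close>

locale dga =
  fixes A :: "'a dga"
  assumes dga: "dg_algebra A"

sublocale dga \<subseteq> complex A
  using dga by unfold_locales (simp add: dg_algebra_def)

context dga
begin

lemma mul_hom_right: "a \<in> carrier (grp A i) \<Longrightarrow> mul A i j a \<in> hom (grp A j) (grp A (i + j))"
  and mul_hom_left: "b \<in> carrier (grp A j) \<Longrightarrow> (\<lambda>a. mul A i j a b) \<in> hom (grp A i) (grp A (i + j))"
  and mul_assoc: "a \<in> carrier (grp A i) \<Longrightarrow> b \<in> carrier (grp A j) \<Longrightarrow> c \<in> carrier (grp A k) \<Longrightarrow>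
        mul A (i + j) k (mul A i j a b) c = mul A i (j + k) a (mul A j k b c)"
  and dif_mul: "a \<in> carrier (grp A i) \<Longrightarrow> b \<in> carrier (grp A j) \<Longrightarrow>
        dif A (i + j) (mul A i j a b) =
        mul A (i - 1) j (dif A i a) b \<otimes>\<^bsub>grp A (i + j - 1)\<^esub>
          kos (grp A (i + j - 1)) i (mul A i (j - 1) a (dif A j b))"
  using dga by (auto simp: dg_algebra_def)

lemma mul_closed:
  "a \<in> carrier (grp A i) \<Longrightarrow> b \<in> carrier (grp A j) \<Longrightarrow> k = i + j \<Longrightarrow> mul A i j a b \<in> carrier (grp A k)"
  using hom_in_carrier[OF mul_hom_right] by simp

lemma mul_op_multiadditive: "multiadditive A 2 k (grp A k) (\<lambda>xs. snd (mulh A (hd xs) (hd (tl xs))))"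
proof (rule multiadditiveI)
  fix xs assume xs: "xs \<in> tgens A 2 k"
  then obtain x y where xy: "xs = [x, y]"
    using tgens_length[OF xs] by (auto simp: numeral_2_eq_2 length_Suc_conv)
  then have "k = fst x + fst y" using xs by (simp add: tgens_Cons')
  then show "snd (mulh A (hd xs) (hd (tl xs))) \<in> carrier (grp A k)"
    using xs xy mul_closed by (auto simp: tgens_Cons' mulh_def)
next
  fix us i a b vs
  assume a: "us @ (i, a) # vs \<in> tgens A 2 k" and b: "us @ (i, b) # vs \<in> tgens A 2 k"
  have "length us + length vs = 1" using tgens_length[OF a] by simp
  then consider y where "us = []" "vs = [y]" | x where "us = [x]" "vs = []"
    by (cases us; cases vs) auto
  then show "snd (mulh A (hd (us @ (i, a \<otimes>\<^bsub>grp A i\<^esub> b) # vs)) (hd (tl (us @ (i, a \<otimes>\<^bsub>grp A i\<^esub> b) # vs)))) =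
      snd (mulh A (hd (us @ (i, a) # vs)) (hd (tl (us @ (i, a) # vs)))) \<otimes>\<^bsub>grp A k\<^esub>
      snd (mulh A (hd (us @ (i, b) # vs)) (hd (tl (us @ (i, b) # vs))))"
  proof cases
    case (1 y)
    then have "k = i + fst y" using a by (simp add: tgens_Cons')
    then show ?thesis using 1 a b hom_mult[OF mul_hom_left] by (simp add: tgens_Cons' mulh_def)
  next
    case (2 x)
    then have "k = fst x + i" using a by (simp add: tgens_Cons')
    then show ?thesis using 2 a b hom_mult[OF mul_hom_right] by (simp add: tgens_Cons' mulh_def)
  qed
qed

lemma mulh_homogeneous_op:
  assumes g: "homogeneous_op A s r g" and h: "homogeneous_op A t r' h"
  shows "homogeneous_op A (s + t) (r + r') (\<lambda>xs. mulh A (g (take s xs)) (h (drop s xs)))"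
  unfolding homogeneous_op_def comp_def
proof (intro allI conjI ballI)
  fix k xs assume xs: "xs \<in> tgens A (s + t) k"
  then have "take s xs \<in> tgens A s (wt (take s xs))" "drop s xs \<in> tgens A t (k - wt (take s xs))"
    using tgens_length[OF xs] tgens_append[of "take s xs" "drop s xs" A "s + t" k] by auto
  then show "fst (mulh A (g (take s xs)) (h (drop s xs))) = k + (r + r')"
    using homogeneous_op_fst[OF g] homogeneous_op_fst[OF h] by (simp add: mulh_def)
next
  fix k
  \<comment> \<open>insert \<open>h\<close> and \<open>g\<close> into the two arguments of the multiplication\<close>
  have "multiadditive A (s + t) k (grp A (k + (r + r')))
      (\<lambda>xs. snd (mulh A (hd (insert_op 1 t h (insert_op 0 s g xs))) (hd (tl (insert_op 1 t h (insert_op 0 s g xs))))))"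
    by (rule multiadditive_insert_op[OF g multiadditive_insert_op[OF h mul_op_multiadditive], where n' = "1 + t" and k' = "k + r"])
       auto
  then show "multiadditive A (s + t) k (grp A (k + (r + r'))) (\<lambda>xs. snd (mulh A (g (take s xs)) (h (drop s xs))))"
    by (rule multiadditive_cong) (auto simp: insert_op_def dest: tgens_length)
qed

text \<open>The decomposition of a pure tensor that a cochain of arity \<open>q\<close> sees: it takes the factors \<open>as\<close>.\<close>

lemma tgens_split:
  assumes xs: "xs \<in> tgens A (m + q) k" and m: "m \<ge> 1"
  obtains a as bs where "xs = a # as @ bs" "snd a \<in> carrier (grp A (fst a))"
    "as \<in> tgens A q (wt as)" "bs \<in> tgens A (m - 1) (k - fst a - wt as)"
proof -
  obtain P as bs where 1: "xs = P @ as @ bs" "length P = 1" "length as = q" "length bs = m - 1"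
    using list_split3[of xs 1 q "m - 1"] tgens_length[OF xs] m by auto
  then obtain a where P: "P = [a]" by (auto simp: length_Suc_conv)
  show thesis
    using xs 1 unfolding P by (intro that[of a as bs]) (auto simp: tgens_append tgens_Cons')
qed

end


definition mul_op :: "'a dga \<Rightarrow> (int \<times> 'a) list \<Rightarrow> int \<times> 'a" where
  "mul_op A xs = mulh A (hd xs) (hd (tl xs))"

text \<open>
  The morphism of the prop by which a cochain \<open>D\<close> of arity \<open>q\<close> acts from \<open>A\<^bsup>\<otimes>m+q\<^esup>\<close> to \<open>A\<^bsup>\<otimes>m\<^esup>\<close>.
  Indexing by the target keeps truncated subtraction out of the proofs.
\<close>

definition cap_mor :: "'a dga \<Rightarrow> nat \<Rightarrow> nat \<Rightarrow> int \<Rightarrow> (int \<Rightarrow> 'a tens \<Rightarrow> 'a) \<Rightarrow> int \<Rightarrow> 'a tens \<Rightarrow> 'a tens" where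
  "cap_mor A m q r D = cap_hom A (m + q - 1) q r D"

lemma wt_cong: "map fst xs = map fst ys \<Longrightarrow> wt xs = wt ys"
  by (simp add: wt_def)

lemma fst_hd_cong:
  fixes xs ys :: "('b \<times> 'c) list"
  shows "map fst xs = map fst ys \<Longrightarrow> fst (hd xs) = fst (hd ys)"
  by (cases xs; cases ys) auto

lemma fst_last_cong:
  fixes xs ys :: "('b \<times> 'c) list"
  shows "map fst xs = map fst ys \<Longrightarrow> fst (last xs) = fst (last ys)"
  by (cases xs rule: rev_cases; cases ys rule: rev_cases) auto

lemma wt_butlast_cong: "map fst xs = map fst ys \<Longrightarrow> wt (butlast xs) = wt (butlast ys)"
  by (rule wt_cong) (simp add: map_butlast)

context dga
begin

lemma mul_homogeneous_op: "homogeneous_op A 2 0 (mul_op A)"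
proof -
  have "mul_op A = (\<lambda>xs. mulh A (hd (take 1 xs)) (hd (drop 1 xs)))"
    by (rule ext, rename_tac xs, case_tac xs) (auto simp: mul_op_def)
  then show ?thesis
    using mulh_homogeneous_op[OF hd_homogeneous_op hd_homogeneous_op] by (simp add: numeral_2_eq_2)
qed

lemma face_multiadditive:
  assumes "i < n" "2 \<le> n"
  shows "multiadditive A n j (tgrp A (n - 1) j) (\<lambda>xs.
     if i + 1 < n
     then pure A (take i xs @ mulh A (xs ! i) (xs ! (i + 1)) # drop (i + 2) xs)
     else kos (tgrp A (n - 1) j) (fst (last xs) * wt (butlast xs))
            (pure A (mulh A (last xs) (hd xs) # tl (butlast xs))))"
proof (cases "i + 1 < n")
  case True
  have "multiadditive A n j (tgrp A (n - 1) j) (\<lambda>xs. pure A (insert_op i 2 (mul_op A) xs))"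
    using True by (intro multiadditive_insert_op[OF mul_homogeneous_op pure_multiadditive]) auto
  moreover have "insert_op i 2 (mul_op A) xs = take i xs @ mulh A (xs ! i) (xs ! (i + 1)) # drop (i + 2) xs"
    if "xs \<in> tgens A n j" for xs
    using True tgens_length[OF that]
    by (simp add: insert_op_def mul_op_def numeral_2_eq_2 take_Suc_conv_app_nth take_Suc hd_drop_conv_nth tl_drop flip: drop_Suc)
  ultimately show ?thesis using True by (auto intro: multiadditive_cong)
next
  case False
  have "multiadditive A n j (tgrp A (n - 1) j) (\<lambda>xs. pure A (insert_op 0 2 (mul_op A) (last xs # butlast xs)))"
    using assms by (intro multiadditive_rotate multiadditive_insert_op[OF mul_homogeneous_op pure_multiadditive]) auto
  moreover have "insert_op 0 2 (mul_op A) (last xs # butlast xs) = mulh A (last xs) (hd xs) # tl (butlast xs)"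
    if "xs \<in> tgens A n j" for xs
  proof -
    have "length xs \<ge> 2" using tgens_length[OF that] assms by simp
    then obtain x ys z where "xs = x # ys @ [z]"
      by (cases xs; cases "tl xs" rule: rev_cases) auto
    then show ?thesis by (simp add: insert_op_def mul_op_def)
  qed
  ultimately have "multiadditive A n j (tgrp A (n - 1) j) (\<lambda>xs. pure A (mulh A (last xs) (hd xs) # tl (butlast xs)))"
    by (auto elim: multiadditive_cong)
  then have "multiadditive A n j (tgrp A (n - 1) j) (\<lambda>xs. kos (tgrp A (n - 1) j) (fst (last xs) * wt (butlast xs))
            (pure A (mulh A (last xs) (hd xs) # tl (butlast xs))))"
    by (rule multiadditive_kos[OF _ tgrp_comm_group]) (metis fst_last_cong wt_butlast_cong)
  then show ?thesis using False by simp
qed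

lemma face_closed:
  assumes "i < n" "2 \<le> n"
  shows "face A n i \<in> carrier (grp (Hom_ch (tpow A n) (tpow A (n - 1))) 0)"
  using tlift_Hom_ch[OF tpow_graded_group, of n "n - 1" 0] face_multiadditive[OF assms]
  by (simp add: face_def)

lemma face_inner:
  assumes "P @ x # y # Q \<in> tgens A n j" "length P = i"
  shows "face A n i j (pure A (P @ x # y # Q)) = pure A (P @ mulh A x y # Q)"
proof -
  have "length P + length Q + 2 = n" using tgens_length[OF assms(1)] by simp
  then have "i < n" "2 \<le> n" "i + 1 < n" using assms(2) by auto
  then show ?thesis
    using tlift_pure[OF tgrp_comm_group face_multiadditive assms(1), of i] assms(2)
    by (simp add: face_def nth_append)
qed

lemma face_cyclic:
  assumes "x # P @ [y] \<in> tgens A n j" "i + 1 = n"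
  shows "face A n i j (pure A (x # P @ [y])) =
    kos (tgrp A (n - 1) j) (fst y * (fst x + wt P)) (pure A (mulh A y x # P))"
proof -
  have "length P + 2 = n" using tgens_length[OF assms(1)] by simp
  then have "i < n" "2 \<le> n" "\<not> i + 1 < n" using assms(2) by auto
  then show ?thesis
    using tlift_pure[OF tgrp_comm_group face_multiadditive assms(1), of i] assms(2)
    by (simp add: face_def butlast_append)
qed

lemma app_homogeneous_op:
  assumes D: "D \<in> carrier (grp (Hom_ch (tpow A q) A) r)"
  shows "homogeneous_op A q r (app A r D)"
  unfolding homogeneous_op_def comp_def
proof (intro allI conjI ballI)
  fix k
  show "multiadditive A q k (grp A (k + r)) (\<lambda>xs. snd (app A r D xs))"
    by (rule multiadditive_cong[OF multiadditive_hom[OF pure_multiadditive]])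
       (use Hom_ch_hom[OF D refl] in \<open>auto simp: app_def dest: tgens_wt\<close>)
qed (auto simp: app_def dest: tgens_wt)

lemma cap_op_homogeneous_op:
  assumes D: "D \<in> carrier (grp (Hom_ch (tpow A q) A) r)"
  shows "homogeneous_op A (q + 1) r (\<lambda>xs. mulh A (hd xs) (app A r D (tl xs)))"
proof -
  have "(\<lambda>xs. mulh A (hd xs) (app A r D (tl xs))) = (\<lambda>xs. mulh A (hd (take 1 xs)) (app A r D (drop 1 xs)))"
    by (rule ext, rename_tac xs, case_tac xs) auto
  then show ?thesis
    using mulh_homogeneous_op[OF hd_homogeneous_op app_homogeneous_op[OF D]] by simp
qed

lemma cap_multiadditive:
  assumes D: "D \<in> carrier (grp (Hom_ch (tpow A q) A) r)" and m: "m \<ge> 1"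
  shows "multiadditive A (m + q) j (tgrp A m (j + r)) (\<lambda>xs.
     kos (tgrp A m (j + r)) ((j + int (m + q - 1) - fst (hd xs)) * r)
       (pure A (mulh A (hd xs) (app A r D (take q (tl xs))) # drop (q + 1) xs)))"
proof (rule multiadditive_kos[OF _ tgrp_comm_group])
  have "multiadditive A (m + q) j (tgrp A m (j + r))
      (\<lambda>xs. pure A (insert_op 0 (q + 1) (\<lambda>xs. mulh A (hd xs) (app A r D (tl xs))) xs))"
    using m by (intro multiadditive_insert_op[OF cap_op_homogeneous_op[OF D] pure_multiadditive]) auto
  moreover have "insert_op 0 (q + 1) (\<lambda>xs. mulh A (hd xs) (app A r D (tl xs))) xs =
      mulh A (hd xs) (app A r D (take q (tl xs))) # drop (q + 1) xs" if "xs \<in> tgens A (m + q) j" for xs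
    using tgens_length[OF that] m by (cases xs) (auto simp: insert_op_def)
  ultimately show "multiadditive A (m + q) j (tgrp A m (j + r))
      (\<lambda>xs. pure A (mulh A (hd xs) (app A r D (take q (tl xs))) # drop (q + 1) xs))"
    by (auto elim: multiadditive_cong)
qed (metis fst_hd_cong)

lemma cap_mor_eq:
  assumes "m \<ge> 1"
  shows "cap_mor A m q r D = (\<lambda>j. tlift A (m + q) j (tgrp A m (j + r)) (\<lambda>xs.
     kos (tgrp A m (j + r)) ((j + int (m + q - 1) - fst (hd xs)) * r)
       (pure A (mulh A (hd xs) (app A r D (take q (tl xs))) # drop (q + 1) xs))))"
  using assms by (simp add: cap_mor_def cap_hom_def)

lemma cap_mor_closed:
  assumes "D \<in> carrier (grp (Hom_ch (tpow A q) A) r)" "m \<ge> 1"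
  shows "cap_mor A m q r D \<in> carrier (grp (Hom_ch (tpow A (m + q)) (tpow A m)) r)"
  using tlift_Hom_ch[OF tpow_graded_group, of "m + q" m r] cap_multiadditive[OF assms]
  by (simp add: cap_mor_eq[OF assms(2)])

lemma cap_mor_pure:
  assumes "D \<in> carrier (grp (Hom_ch (tpow A q) A) r)" "m \<ge> 1"
    and "a # as @ bs \<in> tgens A (m + q) j" "length as = q" "j' = j + r"
  shows "cap_mor A m q r D j (pure A (a # as @ bs)) =
    kos (tgrp A m j') ((j + int m + int q - 1 - fst a) * r) (pure A (mulh A a (app A r D as) # bs))"
  using tlift_pure[OF tgrp_comm_group cap_multiadditive[OF assms(1,2)] assms(3)] assms(2,4,5)
  by (simp add: cap_mor_eq of_nat_diff algebra_simps)

lemma hcoch_int_closed: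
  assumes D: "D \<in> carrier (grp (Hom_ch (tpow A q) A) r)"
  shows "hcoch_int A q r D \<in> carrier (grp (Hom_ch (tpow A q) A) (r - 1))"
  unfolding Hom_ch_carrier
proof (intro allI conjI)
  fix k
  have 1: "(\<lambda>x. dif A (k + r) (D k x)) \<in> hom (tgrp A q k) (grp A (k + r - 1))"
    using hom_comp[OF Hom_ch_hom[OF D refl] dif_hom[OF complex refl]] by simp
  have 2: "(\<lambda>x. D (k - 1) (dif (tpow A q) k x)) \<in> hom (tgrp A q k) (grp A (k + r - 1))"
    using hom_comp[OF dif_tpow_hom, of "D (k - 1)" q k "grp A (k + r - 1)"] Hom_ch_hom[OF D, of "k + r - 1" "k - 1"] by simp
  have "(\<lambda>x. dif A (k + r) (D k x) \<otimes>\<^bsub>grp A (k + r - 1)\<^esub>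
       kos (grp A (k + r - 1)) (r + 1) (D (k - 1) (dif (tpow A q) k x))) \<in> hom (tgrp A q k) (grp A (k + r - 1))"
    by (intro hom_times hom_kos_comp 1 2 groups)
  then have "hcoch_int A q r D k \<in> hom (tgrp A q k) (grp A (k + r - 1))"
    by (rule group.hom_restrict[OF comm_group.axioms(2)[OF tgrp_comm_group]])
       (simp add: hcoch_int_def)
  then show "hcoch_int A q r D k \<in> hom (grp (tpow A q) k) (grp A (k + (r - 1)))"
    by (simp add: algebra_simps)
qed (simp add: hcoch_int_def)

lemma hcoch_ext_multiadditive:
  assumes D: "D \<in> carrier (grp (Hom_ch (tpow A q) A) r)"
  shows "multiadditive A (q + 1) k (grp A (k + r)) (\<lambda>xs.
     kos (grp A (k + r)) (r * fst (hd xs)) (snd (mulh A (hd xs) (app A r D (tl xs))))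
     \<otimes>\<^bsub>grp A (k + r)\<^esub>
     finprod (grp A (k + r))
       (\<lambda>i. kos (grp A (k + r)) (int i)
          (snd (app A r D (take (i - 1) xs @ mulh A (xs ! (i - 1)) (xs ! i) # drop (i + 1) xs))))
       {1..q}
     \<otimes>\<^bsub>grp A (k + r)\<^esub>
     kos (grp A (k + r)) (int q + 1) (snd (mulh A (app A r D (butlast xs)) (last xs))))"
proof (intro multiadditive_times multiadditive_finprod multiadditive_kos groups)
  show "multiadditive A (q + 1) k (grp A (k + r)) (\<lambda>xs. snd (mulh A (hd xs) (app A r D (tl xs))))"
    by (rule homogeneous_op_snd[OF cap_op_homogeneous_op[OF D]])
next
  fix i assume "i \<in> {1..q}"
  then have i: "1 \<le> i" "i \<le> q" by auto
  have "multiadditive A (q + 1) k (grp A (k + r)) (\<lambda>xs. snd (app A r D (insert_op (i - 1) 2 (mul_op A) xs)))"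
    using i homogeneous_op_snd[OF app_homogeneous_op[OF D]]
    by (intro multiadditive_insert_op[OF mul_homogeneous_op]) auto
  moreover have "insert_op (i - 1) 2 (mul_op A) xs = take (i - 1) xs @ mulh A (xs ! (i - 1)) (xs ! i) # drop (i + 1) xs"
    if xs: "xs \<in> tgens A (q + 1) k" for xs
  proof -
    obtain P M Q where 1: "xs = P @ M @ Q" "length P = i - 1" "length M = 2" "length Q = q - i"
      using list_split3[of xs "i - 1" 2 "q - i"] i tgens_length[OF xs] by auto
    then obtain x y where "M = [x, y]" by (auto simp: numeral_2_eq_2 length_Suc_conv)
    then show ?thesis using 1 i insert_op_append[of P "i - 1" "[x, y]" 2 "mul_op A" Q]
      by (cases i) (auto simp: mul_op_def nth_append)
  qed
  ultimately show "multiadditive A (q + 1) k (grp A (k + r))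
      (\<lambda>xs. snd (app A r D (take (i - 1) xs @ mulh A (xs ! (i - 1)) (xs ! i) # drop (i + 1) xs)))"
    by (auto elim: multiadditive_cong)
next
  have "homogeneous_op A (q + 1) r (\<lambda>xs. mulh A (app A r D (take q xs)) (hd (drop q xs)))"
    using mulh_homogeneous_op[OF app_homogeneous_op[OF D] hd_homogeneous_op] by simp
  then show "multiadditive A (q + 1) k (grp A (k + r)) (\<lambda>xs. snd (mulh A (app A r D (butlast xs)) (last xs)))"
    by (rule multiadditive_cong[OF homogeneous_op_snd])
       (auto simp: length_Suc_conv_rev dest!: tgens_length)
qed (metis fst_hd_cong, rule refl, rule refl)

lemma hcoch_ext_closed:
  assumes "D \<in> carrier (grp (Hom_ch (tpow A q) A) r)"
  shows "hcoch_ext A q r D \<in> carrier (grp (Hom_ch (tpow A (q + 1)) A) r)"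
  using tlift_Hom_ch[OF graded_group_axioms hcoch_ext_multiadditive[OF assms]]
  by (simp add: hcoch_ext_def)

lemma hcoch_ext_pure:
  assumes "D \<in> carrier (grp (Hom_ch (tpow A q) A) r)" "xs \<in> tgens A (q + 1) k"
  shows "hcoch_ext A q r D k (pure A xs) =
     kos (grp A (k + r)) (r * fst (hd xs)) (snd (mulh A (hd xs) (app A r D (tl xs))))
     \<otimes>\<^bsub>grp A (k + r)\<^esub>
     finprod (grp A (k + r))
       (\<lambda>i. kos (grp A (k + r)) (int i)
          (snd (app A r D (take (i - 1) xs @ mulh A (xs ! (i - 1)) (xs ! i) # drop (i + 1) xs))))
       {1..q}
     \<otimes>\<^bsub>grp A (k + r)\<^esub>
     kos (grp A (k + r)) (int q + 1) (snd (mulh A (app A r D (butlast xs)) (last xs)))"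
  using tlift_pure[OF groups hcoch_ext_multiadditive[OF assms(1)] assms(2)]
  by (simp add: hcoch_ext_def)

end


section \<open>The cap product with a coboundary\<close>

context dga
begin

lemma mulh_assoc:
  assumes "snd x \<in> carrier (grp A (fst x))" "snd y \<in> carrier (grp A (fst y))" "snd z \<in> carrier (grp A (fst z))"
  shows "mulh A (mulh A x y) z = mulh A x (mulh A y z)"
  using mul_assoc[OF assms] by (simp add: mulh_def add.assoc)

lemma fst_mulh [simp]: "fst (mulh A x y) = fst x + fst y"
  by (simp add: mulh_def)

lemma mulh_closed:
  assumes "snd x \<in> carrier (grp A (fst x))" "snd y \<in> carrier (grp A (fst y))"
  shows "snd (mulh A x y) \<in> carrier (grp A (fst (mulh A x y)))"
  using mul_closed[OF assms] by (simp add: mulh_def)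

lemma fst_app [simp]: "fst (app A r D xs) = wt xs + r"
  by (simp add: app_def)

text \<open>
  Every term in which a face or a differential meets \<open>D\<close> has the form \<open>\<plusminus> ay \<otimes> bs\<close> with \<open>y \<in> A\<close>. By the
  following lemma such terms can be added up in the factor \<open>y\<close>, where they become the coboundary of \<open>D\<close>.
\<close>

lemma mulh_pure_hom:
  assumes a: "snd a \<in> carrier (grp A (fst a))" and bs: "bs \<in> tgens A (m - 1) kb" and "m \<ge> 1"
    and "k = fst a + w + kb"
  shows "(\<lambda>y. pure A (mulh A a (w, y) # bs)) \<in> hom (grp A w) (tgrp A m k)"
proof -
  interpret Ag: comm_group "grp A j" for j by (rule groups)
  have c: "mul A (fst a) w (snd a) y \<in> carrier (grp A (fst a + w))" if "y \<in> carrier (grp A w)" for y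
    using mul_closed[OF a that] by simp
  have t: "(fst a + w, z) # bs \<in> tgens A m k" if "z \<in> carrier (grp A (fst a + w))" for z
    using that bs assms(3,4) by (simp add: tgens_Cons)
  show ?thesis
  proof (rule homI)
    fix y assume y: "y \<in> carrier (grp A w)"
    show "pure A (mulh A a (w, y) # bs) \<in> carrier (tgrp A m k)"
      using t[OF c[OF y]] by (simp add: mulh_def pure_closed)
    fix z assume z: "z \<in> carrier (grp A w)"
    show "pure A (mulh A a (w, y \<otimes>\<^bsub>grp A w\<^esub> z) # bs) =
       pure A (mulh A a (w, y) # bs) \<otimes>\<^bsub>tgrp A m k\<^esub> pure A (mulh A a (w, z) # bs)"
      using hom_mult[OF mul_hom_right[OF a] y z]
        multiadditive_mult[OF pure_multiadditive, of "[]", simplified, OF t[OF c[OF y]] t[OF c[OF z]]]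
      by (simp add: mulh_def)
  qed
qed

text \<open>
  The faces of \<open>a\<^sub>0D(a\<^sub>1,\<dots>,a\<^sub>q) \<otimes> a\<^bsub>q+1\<^esub> \<otimes> \<dots>\<close> other than the first one, including the cyclic one, commute with the
  insertion of \<open>D\<close> and cancel against faces of \<open>a\<^sub>0 \<otimes> a\<^sub>1 \<otimes> \<dots>\<close>. Left are the first face, which gives
  \<open>a\<^sub>0D(a\<^sub>1,\<dots>,a\<^sub>q)a\<^bsub>q+1\<^esub>\<close>, and the faces \<open>0,\<dots>,q\<close> of \<open>a\<^sub>0 \<otimes> a\<^sub>1 \<otimes> \<dots>\<close>, which give \<open>a\<^sub>0a\<^sub>1D(a\<^sub>2,\<dots>)\<close> and the
  \<open>a\<^sub>0D(\<dots>,a\<^sub>ia\<^bsub>i+1\<^esub>,\<dots>)\<close>. These are \<open>a\<^sub>0\<close> times the terms of the coboundary.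
\<close>

lemma cap_mor_hcoch_ext:
  assumes D: "D \<in> carrier (grp (Hom_ch (tpow A q) A) r)" and m: "m \<ge> 1"
  defines "G \<equiv> grp (Hom_ch (tpow A (m + q + 1)) (tpow A m)) r"
  shows "finprod G (\<lambda>i. kos G (int q + r + 1 + int i)
            (hcomp (tpow A (m + q + 1)) r (face A (m + 1) i) (cap_mor A (m + 1) q r D))) {..<m + 1}
      \<otimes>\<^bsub>G\<^esub> finprod G (\<lambda>i. kos G (int i)
            (hcomp (tpow A (m + q + 1)) 0 (cap_mor A m q r D) (face A (m + q + 1) i))) {..<m + q + 1}
      = kos G r (cap_mor A m (q + 1) r (hcoch_ext A q r D))" (is "?lhs = ?rhs")
proof -
  let ?N = "m + q + 1"
  let ?l = "\<lambda>i. hcomp (tpow A ?N) r (face A (m + 1) i) (cap_mor A (m + 1) q r D)"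
  let ?r = "\<lambda>i. hcomp (tpow A ?N) 0 (cap_mor A m q r D) (face A ?N i)"
  note gg = tpow_graded_group
  interpret G: comm_group G unfolding G_def by (rule Hom_ch_comm_group[OF gg gg])
  have E: "hcoch_ext A q r D \<in> carrier (grp (Hom_ch (tpow A (q + 1)) A) r)" by (rule hcoch_ext_closed[OF D])
  have c1: "cap_mor A (m + 1) q r D \<in> carrier (grp (Hom_ch (tpow A ?N) (tpow A (m + 1))) r)"
    using cap_mor_closed[OF D, of "m + 1"] by simp
  have c2: "cap_mor A m q r D \<in> carrier (grp (Hom_ch (tpow A (m + q)) (tpow A m)) r)"
    using cap_mor_closed[OF D m] .
  have c3: "cap_mor A m (q + 1) r (hcoch_ext A q r D) \<in> carrier G"
    using cap_mor_closed[OF E m] by (simp add: G_def)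
  have l: "?l i \<in> carrier G" if "i < m + 1" for i
    unfolding G_def using face_closed[of i "m + 1"] that m by (intro hcomp_closed[OF gg c1]) auto
  have r: "?r i \<in> carrier G" if "i < ?N" for i
    unfolding G_def using face_closed[of i "?N"] that m by (intro hcomp_closed[OF gg _ c2]) auto
  have lhs: "?lhs \<in> carrier G" and rhs: "?rhs \<in> carrier G"
    using l r c3 by (auto intro!: G.finprod_in)
  show ?thesis
  proof (rule tpow_Hom_ch_eqI[OF lhs[unfolded G_def] rhs[unfolded G_def] gg, folded G_def])
    fix k xs assume xs: "xs \<in> tgens A ?N k"
    let ?T = "tgrp A m (k + r)"
    let ?X = "pure A xs"
    interpret T: comm_group "tgrp A n j" for n j by (rule tgrp_comm_group)
    interpret Ag: comm_group "grp A j" for j by (rule groups)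
    have X: "?X \<in> carrier (grp (tpow A ?N) k)" using xs by (simp add: pure_closed)
    define L where "L = (\<lambda>i. kos ?T (int q + r + 1 + int i) (?l i k ?X))"
    define R where "R = (\<lambda>i. kos ?T (int i) (?r i k ?X))"
    have Lc: "L i \<in> carrier ?T" if "i < Suc m" for i
      unfolding L_def using Hom_ch_closed[OF l[unfolded G_def] X refl, of i] that by simp
    have Rc: "R i \<in> carrier ?T" if "i < Suc (q + m)" for i
      unfolding R_def using Hom_ch_closed[OF r[unfolded G_def] X refl, of i] that by (simp add: add.commute)
    have xs': "xs \<in> tgens A (m + (q + 1)) k" using xs by simp
    obtain a zs bs where azb: "xs = a # zs @ bs" and a: "snd a \<in> carrier (grp A (fst a))"
      and zst: "zs \<in> tgens A (q + 1) (wt zs)" and bst: "bs \<in> tgens A (m - 1) (k - fst a - wt zs)"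
      by (rule tgens_split[OF xs' m])
    have lz: "length zs = q + 1" "length bs = m - 1" using tgens_length[OF zst] tgens_length[OF bst] .
    \<comment> \<open>\<open>D\<close> takes the entries \<open>as\<close> and its coboundary the entries \<open>zs = as @ [c]\<close>\<close>
    obtain as c where zs: "zs = as @ [c]" using lz(1) by (cases zs rule: rev_cases) auto
    have len: "length as = q" "length bs = m - 1" using lz zs by auto
    have xs_eq: "xs = a # as @ c # bs" using azb zs by simp
    define Z where "Z = mulh A a (app A r D as)"
    have as: "as \<in> tgens A q (wt as)"
      using xs len unfolding xs_eq by (auto simp: tgens_append tgens_Cons')
    have Zcb: "Z # c # bs \<in> tgens A (m + 1) (k + r)"
      using tgens_insert_op[OF cap_op_homogeneous_op[OF D], of "[]" "a # as" "c # bs" ?N k "m + 1" "k + r"] xs len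
      by (simp add: xs_eq Z_def)
    have lval: "?l i k ?X = kos ?T ((k + int m + int q - fst a) * r) (face A (m + 1) i (k + r) (pure A (Z # c # bs)))"
      if i: "i < m + 1" for i
    proof -
      have "?l i k ?X = face A (m + 1) i (k + r) (cap_mor A (m + 1) q r D k ?X)"
        using X by (simp add: hcomp_apply)
      also have "cap_mor A (m + 1) q r D k ?X =
          kos (tgrp A (m + 1) (k + r)) ((k + int m + int q - fst a) * r) (pure A (Z # c # bs))"
        using cap_mor_pure[OF D, of "m + 1" a as "c # bs" k "k + r"] xs len unfolding xs_eq
        by (simp add: Z_def add.commute add.left_commute)
      also have "face A (m + 1) i (k + r) \<dots> =
          kos ?T ((k + int m + int q - fst a) * r) (face A (m + 1) i (k + r) (pure A (Z # c # bs)))"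
      proof (rule hom_kos[OF _ T.is_group T.is_group pure_closed[OF Zcb]])
        show "face A (m + 1) i (k + r) \<in> hom (tgrp A (m + 1) (k + r)) ?T"
          using Hom_ch_hom[OF face_closed[of i "m + 1"], of "k + r" "k + r"] i m by simp
      qed
      finally show ?thesis .
    qed
    have rval: "?r i k ?X = cap_mor A m q r D k (face A ?N i k ?X)" for i
      using X by (simp add: hcomp_apply)
    have Lval: "L i = kos ?T (int q + r + 1 + int i + (k + int m + int q - fst a) * r)
        (face A (m + 1) i (k + r) (pure A (Z # c # bs)))" if i: "i < Suc m" for i
    proof -
      have "face A (m + 1) i (k + r) (pure A (Z # c # bs)) \<in> carrier ?T"
        using Hom_ch_closed[OF face_closed[of i "m + 1"], of "pure A (Z # c # bs)" "k + r" "k + r"] i m pure_closed[OF Zcb] by simp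
      then show ?thesis unfolding L_def using lval[of i] i by (simp add: T.kos_kos)
    qed
    have Rval: "R i = kos ?T (int i) (cap_mor A m q r D k (face A ?N i k ?X))" for i
      unfolding R_def rval ..
    have "?lhs k ?X = finprod ?T L {..<m + 1} \<otimes>\<^bsub>?T\<^esub> finprod ?T R {..<?N}"
      using Hom_ch_finprod_kos_apply[OF gg gg l[unfolded G_def] X, of "{..<m + 1}"]
        Hom_ch_finprod_kos_apply[OF gg gg r[unfolded G_def] X, of "{..<?N}"]
      unfolding G_def L_def R_def by (simp only: Hom_ch_mult_apply[OF X] lessThan_iff grp_tpow)
    also have "\<dots> = finprod ?T L {..<Suc m} \<otimes>\<^bsub>?T\<^esub> finprod ?T R {..<Suc (q + m)}"
      by (simp add: add.commute)
    also have "\<dots> = L 0 \<otimes>\<^bsub>?T\<^esub> finprod ?T R {..<Suc q}"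
    proof (rule T.finprod_telescope[OF Lc Rc])
      fix i assume i: "1 \<le> i" "i \<le> m"
      show "L i \<otimes>\<^bsub>?T\<^esub> R (q + i) = \<one>\<^bsub>?T\<^esub>"
      proof (cases "i < m")
        case True
        \<comment> \<open>a face behind \<open>D\<close>: it multiplies the neighbours \<open>x\<close> and \<open>y\<close>\<close>
        obtain P M Q where PMQ: "c # bs = P @ M @ Q" "length P = i - 1" "length M = 2" "length Q = m - i - 1"
          using list_split3[of "c # bs" "i - 1" 2 "m - i - 1"] i True len by auto
        then obtain x y where M: "M = [x, y]" by (auto simp: numeral_2_eq_2 length_Suc_conv)
        have cb: "c # bs = P @ x # y # Q" using PMQ(1) M by simp
        let ?p = "pure A (Z # P @ mulh A x y # Q)"
        have xs2: "xs = (a # as @ P) @ x # y # Q" using xs_eq cb by simp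
        have Zt: "(Z # P) @ x # y # Q \<in> tgens A (m + 1) (k + r)" using Zcb cb by simp
        have t: "a # as @ P @ mulh A x y # Q \<in> tgens A (m + q) k"
          using xs len mulh_closed[of x y] unfolding xs2 by (auto simp: tgens_append tgens_Cons' algebra_simps)
        have p: "?p \<in> carrier ?T"
          using Zt mulh_closed[of x y] by (intro pure_closed) (auto simp: tgens_append tgens_Cons' algebra_simps)
        have "face A (m + 1) i (k + r) (pure A (Z # c # bs)) = ?p"
          using face_inner[OF Zt, of i] i PMQ(2) cb by simp
        then have 1: "L i = kos ?T (int q + r + 1 + int i + (k + int m + int q - fst a) * r) ?p"
          using p i by (simp add: Lval)
        have "face A ?N (q + i) k ?X = pure A (a # as @ P @ mulh A x y # Q)"
          using face_inner[OF xs[unfolded xs2], of "q + i"] i PMQ(2) len xs2 by simp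
        then have 2: "R (q + i) = kos ?T (int q + int i + (k + int m + int q - 1 - fst a) * r) ?p"
          using cap_mor_pure[OF D m t len(1) refl] p by (simp add: Rval T.kos_kos Z_def)
        have "(int q + r + 1 + int i + (k + int m + int q - fst a) * r) -
            (int q + int i + (k + int m + int q - 1 - fst a) * r) = 2 * r + 1"
          by (simp add: algebra_simps)
        then show ?thesis unfolding 1 2 using p by (intro T.kos_cancel) simp_all
      next
        case False
        \<comment> \<open>the cyclic faces agree since \<open>(y a) D(as) = y (a D(as))\<close>\<close>
        then have im: "i = m" using i by simp
        obtain P y where cb: "c # bs = P @ [y]" by (metis rev_exhaust list.distinct(1))
        have lP: "length P + 1 = m" using arg_cong[OF cb, of length] len m by simp
        let ?p = "pure A (mulh A y Z # P)"
        have xs2: "xs = a # (as @ P) @ [y]" using xs_eq cb by simp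
        have Zt: "Z # P @ [y] \<in> tgens A (m + 1) (k + r)" using Zcb cb by simp
        have ent: "snd y \<in> carrier (grp A (fst y))" "snd a \<in> carrier (grp A (fst a))"
          "snd Z \<in> carrier (grp A (fst Z))" "snd (app A r D as) \<in> carrier (grp A (fst (app A r D as)))"
          using xs Zt homogeneous_op_closed[OF app_homogeneous_op[OF D] as]
          unfolding xs2 by (auto simp: tgens_append tgens_Cons')
        have t: "mulh A y a # as @ P \<in> tgens A (m + q) k"
          using xs len lP mulh_closed[OF ent(1,2)] unfolding xs2
          by (auto simp: tgens_append tgens_Cons' algebra_simps)
        have p: "?p \<in> carrier ?T"
          using Zt lP mulh_closed[OF ent(1,3)] by (intro pure_closed) (auto simp: tgens_append tgens_Cons' algebra_simps)
        have "face A (m + 1) i (k + r) (pure A (Z # c # bs)) = kos ?T (fst y * (fst Z + wt P)) ?p"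
          using face_cyclic[OF Zt, of i] im cb by simp
        then have 1: "L i = kos ?T (int q + r + 1 + int m + (k + int m + int q - fst a) * r +
            fst y * (fst Z + wt P)) ?p"
          using p im by (simp add: Lval T.kos_kos add.assoc)
        have "face A ?N (q + i) k ?X = kos (tgrp A (m + q) k) (fst y * (fst a + wt as + wt P)) (pure A (mulh A y a # as @ P))"
          using face_cyclic[OF xs[unfolded xs2], of "q + i"] im xs2 by (simp add: add.assoc)
        then have "R (q + i) = kos ?T (int q + int m) (kos ?T (fst y * (fst a + wt as + wt P))
            (cap_mor A m q r D k (pure A (mulh A y a # as @ P))))"
          using hom_kos[OF Hom_ch_hom[OF c2 refl, of k, simplified] T.is_group T.is_group pure_closed[OF t]] im
          by (simp add: Rval)
        moreover have "mulh A (mulh A y a) (app A r D as) = mulh A y Z"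
          unfolding Z_def using ent by (intro mulh_assoc) auto
        ultimately have 2: "R (q + i) = kos ?T (int q + int m + fst y * (fst a + wt as + wt P) +
            (k + int m + int q - 1 - (fst y + fst a)) * r) ?p"
          using cap_mor_pure[OF D m t len(1) refl] p by (simp add: T.kos_kos add.assoc)
        have "(int q + r + 1 + int m + (k + int m + int q - fst a) * r + fst y * (fst Z + wt P)) -
            (int q + int m + fst y * (fst a + wt as + wt P) + (k + int m + int q - 1 - (fst y + fst a)) * r)
            = 2 * (r + fst y * r) + 1"
          by (simp add: algebra_simps Z_def)
        then show ?thesis unfolding 1 2 using p by (intro T.kos_cancel) simp_all
      qed
    qed
    also have "\<dots> = ?rhs k ?X"
    proof -
      define w where "w = wt zs"
      define u where "u = (k + int m + int q - fst a) * r"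
      define \<Lambda> where "\<Lambda> = (\<lambda>y. pure A (mulh A a (w + r, y) # bs))"
      note zst = zst[folded w_def] and bst = bst[folded w_def]
      have \<Lambda>: "\<Lambda> \<in> hom (grp A (w + r)) ?T"
        unfolding \<Lambda>_def using m by (intro mulh_pure_hom[OF a bst]) auto
      let ?W = "grp A (w + r)"
      \<comment> \<open>up to sign, the coboundary of \<open>D\<close> at \<open>zs\<close> is the sum of \<open>t1\<close>, the \<open>t2 i\<close> and \<open>t3\<close>\<close>
      define t1 where "t1 = snd (mulh A (hd zs) (app A r D (tl zs)))"
      define t2 where "t2 i = snd (app A r D (take (i - 1) zs @ mulh A (zs ! (i - 1)) (zs ! i) # drop (i + 1) zs))" for i
      define t3 where "t3 = snd (mulh A (app A r D (butlast zs)) (last zs))"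
      have t1: "t1 \<in> carrier ?W"
        unfolding t1_def by (rule multiadditive_closed[OF homogeneous_op_snd[OF cap_op_homogeneous_op[OF D]] zst])
      have ent: "snd (app A r D as) \<in> carrier (grp A (fst (app A r D as)))" "snd c \<in> carrier (grp A (fst c))"
        using homogeneous_op_closed[OF app_homogeneous_op[OF D] as] zst
        unfolding zs by (auto simp: tgens_append tgens_Cons')
      have deg3: "fst (mulh A (app A r D as) c) = w + r" by (simp add: w_def zs)
      have t3: "t3 \<in> carrier ?W"
        using mulh_closed[OF ent] unfolding deg3 by (simp add: t3_def zs)
      have split: "\<exists>P x y Q. zs = P @ x # y # Q \<and> length P = i - 1 \<and> take (i - 1) zs @ mulh A (zs ! (i - 1)) (zs ! i) # drop (i + 1) zs
          = P @ mulh A x y # Q" if i: "1 \<le> i" "i \<le> q" for i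
      proof -
        obtain P M Q where 1: "zs = P @ M @ Q" "length P = i - 1" "length M = 2" "length Q = q - i"
          using list_split3[of zs "i - 1" 2 "q - i"] i lz(1) by auto
        then obtain x y where "M = [x, y]" by (auto simp: numeral_2_eq_2 length_Suc_conv)
        with 1 i have "zs = P @ x # y # Q \<and> length P = i - 1 \<and>
            take (i - 1) zs @ mulh A (zs ! (i - 1)) (zs ! i) # drop (i + 1) zs = P @ mulh A x y # Q"
          by (cases i) (auto simp: nth_append)
        then show ?thesis by blast
      qed
      have l2: "take (i - 1) zs @ mulh A (zs ! (i - 1)) (zs ! i) # drop (i + 1) zs \<in> tgens A q w"
        if i: "1 \<le> i" "i \<le> q" for i
      proof -
        obtain P x y Q where 1: "zs = P @ x # y # Q" "length P = i - 1"
          "take (i - 1) zs @ mulh A (zs ! (i - 1)) (zs ! i) # drop (i + 1) zs = P @ mulh A x y # Q"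
          using split[OF i] by blast
        show ?thesis unfolding 1(3)
          using zst mulh_closed[of x y] unfolding 1(1) by (auto simp: tgens_append tgens_Cons' algebra_simps)
      qed
      have t2: "t2 i \<in> carrier ?W" if "1 \<le> i" "i \<le> q" for i
        unfolding t2_def by (rule multiadditive_closed[OF homogeneous_op_snd[OF app_homogeneous_op[OF D]] l2[OF that]])
      have t2': "t2 i \<in> carrier ?W" if "i \<in> {1..q}" for i using t2 that by simp
      note \<Lambda>c = hom_in_carrier[OF \<Lambda>]
      have L0: "L 0 = kos ?T (int q + r + 1 + u) (\<Lambda> t3)"
      proof -
        have "mulh A Z c = mulh A a (mulh A (app A r D as) c)"
          unfolding Z_def using ent a by (intro mulh_assoc) auto
        also have "mulh A (app A r D as) c = (w + r, t3)"
          using deg3 by (simp add: t3_def zs prod_eq_iff)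
        finally have "face A (m + 1) 0 (k + r) (pure A (Z # c # bs)) = \<Lambda> t3"
          using face_inner[of "[]" Z c bs "m + 1" "k + r" 0] Zcb by (simp add: \<Lambda>_def)
        then show ?thesis using \<Lambda>c[OF t3] by (simp add: Lval T.kos_kos u_def)
      qed
      have R0: "R 0 = kos ?T (u - r - r * fst (hd zs)) (\<Lambda> t1)"
      proof -
        obtain y ys where y: "zs = y # ys" using lz(1) by (cases zs) auto
        have ys: "length ys = q" using lz(1) y by simp
        have yt: "ys \<in> tgens A q (wt ys)" "snd y \<in> carrier (grp A (fst y))" using zst unfolding y
          by (auto simp: tgens_Cons' tgens_def)
        have 1: "[] @ a # y # ys @ bs \<in> tgens A ?N k" using xs azb y by simp
        have t: "mulh A a y # ys @ bs \<in> tgens A (m + q) k"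
          using 1 mulh_closed[OF a yt(2)] by (auto simp: tgens_append tgens_Cons' algebra_simps)
        have "face A ?N 0 k ?X = pure A (mulh A a y # ys @ bs)"
          using face_inner[OF 1, of 0] azb y by simp
        moreover have "mulh A (mulh A a y) (app A r D ys) = mulh A a (w + r, t1)"
        proof -
          have "mulh A (mulh A a y) (app A r D ys) = mulh A a (mulh A y (app A r D ys))"
            using a yt(2) homogeneous_op_closed[OF app_homogeneous_op[OF D] yt(1)] by (intro mulh_assoc) auto
          also have "mulh A y (app A r D ys) = (w + r, t1)"
            by (simp add: prod_eq_iff t1_def y w_def)
          finally show ?thesis .
        qed
        ultimately have "R 0 = kos ?T ((k + int m + int q - 1 - (fst a + fst y)) * r) (\<Lambda> t1)"
          using cap_mor_pure[OF D m t ys refl] \<Lambda>c[OF t1] by (simp add: Rval T.kos_kos \<Lambda>_def)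
        also have "(k + int m + int q - 1 - (fst a + fst y)) * r = u - r - r * fst (hd zs)"
          by (simp add: u_def y algebra_simps)
        finally show ?thesis .
      qed
      have Ri: "R i = kos ?T (int i + u - r) (\<Lambda> (t2 i))" if i: "1 \<le> i" "i \<le> q" for i
      proof -
        obtain P x y Q where 1: "zs = P @ x # y # Q" "length P = i - 1"
          "take (i - 1) zs @ mulh A (zs ! (i - 1)) (zs ! i) # drop (i + 1) zs = P @ mulh A x y # Q"
          using split[OF i] by blast
        have lt: "P @ mulh A x y # Q \<in> tgens A q w" using l2[OF i] 1(3) by simp
        have 2: "(a # P) @ x # y # Q @ bs \<in> tgens A ?N k" using xs azb 1 by simp
        have t: "a # (P @ mulh A x y # Q) @ bs \<in> tgens A (m + q) k"
          using lt bst a tgens_length[OF lt] tgens_wt[OF lt] m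
          by (simp add: tgens_append[of "P @ mulh A x y # Q" bs] tgens_Cons' del: append_assoc)
        have "face A ?N i k ?X = pure A (a # (P @ mulh A x y # Q) @ bs)"
          using face_inner[OF 2, of i] azb 1 i by simp
        moreover have "app A r D (P @ mulh A x y # Q) = (w + r, t2 i)"
          using tgens_wt[OF lt] unfolding t2_def 1(3) by (simp add: prod_eq_iff)
        ultimately have "R i = kos ?T (int i + (k + int m + int q - 1 - fst a) * r) (\<Lambda> (t2 i))"
          using cap_mor_pure[OF D m t tgens_length[OF lt] refl] \<Lambda>c[OF t2[OF i]]
          by (simp add: Rval T.kos_kos \<Lambda>_def)
        also have "int i + (k + int m + int q - 1 - fst a) * r = int i + u - r"
          by (simp add: u_def algebra_simps)
        finally show ?thesis .
      qed
      let ?F = "finprod ?W (\<lambda>i. kos ?W (int i) (t2 i)) {1..q}"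
      have F: "?F \<in> carrier ?W" using t2 by (auto intro!: Ag.finprod_in)
      have "hcoch_ext A q r D w (pure A zs) =
          kos ?W (r * fst (hd zs)) t1 \<otimes>\<^bsub>?W\<^esub> ?F \<otimes>\<^bsub>?W\<^esub> kos ?W (int q + 1) t3"
        unfolding hcoch_ext_pure[OF D zst] t1_def t2_def t3_def ..
      then have "app A r (hcoch_ext A q r D) zs = (w + r, kos ?W (r * fst (hd zs)) t1 \<otimes>\<^bsub>?W\<^esub> ?F \<otimes>\<^bsub>?W\<^esub> kos ?W (int q + 1) t3)"
        by (simp add: app_def w_def)
      then have "?rhs k ?X = kos ?T (r + u) (\<Lambda> (kos ?W (r * fst (hd zs)) t1 \<otimes>\<^bsub>?W\<^esub> ?F \<otimes>\<^bsub>?W\<^esub> kos ?W (int q + 1) t3))"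
        using cap_mor_pure[OF E m, of a zs bs k "k + r"] xs azb lz(1) c3 \<Lambda>c t1 t3 F
          Hom_ch_kos_apply[OF gg gg c3[unfolded G_def] X, of r]
        by (simp add: G_def T.kos_kos \<Lambda>_def u_def add.assoc)
      also have "\<Lambda> (kos ?W (r * fst (hd zs)) t1 \<otimes>\<^bsub>?W\<^esub> ?F \<otimes>\<^bsub>?W\<^esub> kos ?W (int q + 1) t3) =
          kos ?T (r * fst (hd zs)) (\<Lambda> t1) \<otimes>\<^bsub>?T\<^esub>
          finprod ?T (\<lambda>i. kos ?T (int i) (\<Lambda> (t2 i))) {1..q} \<otimes>\<^bsub>?T\<^esub> kos ?T (int q + 1) (\<Lambda> t3)"
      proof -
        have "\<Lambda> ?F = finprod ?T (\<lambda>i. kos ?T (int i) (\<Lambda> (t2 i))) {1..q}"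
          by (rule hom_finprod_kos[OF \<Lambda> groups tgrp_comm_group t2'])
        then show ?thesis
          using t1 t3 F by (simp add: hom_mult[OF \<Lambda>] hom_kos[OF \<Lambda> Ag.is_group T.is_group])
      qed
      also have "kos ?T (r + u) \<dots> = kos ?T (r + u + r * fst (hd zs)) (\<Lambda> t1) \<otimes>\<^bsub>?T\<^esub>
          finprod ?T (\<lambda>i. kos ?T (r + u + int i) (\<Lambda> (t2 i))) {1..q} \<otimes>\<^bsub>?T\<^esub> kos ?T (r + u + (int q + 1)) (\<Lambda> t3)"
      proof -
        have "kos ?T (r + u) (finprod ?T (\<lambda>i. kos ?T (int i) (\<Lambda> (t2 i))) {1..q}) =
            finprod ?T (\<lambda>i. kos ?T (r + u + int i) (\<Lambda> (t2 i))) {1..q}"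
          by (rule T.kos_finprod_kos) (use \<Lambda>c[OF t2'] in auto)
        moreover have "finprod ?T (\<lambda>i. kos ?T (int i) (\<Lambda> (t2 i))) {1..q} \<in> carrier ?T"
          using t2' \<Lambda>c by (auto intro!: T.finprod_in)
        ultimately show ?thesis
          using \<Lambda>c[OF t1] \<Lambda>c[OF t3] by (simp add: T.kos_mult T.kos_kos)
      qed
      also have "kos ?T (r + u + r * fst (hd zs)) (\<Lambda> t1) = R 0"
        unfolding R0 by (rule T.kos_cong) (simp add: algebra_simps)
      also have "kos ?T (r + u + (int q + 1)) (\<Lambda> t3) = L 0"
        unfolding L0 by (rule T.kos_cong) (simp add: algebra_simps)
      also have "finprod ?T (\<lambda>i. kos ?T (r + u + int i) (\<Lambda> (t2 i))) {1..q} = finprod ?T R {1..q}"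
      proof (rule T.finprod_eq)
        fix i assume "i \<in> {1..q}"
        then have i: "1 \<le> i" "i \<le> q" by auto
        show "kos ?T (r + u + int i) (\<Lambda> (t2 i)) = R i"
          unfolding Ri[OF i] by (rule T.kos_cong) (simp add: algebra_simps)
      qed (use Rc in auto)
      finally have rhs': "?rhs k ?X = R 0 \<otimes>\<^bsub>?T\<^esub> finprod ?T R {1..q} \<otimes>\<^bsub>?T\<^esub> L 0" .
      have "{..<Suc q} = insert 0 {1..q}" by auto
      moreover have "finprod ?T R (insert 0 {1..q}) = R 0 \<otimes>\<^bsub>?T\<^esub> finprod ?T R {1..q}"
        using Rc by (intro T.finprod_insert) auto
      moreover have "finprod ?T R {1..q} \<in> carrier ?T" using Rc by (auto intro!: T.finprod_in)
      ultimately show ?thesis unfolding rhs' using Rc[of 0] Lc[of 0] by (simp add: T.m_ac)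
    qed
    finally show "?lhs k ?X = ?rhs k ?X" .
  qed
qed


lemma pure_Cons_hom:
  assumes bs: "bs \<in> tgens A (m - 1) (k - j)" and "m \<ge> 1"
  shows "(\<lambda>z. pure A ((j, z) # bs)) \<in> hom (grp A j) (tgrp A m k)"
proof -
  have t: "(j, z) # bs \<in> tgens A m k" if "z \<in> carrier (grp A j)" for z
    using that assms by (simp add: tgens_Cons)
  show ?thesis
    using t multiadditive_mult[OF pure_multiadditive, of "[]", simplified, OF t t]
    by (intro homI) (auto simp: pure_closed)
qed

text \<open>
  The terms of \<open>d(a \<inter> D)\<close> with the differential on \<open>a\<^sub>0\<close> or on a factor behind \<open>D\<close> also occur in \<open>(da) \<inter> D\<close>
  and cancel. The remaining ones are \<open>a\<^sub>0 d(D(a\<^sub>1,\<dots>,a\<^sub>q))\<close> and \<open>a\<^sub>0 D(d(a\<^sub>1 \<otimes> \<dots> \<otimes> a\<^sub>q))\<close>.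
\<close>

lemma cap_mor_hcoch_int:
  assumes D: "D \<in> carrier (grp (Hom_ch (tpow A q) A) r)" and m: "m \<ge> 1"
  defines "H \<equiv> Hom_ch (tpow A (m + q)) (tpow A m)"
  shows "dif H r (cap_mor A m q r D) =
    kos (grp H (r - 1)) (int m + int q - 1) (cap_mor A m q (r - 1) (hcoch_int A q r D))" (is "?lhs = ?rhs")
proof -
  note gg = tpow_graded_group
  interpret G: comm_group "grp H (r - 1)" unfolding H_def by (rule Hom_ch_comm_group[OF gg gg])
  have E: "hcoch_int A q r D \<in> carrier (grp (Hom_ch (tpow A q) A) (r - 1))" by (rule hcoch_int_closed[OF D])
  have c: "cap_mor A m q r D \<in> carrier (grp H r)" unfolding H_def by (rule cap_mor_closed[OF D m])
  have c3: "cap_mor A m q (r - 1) (hcoch_int A q r D) \<in> carrier (grp H (r - 1))"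
    unfolding H_def by (rule cap_mor_closed[OF E m])
  have lhs: "?lhs \<in> carrier (grp H (r - 1))"
    using c unfolding H_def by (rule Hom_ch_dif_closed[OF tpow_complex tpow_complex])
  have rhs: "?rhs \<in> carrier (grp H (r - 1))" using c3 by simp
  show ?thesis
  proof (rule tpow_Hom_ch_eqI[OF lhs[unfolded H_def] rhs[unfolded H_def] gg, folded H_def])
    fix k xs assume xs: "xs \<in> tgens A (m + q) k"
    interpret T: comm_group "tgrp A n j" for n j by (rule tgrp_comm_group)
    interpret Ag: comm_group "grp A j" for j by (rule groups)
    let ?T = "tgrp A m (k + r - 1)"
    let ?X = "pure A xs"
    obtain m' where m': "m = Suc m'" using m by (cases m) auto
    obtain a as bs where xs_eq: "xs = a # as @ bs" and a: "snd a \<in> carrier (grp A (fst a))"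
      and as: "as \<in> tgens A q (wt as)" and bs: "bs \<in> tgens A (m - 1) (k - fst a - wt as)"
      by (rule tgens_split[OF xs m])
    have azb: "length as = q" "length bs = m'" using tgens_length[OF as] tgens_length[OF bs] m' by simp_all
    define w where "w = wt as"
    define fa where "fa = fst a"
    define u where "u = (k + int m + int q - 1 - fa) * r"
    define Z where "Z = mulh A a (app A r D as)"
    define y where "y = D w (pure A as)"
    note a = a[folded fa_def] and as = as[folded w_def]
    have bs: "bs \<in> tgens A m' (k - fa - w)" using bs m' by (simp add: w_def fa_def)
    have app: "app A r D as = (w + r, y)" by (simp add: app_def w_def y_def)
    have y: "y \<in> carrier (grp A (w + r))"
      using homogeneous_op_closed[OF app_homogeneous_op[OF D] as] app by simp
    have dy: "dif A (w + r) y \<in> carrier (grp A (w + r - 1))" by (rule dif_closed[OF complex y refl])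
    have da: "dif A fa (snd a) \<in> carrier (grp A (fa - 1))" by (rule dif_closed[OF complex a refl])
    have Zbs: "Z # bs \<in> tgens A m (k + r)"
      using tgens_insert_op[OF cap_op_homogeneous_op[OF D], of "[]" "a # as" bs "m + q" k m "k + r"] xs xs_eq azb m
      by (simp add: Z_def)
    have X: "?X \<in> carrier (grp (tpow A (m + q)) k)" using xs by (simp add: pure_closed)
    define \<Lambda> where "\<Lambda> = (\<lambda>y. pure A (mulh A a (w + r - 1, y) # bs))"
    have \<Lambda>: "\<Lambda> \<in> hom (grp A (w + r - 1)) ?T"
      unfolding \<Lambda>_def using m m' a bs by (intro mulh_pure_hom) (auto simp: fa_def)
    note \<Lambda>c = hom_in_carrier[OF \<Lambda>]
    define x1 where "x1 = pure A (mulh A (fa - 1, dif A fa (snd a)) (w + r, y) # bs)"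
    define U where "U = finprod ?T (\<lambda>i. kos ?T (fst Z + wt (take i bs)) (pure A (Z # dif_entry i bs))) {..<m'}"
    have x1t: "mulh A (fa - 1, dif A fa (snd a)) (w + r, y) # bs \<in> tgens A m (k + r - 1)"
      using mulh_closed[of "(fa - 1, dif A fa (snd a))" "(w + r, y)"] da y bs m m'
      by (auto simp: tgens_Cons' algebra_simps)
    then have x1: "x1 \<in> carrier ?T" unfolding x1_def by (rule pure_closed)
    have Zd: "Z # dif_entry i bs \<in> tgens A m (k + r - 1)" if "i < m'" for i
      using tgens_dif_entry[OF Zbs, of "Suc i" "k + r - 1"] that m' by (simp add: dif_entry_def)
    have Uc: "U \<in> carrier ?T" unfolding U_def using Zd by (auto intro!: T.finprod_in T.kos_closed pure_closed)

    \<comment> \<open>\<open>x1\<close>, \<open>\<Lambda> (dif A (w + r) y)\<close> and \<open>U\<close> are the terms with the differential on \<open>a\<close>, on the value of \<open>D\<close> and behind \<open>D\<close>\<close>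
    have cap: "cap_mor A m q r D k ?X = kos (tgrp A m (k + r)) u (pure A (Z # bs))"
      using cap_mor_pure[OF D m, of a as bs k "k + r"] xs xs_eq azb by (simp add: Z_def u_def fa_def)
    have "pure A (dif_entry 0 (Z # bs)) = x1 \<otimes>\<^bsub>?T\<^esub> kos ?T fa (\<Lambda> (dif A (w + r) y))"
    proof -
      let ?j = "fa + (w + r) - 1"
      have hj: "(\<lambda>z. pure A ((?j, z) # bs)) \<in> hom (grp A ?j) ?T"
        using bs m m' by (intro pure_Cons_hom) (simp_all add: algebra_simps)
      have m1: "mul A (fa - 1) (w + r) (dif A fa (snd a)) y \<in> carrier (grp A ?j)"
        and m2: "mul A fa (w + r - 1) (snd a) (dif A (w + r) y) \<in> carrier (grp A ?j)"
        using a da y dy by (auto intro!: mul_closed)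
      have j: "fa - 1 + (w + r) = ?j" "fa + (w + r - 1) = ?j" by simp_all
      have "dif_entry 0 (Z # bs) = (?j, dif A (fa + (w + r)) (mul A fa (w + r) (snd a) y)) # bs"
        by (simp add: dif_entry_def Z_def app mulh_def fa_def)
      also have "dif A (fa + (w + r)) (mul A fa (w + r) (snd a) y) =
          mul A (fa - 1) (w + r) (dif A fa (snd a)) y \<otimes>\<^bsub>grp A ?j\<^esub>
          kos (grp A ?j) fa (mul A fa (w + r - 1) (snd a) (dif A (w + r) y))"
        by (rule dif_mul[OF a y])
      also have "pure A ((?j, \<dots>) # bs) =
          pure A ((?j, mul A (fa - 1) (w + r) (dif A fa (snd a)) y) # bs) \<otimes>\<^bsub>?T\<^esub>
          kos ?T fa (pure A ((?j, mul A fa (w + r - 1) (snd a) (dif A (w + r) y)) # bs))"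
        using hom_mult[OF hj m1 Ag.kos_closed[OF m2]] hom_kos[OF hj Ag.is_group T.is_group m2] by simp
      finally show ?thesis
        by (simp add: x1_def \<Lambda>_def mulh_def j flip: fa_def)
    qed
    then have "dif (tpow A m) (k + r) (pure A (Z # bs)) =
        x1 \<otimes>\<^bsub>?T\<^esub> kos ?T fa (\<Lambda> (dif A (w + r) y)) \<otimes>\<^bsub>?T\<^esub> U"
    proof -
      assume *: "pure A (dif_entry 0 (Z # bs)) = x1 \<otimes>\<^bsub>?T\<^esub> kos ?T fa (\<Lambda> (dif A (w + r) y))"
      have "dif (tpow A m) (k + r) (pure A (Z # bs)) =
        finprod ?T (\<lambda>i. kos ?T (wt (take i (Z # bs))) (pure A (dif_entry i (Z # bs)))) {..<Suc m'}"
        using dif_tpow_pure[OF Zbs refl] by (simp add: m')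
      also have "\<dots> = kos ?T (wt (take 0 (Z # bs))) (pure A (dif_entry 0 (Z # bs))) \<otimes>\<^bsub>?T\<^esub>
        finprod ?T (\<lambda>i. kos ?T (wt (take (Suc i) (Z # bs))) (pure A (dif_entry (Suc i) (Z # bs)))) {..<m'}"
        using tgens_dif_entry[OF Zbs _ refl] m' by (intro T.finprod_lessThan_Suc_shift T.kos_closed pure_closed) simp
      also have "\<dots> = pure A (dif_entry 0 (Z # bs)) \<otimes>\<^bsub>?T\<^esub> U"
        by (simp add: U_def dif_entry_def)
      finally show ?thesis using * by simp
    qed
    then have dcap: "dif (tpow A m) (k + r) (cap_mor A m q r D k ?X) =
        kos ?T u (x1 \<otimes>\<^bsub>?T\<^esub> kos ?T fa (\<Lambda> (dif A (w + r) y)) \<otimes>\<^bsub>?T\<^esub> U)"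
      using hom_kos[OF dif_tpow_hom T.is_group T.is_group pure_closed[OF Zbs], of u] by (simp add: cap)

    \<comment> \<open>in the cap product of the boundary \<open>x1\<close> and \<open>U\<close> recur, with \<open>z\<close> instead of the differential of \<open>y\<close>\<close>
    define z where "z = D (w - 1) (dif (tpow A q) w (pure A as))"
    have z: "z \<in> carrier (grp A (w + r - 1))"
      using Hom_ch_closed[OF D, of _ "w - 1" "w + r - 1"] dif_closed[OF tpow_complex, of "pure A as" q w "w - 1"] as
      by (simp add: z_def pure_closed)
    have ch: "cap_mor A m q r D (k - 1) \<in> hom (tgrp A (m + q) (k - 1)) ?T"
      using Hom_ch_hom[OF c[unfolded H_def], of "k + r - 1" "k - 1"] by simp
    define C where "C i = kos ?T (wt (take i xs)) (cap_mor A m q r D (k - 1) (pure A (dif_entry i xs)))" for i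
    have xd: "dif_entry i xs \<in> tgens A (m + q) (k - 1)" if "i < m + q" for i
      using tgens_dif_entry[OF xs that refl] .
    have Cc: "C i \<in> carrier ?T" if "i < m + q" for i
      unfolding C_def using hom_in_carrier[OF ch pure_closed[OF xd[OF that]]] by simp
    have "cap_mor A m q r D (k - 1) (dif (tpow A (m + q)) k ?X) = finprod ?T C {..<m + q}"
      unfolding dif_tpow_pure[OF xs refl] C_def
      by (rule hom_finprod_kos[OF ch tgrp_comm_group tgrp_comm_group]) (use xd in \<open>auto simp: pure_closed\<close>)
    also have "\<dots> = finprod ?T C {..<Suc (q + m')}" by (simp add: m' add.commute)
    also have "\<dots> = C 0 \<otimes>\<^bsub>?T\<^esub> finprod ?T (\<lambda>i. C (Suc i)) {..<q + m'}"
      using Cc m' by (intro T.finprod_lessThan_Suc_shift) auto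
    also have "finprod ?T (\<lambda>i. C (Suc i)) {..<q + m'} =
        finprod ?T (\<lambda>i. C (Suc i)) {..<q} \<otimes>\<^bsub>?T\<^esub> finprod ?T (\<lambda>i. C (Suc (q + i))) {..<m'}"
      using Cc m' by (intro T.finprod_lessThan_add) auto
    also have "C 0 = kos ?T u x1"
    proof -
      have t: "(fa - 1, dif A fa (snd a)) # as @ bs \<in> tgens A (m + q) (k - 1)"
        using xd[of 0] m by (simp add: xs_eq dif_entry_def fa_def)
      have "(k - 1 + int m + int q - 1 - (fa - 1)) * r = u" by (simp add: u_def)
      then show ?thesis
        using cap_mor_pure[OF D m t azb(1), of "k + r - 1"]
        by (simp add: C_def xs_eq dif_entry_def x1_def app flip: fa_def)
    qed
    also have "finprod ?T (\<lambda>i. C (Suc i)) {..<q} = kos ?T (fa + u - r) (\<Lambda> z)"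
    proof -
      let ?d = "\<lambda>i. D (w - 1) (pure A (dif_entry i as))"
      have dt: "dif_entry i as \<in> tgens A q (w - 1)" if "i < q" for i
        using tgens_dif_entry[OF as that refl] .
      have dc: "?d i \<in> carrier (grp A (w + r - 1))" if "i < q" for i
        using Hom_ch_closed[OF D, of "pure A (dif_entry i as)" "w - 1" "w + r - 1"] pure_closed[OF dt[OF that]] by simp
      have Dh: "D (w - 1) \<in> hom (tgrp A q (w - 1)) (grp A (w + r - 1))"
        using Hom_ch_hom[OF D, of "w + r - 1" "w - 1"] by simp
      have "z = finprod (grp A (w + r - 1)) (\<lambda>i. kos (grp A (w + r - 1)) (wt (take i as)) (?d i)) {..<q}"
        unfolding z_def dif_tpow_pure[OF as refl]
        by (rule hom_finprod_kos[OF Dh tgrp_comm_group groups]) (use dt in \<open>auto simp: pure_closed\<close>)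
      then have "\<Lambda> z = finprod ?T (\<lambda>i. kos ?T (wt (take i as)) (\<Lambda> (?d i))) {..<q}"
        using dc by (simp only:) (rule hom_finprod_kos[OF \<Lambda> groups tgrp_comm_group], simp)
      then have "kos ?T (fa + u - r) (\<Lambda> z) = finprod ?T (\<lambda>i. kos ?T (fa + u - r + wt (take i as)) (\<Lambda> (?d i))) {..<q}"
        using dc \<Lambda>c by (simp only:) (rule T.kos_finprod_kos, auto)
      also have "\<dots> = finprod ?T (\<lambda>i. C (Suc i)) {..<q}"
      proof (rule T.finprod_eq)
        fix i assume "i \<in> {..<q}"
        then have i: "i < q" by simp
        have t: "a # dif_entry i as @ bs \<in> tgens A (m + q) (k - 1)"
          using xd[of "Suc i"] i m azb(1) by (simp add: xs_eq dif_entry_def nth_append list_update_append)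
        have ap: "app A r D (dif_entry i as) = (w + r - 1, ?d i)"
          using tgens_wt[OF dt[OF i]] by (simp add: app_def)
        have "dif_entry (Suc i) xs = a # dif_entry i as @ bs"
          using i azb(1) by (simp add: xs_eq dif_entry_def nth_append list_update_append)
        moreover have "wt (take (Suc i) xs) = fa + wt (take i as)"
          using i azb(1) by (simp add: xs_eq fa_def)
        ultimately have "C (Suc i) = kos ?T (fa + wt (take i as)) (kos ?T ((k - 1 + int m + int q - 1 - fa) * r) (\<Lambda> (?d i)))"
          using cap_mor_pure[OF D m t, of "k + r - 1"] azb(1) by (simp add: C_def ap \<Lambda>_def fa_def)
        also have "(k - 1 + int m + int q - 1 - fa) * r = u - r" by (simp add: u_def algebra_simps)
        finally show "kos ?T (fa + u - r + wt (take i as)) (\<Lambda> (?d i)) = C (Suc i)"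
          using \<Lambda>c[OF dc[OF i]] by (simp add: T.kos_kos algebra_simps)
      qed (use Cc m' in auto)
      finally show ?thesis ..
    qed
    also have "finprod ?T (\<lambda>i. C (Suc (q + i))) {..<m'} = kos ?T u U"
    proof -
      have "kos ?T u U = finprod ?T (\<lambda>i. kos ?T (u + (fst Z + wt (take i bs))) (pure A (Z # dif_entry i bs))) {..<m'}"
        unfolding U_def using Zd by (intro T.kos_finprod_kos) (auto simp: pure_closed)
      also have "\<dots> = finprod ?T (\<lambda>i. C (Suc (q + i))) {..<m'}"
      proof (rule T.finprod_eq)
        fix i assume "i \<in> {..<m'}"
        then have i: "i < m'" by simp
        have e: "dif_entry (Suc (q + i)) xs = a # as @ dif_entry i bs"
          using azb(1) by (simp add: xs_eq dif_entry_def nth_append list_update_append)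
        have t: "a # as @ dif_entry i bs \<in> tgens A (m + q) (k - 1)"
          using xd[of "Suc (q + i)"] i m' e by simp
        have "wt (take (Suc (q + i)) xs) = fa + w + wt (take i bs)"
          using azb(1) by (simp add: xs_eq fa_def w_def)
        then have "C (Suc (q + i)) = kos ?T (fa + w + wt (take i bs))
            (kos ?T ((k - 1 + int m + int q - 1 - fa) * r) (pure A (Z # dif_entry i bs)))"
          using cap_mor_pure[OF D m t azb(1), of "k + r - 1"] e by (simp add: C_def Z_def fa_def)
        also have "\<dots> = kos ?T (fa + w + wt (take i bs) + (k - 1 + int m + int q - 1 - fa) * r) (pure A (Z # dif_entry i bs))"
          using Zd[OF i] by (simp add: T.kos_kos pure_closed)
        also have "\<dots> = kos ?T (u + (fst Z + wt (take i bs))) (pure A (Z # dif_entry i bs))"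
          by (rule T.kos_cong) (simp add: u_def Z_def fa_def w_def algebra_simps)
        finally show "kos ?T (u + (fst Z + wt (take i bs))) (pure A (Z # dif_entry i bs)) = C (Suc (q + i))" ..
      qed (use Cc m' in auto)
      finally show ?thesis ..
    qed
    finally have capd: "cap_mor A m q r D (k - 1) (dif (tpow A (m + q)) k ?X) =
      kos ?T u x1 \<otimes>\<^bsub>?T\<^esub> kos ?T (fa + u - r) (\<Lambda> z) \<otimes>\<^bsub>?T\<^esub> kos ?T u U"
      using x1 Uc \<Lambda>c[OF z] by (simp add: T.m_assoc)

    let ?dy = "\<Lambda> (dif A (w + r) y)"
    have "?lhs k ?X = kos ?T k (kos ?T u (x1 \<otimes>\<^bsub>?T\<^esub> kos ?T fa ?dy \<otimes>\<^bsub>?T\<^esub> U) \<otimes>\<^bsub>?T\<^esub>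
        inv\<^bsub>?T\<^esub> (kos ?T u x1 \<otimes>\<^bsub>?T\<^esub> kos ?T (fa + u - r) (\<Lambda> z) \<otimes>\<^bsub>?T\<^esub> kos ?T u U))"
      unfolding H_def Hom_ch_dif_apply[OF X] dcap capd by simp
    also have "kos ?T u (x1 \<otimes>\<^bsub>?T\<^esub> kos ?T fa ?dy \<otimes>\<^bsub>?T\<^esub> U) = kos ?T u x1 \<otimes>\<^bsub>?T\<^esub> kos ?T (u + fa) ?dy \<otimes>\<^bsub>?T\<^esub> kos ?T u U"
      using x1 Uc \<Lambda>c[OF dy] by (simp add: T.kos_mult T.kos_kos)
    also have "\<dots> \<otimes>\<^bsub>?T\<^esub> inv\<^bsub>?T\<^esub> (kos ?T u x1 \<otimes>\<^bsub>?T\<^esub> kos ?T (fa + u - r) (\<Lambda> z) \<otimes>\<^bsub>?T\<^esub> kos ?T u U) =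
        kos ?T (u + fa) ?dy \<otimes>\<^bsub>?T\<^esub> inv\<^bsub>?T\<^esub> (kos ?T (fa + u - r) (\<Lambda> z))"
      using x1 Uc \<Lambda>c[OF dy] \<Lambda>c[OF z] by (intro T.cancel_ends) simp_all
    also have "kos ?T k \<dots> = kos ?T (k + u + fa) ?dy \<otimes>\<^bsub>?T\<^esub> kos ?T (k + 1 + fa + u - r) (\<Lambda> z)"
      using \<Lambda>c[OF dy] \<Lambda>c[OF z] by (simp add: T.kos_mult T.kos_kos T.inv_eq_kos algebra_simps)
    finally have L: "?lhs k ?X = kos ?T (k + u + fa) ?dy \<otimes>\<^bsub>?T\<^esub> kos ?T (k + 1 + fa + u - r) (\<Lambda> z)" .

    define s where "s = int m + int q - 1 + (k + int m + int q - 1 - fa) * (r - 1)"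
    have ap: "app A (r - 1) (hcoch_int A q r D) as =
        (w + r - 1, dif A (w + r) y \<otimes>\<^bsub>grp A (w + r - 1)\<^esub> kos (grp A (w + r - 1)) (r + 1) z)"
      using pure_closed[OF as] by (simp add: app_def hcoch_int_def w_def y_def z_def algebra_simps)
    have "?rhs k ?X = kos ?T (int m + int q - 1) (cap_mor A m q (r - 1) (hcoch_int A q r D) k ?X)"
      using Hom_ch_kos_apply[OF gg gg c3[unfolded H_def] X] by (simp add: H_def add_diff_eq)
    also have "cap_mor A m q (r - 1) (hcoch_int A q r D) k ?X = kos ?T ((k + int m + int q - 1 - fa) * (r - 1))
        (\<Lambda> (dif A (w + r) y \<otimes>\<^bsub>grp A (w + r - 1)\<^esub> kos (grp A (w + r - 1)) (r + 1) z))"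
      using cap_mor_pure[OF E m, of a as bs k "k + r - 1"] xs xs_eq azb ap by (simp add: \<Lambda>_def fa_def)
    also have "\<Lambda> (dif A (w + r) y \<otimes>\<^bsub>grp A (w + r - 1)\<^esub> kos (grp A (w + r - 1)) (r + 1) z) = ?dy \<otimes>\<^bsub>?T\<^esub> kos ?T (r + 1) (\<Lambda> z)"
      using dy z by (simp add: hom_mult[OF \<Lambda>] hom_kos[OF \<Lambda> Ag.is_group T.is_group])
    finally have "?rhs k ?X = kos ?T s ?dy \<otimes>\<^bsub>?T\<^esub> kos ?T (s + (r + 1)) (\<Lambda> z)"
      using \<Lambda>c[OF dy] \<Lambda>c[OF z] by (simp add: T.kos_mult T.kos_kos s_def add.assoc)
    also have "kos ?T s ?dy = kos ?T (k + u + fa) ?dy"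
      by (rule T.kos_cong) (simp add: s_def u_def algebra_simps)
    also have "kos ?T (s + (r + 1)) (\<Lambda> z) = kos ?T (k + 1 + fa + u - r) (\<Lambda> z)"
      by (rule T.kos_cong) (simp add: s_def u_def algebra_simps)
    finally show "?lhs k ?X = ?rhs k ?X" using L by simp
  qed
qed

end


section \<open>The action of cochains on Hochschild complexes\<close>

locale prop_functor = dga A for A :: "'a dga" +
  fixes \<Phi> :: "(nat, int \<Rightarrow> 'a tens \<Rightarrow> 'a tens, 'u) dgfun"
  assumes dg_functor: "dg_functor (End_cat A) \<Phi>"
begin

abbreviation E :: "nat \<Rightarrow> nat \<Rightarrow> (int \<Rightarrow> 'a tens \<Rightarrow> 'a tens) ch" where
  "E p q \<equiv> Hom_ch (tpow A p) (tpow A q)"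

lemma obj_complex: "chain_complex (obj \<Phi> n)"
  using dg_functor by (simp add: dg_functor_def End_cat_def)

lemma obj_graded_group: "graded_group (obj \<Phi> n)"
  by (rule chain_complex_graded_group[OF obj_complex])

lemma obj_group: "comm_group (grp (obj \<Phi> n) k)"
  by (rule graded_group.groups[OF obj_graded_group])

lemma mor_hom: "mor \<Phi> p q r \<in> hom (grp (E p q) r) (grp (Hom_ch (obj \<Phi> p) (obj \<Phi> q)) r)"
  and mor_dif: "f \<in> carrier (grp (E p q) r) \<Longrightarrow>
    mor \<Phi> p q (r - 1) (dif (E p q) r f) = dif (Hom_ch (obj \<Phi> p) (obj \<Phi> q)) r (mor \<Phi> p q r f)"
  and mor_comp: "f \<in> carrier (grp (E p q) r) \<Longrightarrow> g \<in> carrier (grp (E q t) s) \<Longrightarrow>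
    mor \<Phi> p t (r + s) (hcomp (tpow A p) r g f) = hcomp (obj \<Phi> p) r (mor \<Phi> q t s g) (mor \<Phi> p q r f)"
  using dg_functor by (simp_all add: dg_functor_def End_cat_def chain_maps_def)

lemma E_group: "comm_group (grp (E p q) r)"
  by (rule Hom_ch_comm_group[OF tpow_graded_group tpow_graded_group])

lemma mor_closed: "f \<in> carrier (grp (E p q) r) \<Longrightarrow> mor \<Phi> p q r f \<in> carrier (grp (Hom_ch (obj \<Phi> p) (obj \<Phi> q)) r)"
  by (rule hom_in_carrier[OF mor_hom])

lemma act_hom_left:
  "x \<in> carrier (grp (obj \<Phi> p) k) \<Longrightarrow> k' = k + r \<Longrightarrow>
    (\<lambda>f. mor \<Phi> p q r f k x) \<in> hom (grp (E p q) r) (grp (obj \<Phi> q) k')"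
  by (rule hom_comp[OF mor_hom eval_hom])

lemma act_hom_right:
  "f \<in> carrier (grp (E p q) r) \<Longrightarrow> k' = k + r \<Longrightarrow> mor \<Phi> p q r f k \<in> hom (grp (obj \<Phi> p) k) (grp (obj \<Phi> q) k')"
  by (rule Hom_ch_hom[OF mor_closed])

lemma act_closed:
  "f \<in> carrier (grp (E p q) r) \<Longrightarrow> x \<in> carrier (grp (obj \<Phi> p) k) \<Longrightarrow> k' = k + r \<Longrightarrow>
    mor \<Phi> p q r f k x \<in> carrier (grp (obj \<Phi> q) k')"
  by (rule hom_in_carrier[OF act_hom_right])

lemma act_one:
  "f \<in> carrier (grp (E p q) r) \<Longrightarrow> k' = k + r \<Longrightarrow>
    mor \<Phi> p q r f k \<one>\<^bsub>grp (obj \<Phi> p) k\<^esub> = \<one>\<^bsub>grp (obj \<Phi> q) k'\<^esub>"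
  by (rule hom_one[OF act_hom_right]) (use obj_group in \<open>auto intro: comm_group.axioms(2)\<close>)

lemma hoch_carrier:
  "x \<in> carrier (grp (hoch A \<Phi>) k) \<longleftrightarrow> x \<in> extensional {1..} \<and>
     (\<forall>n\<ge>1. x n \<in> carrier (grp (obj \<Phi> n) (k - int n + 1))) \<and>
     finite {n \<in> {1..}. x n \<noteq> \<one>\<^bsub>grp (obj \<Phi> n) (k - int n + 1)\<^esub>}"
proof -
  have "group (grp (obj \<Phi> n) (k - int n + 1))" for n
    using obj_group by (rule comm_group.axioms(2))
  then show ?thesis by (auto simp: hoch_def carrier_sum_group PiE_iff)
qed

lemma hoch_component:
  "x \<in> carrier (grp (hoch A \<Phi>) k) \<Longrightarrow> n \<ge> 1 \<Longrightarrow> k' = k - int n + 1 \<Longrightarrow> x n \<in> carrier (grp (obj \<Phi> n) k')"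
  by (simp add: hoch_carrier)

lemma hoch_support:
  assumes "x \<in> carrier (grp (hoch A \<Phi>) k)"
  obtains N where "N \<ge> 1" "\<And>n. n \<ge> N \<Longrightarrow> x n = \<one>\<^bsub>grp (obj \<Phi> n) (k - int n + 1)\<^esub>"
proof -
  have "finite {n \<in> {1..}. x n \<noteq> \<one>\<^bsub>grp (obj \<Phi> n) (k - int n + 1)\<^esub>}" using assms by (simp add: hoch_carrier)
  then obtain M where M: "\<And>n. n \<in> {n \<in> {1..}. x n \<noteq> \<one>\<^bsub>grp (obj \<Phi> n) (k - int n + 1)\<^esub>} \<Longrightarrow> n \<le> M"
    by (meson finite_nat_set_iff_bounded_le)
  show thesis
  proof (rule that[of "Suc M"])
    show "x n = \<one>\<^bsub>grp (obj \<Phi> n) (k - int n + 1)\<^esub>" if "n \<ge> Suc M" for n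
      using M[of n] that by fastforce
  qed simp
qed

lemma hoch_carrierI:
  assumes "x \<in> extensional {1..}" "\<And>n. n \<ge> 1 \<Longrightarrow> x n \<in> carrier (grp (obj \<Phi> n) (k - int n + 1))"
    and "\<And>n. n \<ge> N \<Longrightarrow> n \<ge> 1 \<Longrightarrow> x n = \<one>\<^bsub>grp (obj \<Phi> n) (k - int n + 1)\<^esub>"
  shows "x \<in> carrier (grp (hoch A \<Phi>) k)"
proof -
  have "{n \<in> {1..}. x n \<noteq> \<one>\<^bsub>grp (obj \<Phi> n) (k - int n + 1)\<^esub>} \<subseteq> {..N}"
    using assms(3) by (auto simp: not_le intro: ccontr)
  then show ?thesis using assms(1,2) by (auto simp: hoch_carrier intro: finite_subset)
qed

lemma hoch_mult: "n \<ge> 1 \<Longrightarrow> (x \<otimes>\<^bsub>grp (hoch A \<Phi>) k\<^esub> y) n = x n \<otimes>\<^bsub>grp (obj \<Phi> n) (k - int n + 1)\<^esub> y n"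
  by (simp add: hoch_def)

lemma hoch_eqI:
  assumes "x \<in> extensional {1..}" "y \<in> extensional {1..}" "\<And>n. n \<ge> (1::nat) \<Longrightarrow> x n = y n"
  shows "x = y"
  by (rule extensionalityI[OF assms(1,2)]) (use assms(3) in simp)

lemma hoch_extensional: "x \<in> carrier (grp (hoch A \<Phi>) k) \<Longrightarrow> x \<in> extensional {1..}"
  by (simp add: hoch_carrier)

lemma hoch_group: "comm_group (grp (hoch A \<Phi>) k)"
proof (rule group.group_comm_groupI)
  show "group (grp (hoch A \<Phi>) k)"
    using comm_group.axioms(2)[OF obj_group] by (simp add: hoch_def)
  fix x y assume xy: "x \<in> carrier (grp (hoch A \<Phi>) k)" "y \<in> carrier (grp (hoch A \<Phi>) k)"
  have "x n \<otimes>\<^bsub>grp (obj \<Phi> n) (k - int n + 1)\<^esub> y n = y n \<otimes>\<^bsub>grp (obj \<Phi> n) (k - int n + 1)\<^esub> x n" if "n \<ge> 1" for n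
    using comm_monoid.m_comm[OF comm_group.axioms(1)[OF obj_group] hoch_component hoch_component] xy that by blast
  then show "x \<otimes>\<^bsub>grp (hoch A \<Phi>) k\<^esub> y = y \<otimes>\<^bsub>grp (hoch A \<Phi>) k\<^esub> x"
    by (auto simp: hoch_def)
qed

lemma hoch_graded_group: "graded_group (hoch A \<Phi>)"
  by (simp add: graded_group_def hoch_group)

lemma component_hom:
  "n \<ge> 1 \<Longrightarrow> k' = k - int n + 1 \<Longrightarrow> (\<lambda>x. x n) \<in> hom (grp (hoch A \<Phi>) k) (grp (obj \<Phi> n) k')"
  by (rule homI) (simp_all add: hoch_component hoch_mult)

lemma hoch_kos:
  assumes "x \<in> carrier (grp (hoch A \<Phi>) k)" "n \<ge> 1"
  shows "kos (grp (hoch A \<Phi>) k) a x n = kos (grp (obj \<Phi> n) (k - int n + 1)) a (x n)"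
  by (rule hom_kos[OF component_hom[OF assms(2) refl] _ _ assms(1)])
     (use obj_group hoch_group in \<open>auto intro: comm_group.axioms(2)\<close>)

end

definition cap_term ::
  "'a dga \<Rightarrow> (nat, int \<Rightarrow> 'a tens \<Rightarrow> 'a tens, 'u) dgfun \<Rightarrow> int \<Rightarrow> (nat \<Rightarrow> int \<Rightarrow> 'a tens \<Rightarrow> 'a) \<Rightarrow>
    int \<Rightarrow> (nat \<Rightarrow> 'u) \<Rightarrow> nat \<Rightarrow> nat \<Rightarrow> 'u" where
  "cap_term A \<Phi> l D k x m q =
     mor \<Phi> (m + q) m (l + int q) (cap_mor A m q (l + int q) (D q)) (k - int (m + q) + 1) (x (m + q))"

text \<open>
  The transformation \<open>F(D)\<close>. The sum has only finitely many non-trivial terms because \<open>x\<close> has finite support;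
  like all morphisms here it is extensional, both in the functor and in \<open>x\<close>.
\<close>

definition cap_nat ::
  "'a dga \<Rightarrow> int \<Rightarrow> (nat \<Rightarrow> int \<Rightarrow> 'a tens \<Rightarrow> 'a) \<Rightarrow>
    (nat, int \<Rightarrow> 'a tens \<Rightarrow> 'a tens, 'u) dgfun \<Rightarrow> int \<Rightarrow> (nat \<Rightarrow> 'u) \<Rightarrow> nat \<Rightarrow> 'u" where
  "cap_nat A l D = (\<lambda>\<Phi>\<in>{\<Phi>. dg_functor (End_cat A) \<Phi>}. \<lambda>k. \<lambda>x\<in>carrier (grp (hoch A \<Phi>) k). \<lambda>m\<in>{1..}.
     gfinprod (grp (obj \<Phi> m) (k + l - int m + 1)) (cap_term A \<Phi> l D k x m) UNIV)"

lemma hoch_cochains_carrier: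
  "D \<in> carrier (grp (hoch_cochains A) l) \<longleftrightarrow> (\<forall>q. D q \<in> carrier (grp (Hom_ch (tpow A q) A) (l + int q)))"
  by (simp add: hoch_cochains_def PiE_iff)

context prop_functor
begin

lemma cap_term_closed:
  assumes "D \<in> carrier (grp (hoch_cochains A) l)" "x \<in> carrier (grp (hoch A \<Phi>) k)" "m \<ge> 1"
  shows "cap_term A \<Phi> l D k x m q \<in> carrier (grp (obj \<Phi> m) (k + l - int m + 1))"
  unfolding cap_term_def
  using assms by (intro act_closed[OF cap_mor_closed hoch_component]) (auto simp: hoch_cochains_carrier)

lemma cap_term_one:
  assumes "D \<in> carrier (grp (hoch_cochains A) l)" "m \<ge> 1"
    "x (m + q) = \<one>\<^bsub>grp (obj \<Phi> (m + q)) (k - int (m + q) + 1)\<^esub>"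
  shows "cap_term A \<Phi> l D k x m q = \<one>\<^bsub>grp (obj \<Phi> m) (k + l - int m + 1)\<^esub>"
  unfolding cap_term_def assms(3)
  using assms(1,2) by (intro act_one[OF cap_mor_closed]) (auto simp: hoch_cochains_carrier)

lemma cap_nat_component:
  assumes D: "D \<in> carrier (grp (hoch_cochains A) l)" and x: "x \<in> carrier (grp (hoch A \<Phi>) k)" and m: "m \<ge> 1"
    and N: "\<And>n. n \<ge> N \<Longrightarrow> x n = \<one>\<^bsub>grp (obj \<Phi> n) (k - int n + 1)\<^esub>"
  shows "cap_nat A l D \<Phi> k x m = finprod (grp (obj \<Phi> m) (k + l - int m + 1)) (cap_term A \<Phi> l D k x m) {..<N}"
proof -
  interpret G: comm_group "grp (obj \<Phi> m) (k + l - int m + 1)" by (rule obj_group)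
  have "cap_nat A l D \<Phi> k x m = gfinprod (grp (obj \<Phi> m) (k + l - int m + 1)) (cap_term A \<Phi> l D k x m) UNIV"
    using dg_functor x m by (simp add: cap_nat_def)
  also have "\<dots> = gfinprod (grp (obj \<Phi> m) (k + l - int m + 1)) (cap_term A \<Phi> l D k x m) {..<N}"
  proof (rule G.gfinprod_mono_neutral_cong_right)
    fix q assume "q \<in> UNIV - {..<N}"
    then have "x (m + q) = \<one>\<^bsub>grp (obj \<Phi> (m + q)) (k - int (m + q) + 1)\<^esub>" by (intro N) auto
    then show "cap_term A \<Phi> l D k x m q = \<one>\<^bsub>grp (obj \<Phi> m) (k + l - int m + 1)\<^esub>"
      using D m by (intro cap_term_one) auto
  qed (use cap_term_closed[OF D x m] in auto)
  also have "\<dots> = finprod (grp (obj \<Phi> m) (k + l - int m + 1)) (cap_term A \<Phi> l D k x m) {..<N}"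
    using cap_term_closed[OF D x m] by simp
  finally show ?thesis .
qed

lemma cap_nat_zero:
  assumes D: "D \<in> carrier (grp (hoch_cochains A) l)" and x: "x \<in> carrier (grp (hoch A \<Phi>) k)" and m: "m \<ge> 1" "m \<ge> N"
    and N: "\<And>n. n \<ge> N \<Longrightarrow> x n = \<one>\<^bsub>grp (obj \<Phi> n) (k - int n + 1)\<^esub>"
  shows "cap_nat A l D \<Phi> k x m = \<one>\<^bsub>grp (obj \<Phi> m) (k + l - int m + 1)\<^esub>"
proof -
  interpret G: comm_group "grp (obj \<Phi> m) (k + l - int m + 1)" by (rule obj_group)
  have "cap_nat A l D \<Phi> k x m = finprod (grp (obj \<Phi> m) (k + l - int m + 1)) (cap_term A \<Phi> l D k x m) {..<N}"
    by (rule cap_nat_component[OF D x m(1)]) (rule N)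
  also have "\<dots> = \<one>\<^bsub>grp (obj \<Phi> m) (k + l - int m + 1)\<^esub>"
    using D m N[of "m + _"] by (intro G.finprod_one_eqI cap_term_one) auto
  finally show ?thesis .
qed

lemma cap_nat_component_closed:
  assumes D: "D \<in> carrier (grp (hoch_cochains A) l)" and x: "x \<in> carrier (grp (hoch A \<Phi>) k)" and m: "m \<ge> 1"
  shows "cap_nat A l D \<Phi> k x m \<in> carrier (grp (obj \<Phi> m) (k + l - int m + 1))"
proof -
  interpret G: comm_group "grp (obj \<Phi> m) (k + l - int m + 1)" by (rule obj_group)
  obtain N where "\<And>n. n \<ge> N \<Longrightarrow> x n = \<one>\<^bsub>grp (obj \<Phi> n) (k - int n + 1)\<^esub>" using hoch_support[OF x] by metis
  from cap_nat_component[OF D x m this] show ?thesis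
    using cap_term_closed[OF D x m] by (auto intro!: G.finprod_in)
qed

lemma cap_nat_extensional:
  assumes "x \<in> carrier (grp (hoch A \<Phi>) k)"
  shows "cap_nat A l D \<Phi> k x \<in> extensional {1..}"
  using dg_functor assms by (simp add: cap_nat_def)

lemma cap_nat_closed:
  assumes D: "D \<in> carrier (grp (hoch_cochains A) l)" and x: "x \<in> carrier (grp (hoch A \<Phi>) k)"
  shows "cap_nat A l D \<Phi> k x \<in> carrier (grp (hoch A \<Phi>) (k + l))"
proof -
  obtain N where N: "\<And>n. n \<ge> N \<Longrightarrow> x n = \<one>\<^bsub>grp (obj \<Phi> n) (k - int n + 1)\<^esub>" using hoch_support[OF x] by metis
  show ?thesis
    using cap_nat_extensional[OF x] cap_nat_component_closed[OF D x] cap_nat_zero[OF D x _ _ N]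
    by (intro hoch_carrierI[of _ _ N]) auto
qed

lemma cap_nat_Hom:
  assumes D: "D \<in> carrier (grp (hoch_cochains A) l)"
  shows "cap_nat A l D \<Phi> \<in> carrier (grp (Hom_ch (hoch A \<Phi>) (hoch A \<Phi>)) l)"
  unfolding Hom_ch_carrier
proof (intro allI conjI homI)
  fix k x y assume x: "x \<in> carrier (grp (hoch A \<Phi>) k)" and y: "y \<in> carrier (grp (hoch A \<Phi>) k)"
  let ?xy = "x \<otimes>\<^bsub>grp (hoch A \<Phi>) k\<^esub> y"
  interpret H: comm_group "grp (hoch A \<Phi>) j" for j by (rule hoch_group)
  have xy: "?xy \<in> carrier (grp (hoch A \<Phi>) k)" using x y by simp
  obtain N1 where N1: "\<And>n. n \<ge> N1 \<Longrightarrow> x n = \<one>\<^bsub>grp (obj \<Phi> n) (k - int n + 1)\<^esub>" using hoch_support[OF x] by metis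
  obtain N2 where N2: "\<And>n. n \<ge> N2 \<Longrightarrow> y n = \<one>\<^bsub>grp (obj \<Phi> n) (k - int n + 1)\<^esub>" using hoch_support[OF y] by metis
  obtain N3 where N3: "\<And>n. n \<ge> N3 \<Longrightarrow> ?xy n = \<one>\<^bsub>grp (obj \<Phi> n) (k - int n + 1)\<^esub>" using hoch_support[OF xy] by metis
  define N where "N = N1 + N2 + N3"
  show "cap_nat A l D \<Phi> k ?xy = cap_nat A l D \<Phi> k x \<otimes>\<^bsub>grp (hoch A \<Phi>) (k + l)\<^esub> cap_nat A l D \<Phi> k y"
  proof (rule hoch_eqI)
    fix m :: nat assume m: "m \<ge> 1"
    let ?T = "grp (obj \<Phi> m) (k + l - int m + 1)"
    interpret T: comm_group ?T by (rule obj_group)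
    have "cap_term A \<Phi> l D k ?xy m q = cap_term A \<Phi> l D k x m q \<otimes>\<^bsub>?T\<^esub> cap_term A \<Phi> l D k y m q" for q
    proof -
      have mq: "m + q \<ge> 1" using m by simp
      have "D q \<in> carrier (grp (Hom_ch (tpow A q) A) (l + int q))" using D by (simp add: hoch_cochains_carrier)
      note c = cap_mor_closed[OF this m]
      show ?thesis
        unfolding cap_term_def hoch_mult[OF mq]
        by (rule hom_mult[OF act_hom_right[OF c] hoch_component[OF x mq refl] hoch_component[OF y mq refl]]) simp
    qed
    then have "finprod ?T (cap_term A \<Phi> l D k ?xy m) {..<N} =
        finprod ?T (\<lambda>q. cap_term A \<Phi> l D k x m q \<otimes>\<^bsub>?T\<^esub> cap_term A \<Phi> l D k y m q) {..<N}"
      by presburger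
    also have "\<dots> = finprod ?T (cap_term A \<Phi> l D k x m) {..<N} \<otimes>\<^bsub>?T\<^esub> finprod ?T (cap_term A \<Phi> l D k y m) {..<N}"
      using cap_term_closed[OF D x m] cap_term_closed[OF D y m] by (intro T.finprod_mult)
    finally show "cap_nat A l D \<Phi> k ?xy m =
        (cap_nat A l D \<Phi> k x \<otimes>\<^bsub>grp (hoch A \<Phi>) (k + l)\<^esub> cap_nat A l D \<Phi> k y) m"
      using cap_nat_component[OF D x m, of N] cap_nat_component[OF D y m, of N] cap_nat_component[OF D xy m, of N]
        N1 N2 N3 m by (simp add: N_def hoch_mult)
  qed (use cap_nat_extensional[OF xy] hoch_extensional[OF H.m_closed[OF cap_nat_closed[OF D x] cap_nat_closed[OF D y]]] in auto)
qed (use cap_nat_closed[OF D] dg_functor in \<open>auto simp: cap_nat_def\<close>)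

end

lemma hoch_fun_mor_apply:
  assumes "x \<in> carrier (grp (hoch A \<Phi>) k)" "n \<ge> 1"
  shows "mor (hoch_fun A) \<Phi> \<Psi> s \<eta> k x n =
    kos (grp (obj \<Psi> n) (k - int n + 1 + s)) (s * (int n - 1)) (\<eta> n (k - int n + 1) (x n))"
  using assms by (simp add: hoch_fun_def)

lemma nat_ch_End_cat_carrier:
  "\<eta> \<in> carrier (grp (nat_ch (End_cat A) \<Phi> \<Psi>) s) \<longleftrightarrow>
     (\<forall>n. \<eta> n \<in> carrier (grp (Hom_ch (obj \<Phi> n) (obj \<Psi> n)) s)) \<and>
     (\<forall>p q r. \<forall>f\<in>carrier (grp (Hom_ch (tpow A p) (tpow A q)) r).
        hcomp (obj \<Phi> p) r (\<eta> q) (mor \<Phi> p q r f) =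
        kos (grp (Hom_ch (obj \<Phi> p) (obj \<Psi> q)) (s + r)) (s * r) (hcomp (obj \<Phi> p) s (mor \<Psi> p q r f) (\<eta> p)))"
  by (auto simp: nat_ch_def End_cat_def extensional_def)

lemma hoch_fun_mor_closed:
  assumes "prop_functor A \<Phi>" "prop_functor A \<Psi>" and \<eta>: "\<eta> \<in> carrier (grp (nat_ch (End_cat A) \<Phi> \<Psi>) s)"
  shows "mor (hoch_fun A) \<Phi> \<Psi> s \<eta> \<in> carrier (grp (Hom_ch (hoch A \<Phi>) (hoch A \<Psi>)) s)"
proof -
  interpret P: prop_functor A \<Phi> by fact
  interpret Q: prop_functor A \<Psi> by fact
  let ?M = "mor (hoch_fun A) \<Phi> \<Psi> s \<eta>"
  interpret PG: comm_group "grp (obj \<Phi> n) k" for n k by (rule P.obj_group)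
  interpret QG: comm_group "grp (obj \<Psi> n) k" for n k by (rule Q.obj_group)
  interpret PH: comm_group "grp (hoch A \<Phi>) k" for k by (rule P.hoch_group)
  interpret QH: comm_group "grp (hoch A \<Psi>) k" for k by (rule Q.hoch_group)
  have ext: "?M k x \<in> extensional {1..}" if "x \<in> carrier (grp (hoch A \<Phi>) k)" for k x
    using that by (simp add: hoch_fun_def)
  have \<eta>h: "\<eta> n j \<in> hom (grp (obj \<Phi> n) j) (grp (obj \<Psi> n) j')" if "j' = j + s" for n j j'
  proof -
    have "\<eta> n \<in> carrier (grp (Hom_ch (obj \<Phi> n) (obj \<Psi> n)) s)" using \<eta> by (simp add: nat_ch_End_cat_carrier)
    then show ?thesis by (rule Hom_ch_hom[OF _ that])
  qed
  have cl: "?M k x \<in> carrier (grp (hoch A \<Psi>) (k + s))" if x: "x \<in> carrier (grp (hoch A \<Phi>) k)" for k x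
  proof -
    obtain N where N: "\<And>n. n \<ge> N \<Longrightarrow> x n = \<one>\<^bsub>grp (obj \<Phi> n) (k - int n + 1)\<^esub>" using P.hoch_support[OF x] by metis
    have d: "k - int n + 1 + s = k + s - int n + 1" for n by simp
    show ?thesis
    proof (rule Q.hoch_carrierI[of _ _ N])
      fix n :: nat assume n: "n \<ge> 1"
      show "?M k x n \<in> carrier (grp (obj \<Psi> n) (k + s - int n + 1))"
        unfolding hoch_fun_mor_apply[OF x n] d using P.hoch_component[OF x n refl]
        by (intro QG.kos_closed hom_in_carrier[OF \<eta>h]) simp_all
      assume "n \<ge> N"
      show "?M k x n = \<one>\<^bsub>grp (obj \<Psi> n) (k + s - int n + 1)\<^esub>"
        unfolding hoch_fun_mor_apply[OF x n] d N[OF \<open>n \<ge> N\<close>]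
        using hom_one[OF \<eta>h[of "k + s - int n + 1" "k - int n + 1"] PG.is_group QG.is_group] by simp
    qed (rule ext[OF x])
  qed
  show ?thesis
    unfolding Hom_ch_carrier
  proof (intro allI conjI homI)
    fix k x y assume x: "x \<in> carrier (grp (hoch A \<Phi>) k)" and y: "y \<in> carrier (grp (hoch A \<Phi>) k)"
    have xy: "x \<otimes>\<^bsub>grp (hoch A \<Phi>) k\<^esub> y \<in> carrier (grp (hoch A \<Phi>) k)" using x y by simp
    show "?M k (x \<otimes>\<^bsub>grp (hoch A \<Phi>) k\<^esub> y) = ?M k x \<otimes>\<^bsub>grp (hoch A \<Psi>) (k + s)\<^esub> ?M k y"
    proof (rule P.hoch_eqI)
      fix n :: nat assume n: "n \<ge> 1"
      have d: "k - int n + 1 + s = k + s - int n + 1" by simp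
      note h = \<eta>h[of "k + s - int n + 1" "k - int n + 1" n, OF d[symmetric]]
      show "?M k (x \<otimes>\<^bsub>grp (hoch A \<Phi>) k\<^esub> y) n = (?M k x \<otimes>\<^bsub>grp (hoch A \<Psi>) (k + s)\<^esub> ?M k y) n"
        using P.hoch_component[OF x n refl] P.hoch_component[OF y n refl] n
        by (simp add: hoch_fun_mor_apply xy x y P.hoch_mult Q.hoch_mult d hom_mult[OF h] hom_in_carrier[OF h] QG.kos_mult)
    qed (use ext[OF xy] Q.hoch_extensional[OF QH.m_closed[OF cl[OF x] cl[OF y]]] in auto)
  qed (use cl in \<open>auto simp: hoch_fun_def\<close>)
qed


text \<open>
  Naturality with respect to the morphism \<open>cap_mor\<close> of degree \<open>l + q\<close> gives the sign \<open>(-1)\<^bsup>s(l+q)\<^esup>\<close>. The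
  suspensions of source and target, by \<open>m + q - 1\<close> and \<open>m - 1\<close>, account for \<open>(-1)\<^bsup>sq\<^esup>\<close>, and \<open>(-1)\<^bsup>sl\<^esup>\<close> remains.
\<close>

lemma cap_nat_natural:
  assumes \<Phi>: "prop_functor A \<Phi>" and \<Psi>: "prop_functor A \<Psi>"
    and \<eta>: "\<eta> \<in> carrier (grp (nat_ch (End_cat A) \<Phi> \<Psi>) s)" and D: "D \<in> carrier (grp (hoch_cochains A) l)"
  shows "hcomp (hoch A \<Phi>) s (cap_nat A l D \<Psi>) (mor (hoch_fun A) \<Phi> \<Psi> s \<eta>) =
    kos (grp (Hom_ch (hoch A \<Phi>) (hoch A \<Psi>)) (l + s)) (l * s)
      (hcomp (hoch A \<Phi>) l (mor (hoch_fun A) \<Phi> \<Psi> s \<eta>) (cap_nat A l D \<Phi>))" (is "?lhs = ?rhs")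
proof -
  interpret P: prop_functor A \<Phi> by fact
  interpret Q: prop_functor A \<Psi> by fact
  interpret PG: comm_group "grp (obj \<Phi> n) k" for n k by (rule P.obj_group)
  interpret QG: comm_group "grp (obj \<Psi> n) k" for n k by (rule Q.obj_group)
  let ?M = "mor (hoch_fun A) \<Phi> \<Psi> s \<eta>"
  interpret H: comm_group "grp (Hom_ch (hoch A \<Phi>) (hoch A \<Psi>)) r" for r
    by (rule Hom_ch_comm_group[OF P.hoch_graded_group Q.hoch_graded_group])
  interpret QH: comm_group "grp (hoch A \<Psi>) k" for k by (rule Q.hoch_group)
  have M: "?M \<in> carrier (grp (Hom_ch (hoch A \<Phi>) (hoch A \<Psi>)) s)" by (rule hoch_fun_mor_closed[OF \<Phi> \<Psi> \<eta>])
  have lhs: "?lhs \<in> carrier (grp (Hom_ch (hoch A \<Phi>) (hoch A \<Psi>)) (l + s))"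
    by (rule hcomp_closed[OF P.hoch_graded_group M Q.cap_nat_Hom[OF D]]) simp
  have MF: "hcomp (hoch A \<Phi>) l ?M (cap_nat A l D \<Phi>) \<in> carrier (grp (Hom_ch (hoch A \<Phi>) (hoch A \<Psi>)) (l + s))"
    by (rule hcomp_closed[OF P.hoch_graded_group P.cap_nat_Hom[OF D] M]) simp
  show ?thesis
  proof (rule Hom_ch_eqI[OF lhs H.kos_closed[OF MF]])
    fix k x assume x: "x \<in> carrier (grp (hoch A \<Phi>) k)"
    have Mx: "?M k x \<in> carrier (grp (hoch A \<Psi>) (k + s))" by (rule Hom_ch_closed[OF M x refl])
    have Fx: "cap_nat A l D \<Phi> k x \<in> carrier (grp (hoch A \<Phi>) (k + l))" by (rule P.cap_nat_closed[OF D x])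
    have MFx: "?M (k + l) (cap_nat A l D \<Phi> k x) \<in> carrier (grp (hoch A \<Psi>) (k + (l + s)))"
      by (rule Hom_ch_closed[OF M Fx]) simp
    obtain N1 where N1: "\<And>n. n \<ge> N1 \<Longrightarrow> x n = \<one>\<^bsub>grp (obj \<Phi> n) (k - int n + 1)\<^esub>" using P.hoch_support[OF x] by metis
    obtain N2 where N2: "\<And>n. n \<ge> N2 \<Longrightarrow> ?M k x n = \<one>\<^bsub>grp (obj \<Psi> n) (k + s - int n + 1)\<^esub>" using Q.hoch_support[OF Mx] by metis
    define N where "N = N1 + N2"
    have N: "x n = \<one>\<^bsub>grp (obj \<Phi> n) (k - int n + 1)\<^esub>" "?M k x n = \<one>\<^bsub>grp (obj \<Psi> n) (k + s - int n + 1)\<^esub>"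
      if "n \<ge> N" for n
      using that N1 N2 by (auto simp: N_def)
    have L: "?lhs k x = cap_nat A l D \<Psi> (k + s) (?M k x)" by (rule hcomp_apply[OF x])
    have R: "?rhs k x = kos (grp (hoch A \<Psi>) (k + (l + s))) (l * s) (?M (k + l) (cap_nat A l D \<Phi> k x))"
      using Hom_ch_kos_apply[OF P.hoch_graded_group Q.hoch_graded_group MF x] by (simp add: hcomp_apply[OF x])
    show "?lhs k x = ?rhs k x"
      unfolding L R
    proof (rule P.hoch_eqI)
      show "cap_nat A l D \<Psi> (k + s) (?M k x) \<in> extensional {1..}" by (rule Q.cap_nat_extensional[OF Mx])
      show "kos (grp (hoch A \<Psi>) (k + (l + s))) (l * s) (?M (k + l) (cap_nat A l D \<Phi> k x)) \<in> extensional {1..}"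
        by (rule Q.hoch_extensional[OF QH.kos_closed[OF MFx]])
      fix m :: nat assume m: "m \<ge> 1"
      let ?t = "k + s + l - int m + 1"
      let ?T = "grp (obj \<Psi> m) ?t"
      have \<eta>m: "\<eta> n \<in> carrier (grp (Hom_ch (obj \<Phi> n) (obj \<Psi> n)) s)" for n
        using \<eta> by (simp add: nat_ch_End_cat_carrier)
      have \<eta>h: "\<eta> m (k + l - int m + 1) \<in> hom (grp (obj \<Phi> m) (k + l - int m + 1)) ?T"
        by (rule Hom_ch_hom[OF \<eta>m]) simp
      have termq: "cap_term A \<Psi> l D (k + s) (?M k x) m q =
          kos ?T (l * s + s * (int m - 1)) (\<eta> m (k + l - int m + 1) (cap_term A \<Phi> l D k x m q))" for q
      proof -
        define j where "j = k - int (m + q) + 1"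
        define r where "r = l + int q"
        define c where "c = cap_mor A m q r (D q)"
        have Dq: "D q \<in> carrier (grp (Hom_ch (tpow A q) A) r)" using D by (simp add: hoch_cochains_carrier r_def)
        have c: "c \<in> carrier (grp (P.E (m + q) m) r)" unfolding c_def by (rule P.cap_mor_closed[OF Dq m])
        have mq: "m + q \<ge> 1" using m by simp
        have xq: "x (m + q) \<in> carrier (grp (obj \<Phi> (m + q)) j)"
          by (rule P.hoch_component[OF x mq]) (simp add: j_def)
        let ?y = "\<eta> (m + q) j (x (m + q))"
        have y: "?y \<in> carrier (grp (obj \<Psi> (m + q)) (j + s))" by (rule Hom_ch_closed[OF \<eta>m xq refl])
        have jt: "k + s - int (m + q) + 1 = j + s" "j + s + r = ?t" "k + l - int m + 1 = j + r" "j + (s + r) = ?t"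
          by (simp_all add: j_def r_def)
        have ch: "mor \<Psi> (m + q) m r c (j + s) \<in> hom (grp (obj \<Psi> (m + q)) (j + s)) ?T"
          by (rule Q.act_hom_right[OF c]) (simp add: jt)
        let ?z = "mor \<Psi> (m + q) m r c (j + s) ?y"
        have z: "?z \<in> carrier ?T" by (rule hom_in_carrier[OF ch y])
        have "cap_term A \<Psi> l D (k + s) (?M k x) m q = mor \<Psi> (m + q) m r c (j + s) (?M k x (m + q))"
          by (simp only: cap_term_def r_def c_def jt)
        also have "?M k x (m + q) = kos (grp (obj \<Psi> (m + q)) (j + s)) (s * (int (m + q) - 1)) ?y"
          using hoch_fun_mor_apply[OF x mq, of \<Psi> s \<eta>] by (simp only: j_def)
        also have "mor \<Psi> (m + q) m r c (j + s) \<dots> = kos ?T (s * (int (m + q) - 1)) ?z"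
          by (rule hom_kos[OF ch QG.is_group QG.is_group y])
        finally have 1: "cap_term A \<Psi> l D (k + s) (?M k x) m q = kos ?T (s * (int (m + q) - 1)) ?z" .
        have "\<eta> m (j + r) (mor \<Phi> (m + q) m r c j (x (m + q))) = hcomp (obj \<Phi> (m + q)) r (\<eta> m) (mor \<Phi> (m + q) m r c) j (x (m + q))"
          by (rule hcomp_apply[OF xq, symmetric])
        also have "hcomp (obj \<Phi> (m + q)) r (\<eta> m) (mor \<Phi> (m + q) m r c) =
            kos (grp (Hom_ch (obj \<Phi> (m + q)) (obj \<Psi> m)) (s + r)) (s * r)
              (hcomp (obj \<Phi> (m + q)) s (mor \<Psi> (m + q) m r c) (\<eta> (m + q)))"
          using \<eta> c unfolding nat_ch_End_cat_carrier by blast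
        also have "\<dots> j (x (m + q)) = kos ?T (s * r) (hcomp (obj \<Phi> (m + q)) s (mor \<Psi> (m + q) m r c) (\<eta> (m + q)) j (x (m + q)))"
          using Hom_ch_kos_apply[OF P.obj_graded_group Q.obj_graded_group
              hcomp_closed[OF P.obj_graded_group \<eta>m Q.mor_closed[OF c] refl] xq]
          unfolding jt .
        also have "hcomp (obj \<Phi> (m + q)) s (mor \<Psi> (m + q) m r c) (\<eta> (m + q)) j (x (m + q)) = ?z"
          by (rule hcomp_apply[OF xq])
        finally have "\<eta> m (k + l - int m + 1) (cap_term A \<Phi> l D k x m q) = kos ?T (s * r) ?z"
          unfolding jt(3) by (simp only: cap_term_def j_def r_def c_def)
        then have "kos ?T (l * s + s * (int m - 1)) (\<eta> m (k + l - int m + 1) (cap_term A \<Phi> l D k x m q)) =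
            kos ?T (l * s + s * (int m - 1) + s * r) ?z"
          using z by (simp add: QG.kos_kos)
        also have "\<dots> = kos ?T (s * (int (m + q) - 1)) ?z"
          by (rule QG.kos_cong) (simp add: r_def algebra_simps)
        finally show ?thesis using 1 by simp
      qed
      have tc: "\<eta> m (k + l - int m + 1) (cap_term A \<Phi> l D k x m q) \<in> carrier ?T" for q
        by (rule hom_in_carrier[OF \<eta>h P.cap_term_closed[OF D x m]])
      have MFm: "?M (k + l) (cap_nat A l D \<Phi> k x) m =
          kos ?T (s * (int m - 1)) (\<eta> m (k + l - int m + 1) (cap_nat A l D \<Phi> k x m))"
        unfolding hoch_fun_mor_apply[OF Fx m] by (simp add: algebra_simps)
      have Fm: "cap_nat A l D \<Phi> k x m = finprod (grp (obj \<Phi> m) (k + l - int m + 1)) (cap_term A \<Phi> l D k x m) {..<N}"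
        by (rule P.cap_nat_component[OF D x m]) (rule N(1))
      have "kos (grp (hoch A \<Psi>) (k + (l + s))) (l * s) (?M (k + l) (cap_nat A l D \<Phi> k x)) m =
          kos ?T (l * s) (?M (k + l) (cap_nat A l D \<Phi> k x) m)"
        unfolding Q.hoch_kos[OF MFx m] by (simp add: algebra_simps)
      also have "\<dots> = kos ?T (l * s + s * (int m - 1)) (\<eta> m (k + l - int m + 1) (cap_nat A l D \<Phi> k x m))"
        unfolding MFm by (rule QG.kos_kos) (rule hom_in_carrier[OF \<eta>h P.cap_nat_component_closed[OF D x m]])
      also have "\<eta> m (k + l - int m + 1) (cap_nat A l D \<Phi> k x m) =
          finprod ?T (\<lambda>q. \<eta> m (k + l - int m + 1) (cap_term A \<Phi> l D k x m q)) {..<N}"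
        unfolding Fm by (rule hom_finprod[OF \<eta>h P.obj_group Q.obj_group P.cap_term_closed[OF D x m]])
      also have "kos ?T (l * s + s * (int m - 1)) \<dots> = finprod ?T (cap_term A \<Psi> l D (k + s) (?M k x) m) {..<N}"
        unfolding termq by (rule QG.kos_finprod) (use tc in auto)
      also have "\<dots> = cap_nat A l D \<Psi> (k + s) (?M k x) m"
        by (rule Q.cap_nat_component[OF D Mx m, symmetric]) (rule N(2))
      finally show "cap_nat A l D \<Psi> (k + s) (?M k x) m =
          kos (grp (hoch A \<Psi>) (k + (l + s))) (l * s) (?M (k + l) (cap_nat A l D \<Phi> k x)) m" ..
    qed
  qed
qed

context dga
begin

lemma cap_mor_hom:
  assumes m: "m \<ge> 1"
  shows "cap_mor A m q r \<in> hom (grp (Hom_ch (tpow A q) A) r) (grp (Hom_ch (tpow A (m + q)) (tpow A m)) r)"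
proof (rule homI)
  let ?G = "grp (Hom_ch (tpow A q) A) r" and ?H = "grp (Hom_ch (tpow A (m + q)) (tpow A m)) r"
  note gg = tpow_graded_group
  interpret G: comm_group ?G by (rule Hom_ch_comm_group[OF gg graded_group_axioms])
  interpret H: comm_group ?H by (rule Hom_ch_comm_group[OF gg gg])
  fix D D' assume D: "D \<in> carrier ?G" and D': "D' \<in> carrier ?G"
  show "cap_mor A m q r D \<in> carrier ?H" by (rule cap_mor_closed[OF D m])
  have DD: "D \<otimes>\<^bsub>?G\<^esub> D' \<in> carrier ?G" using D D' by simp
  show "cap_mor A m q r (D \<otimes>\<^bsub>?G\<^esub> D') = cap_mor A m q r D \<otimes>\<^bsub>?H\<^esub> cap_mor A m q r D'"
  proof (rule tpow_Hom_ch_eqI[OF cap_mor_closed[OF DD m] H.m_closed[OF cap_mor_closed[OF D m] cap_mor_closed[OF D' m]] gg])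
    fix k xs assume xs: "xs \<in> tgens A (m + q) k"
    interpret T: comm_group "tgrp A n j" for n j by (rule tgrp_comm_group)
    obtain a as bs where xs_eq: "xs = a # as @ bs" and a: "snd a \<in> carrier (grp A (fst a))"
      and as: "as \<in> tgens A q (wt as)" and bs: "bs \<in> tgens A (m - 1) (k - fst a - wt as)"
      by (rule tgens_split[OF xs m])
    define w where "w = wt as"
    note as = as[folded w_def] and bs = bs[folded w_def]
    let ?T = "tgrp A m (k + r)"
    define \<Lambda> where "\<Lambda> = (\<lambda>y. pure A (mulh A a (w + r, y) # bs))"
    have \<Lambda>: "\<Lambda> \<in> hom (grp A (w + r)) ?T"
      unfolding \<Lambda>_def using m by (intro mulh_pure_hom[OF a bs]) auto
    have asw: "pure A as \<in> carrier (grp (tpow A q) w)" using pure_closed[OF as] by simp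
    have y: "D w (pure A as) \<in> carrier (grp A (w + r))" "D' w (pure A as) \<in> carrier (grp A (w + r))"
      using Hom_ch_closed[OF D asw refl] Hom_ch_closed[OF D' asw refl] .
    define s where "s = (k + int m + int q - 1 - fst a) * r"
    have p: "cap_mor A m q r D'' k (pure A xs) = kos ?T s (\<Lambda> (D'' w (pure A as)))" if "D'' \<in> carrier ?G" for D''
      using cap_mor_pure[OF that m, of a as bs k "k + r"] xs xs_eq tgens_length[OF as] by (simp add: app_def \<Lambda>_def s_def w_def)
    have X: "pure A xs \<in> carrier (grp (tpow A (m + q)) k)" using pure_closed[OF xs] by simp
    have "cap_mor A m q r (D \<otimes>\<^bsub>?G\<^esub> D') k (pure A xs) =
        kos ?T s (\<Lambda> (D w (pure A as)) \<otimes>\<^bsub>?T\<^esub> \<Lambda> (D' w (pure A as)))"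
      unfolding p[OF DD] Hom_ch_mult_apply[OF asw] hom_mult[OF \<Lambda> y] ..
    also have "\<dots> = (cap_mor A m q r D \<otimes>\<^bsub>?H\<^esub> cap_mor A m q r D') k (pure A xs)"
      unfolding Hom_ch_mult_apply[OF X] p[OF D] p[OF D'] grp_tpow
      by (rule T.kos_mult[OF hom_in_carrier[OF \<Lambda> y(1)] hom_in_carrier[OF \<Lambda> y(2)]])
    finally show "cap_mor A m q r (D \<otimes>\<^bsub>?G\<^esub> D') k (pure A xs) =
        (cap_mor A m q r D \<otimes>\<^bsub>?H\<^esub> cap_mor A m q r D') k (pure A xs)" .
  qed
qed

lemma Hom_A_group: "comm_group (grp (Hom_ch (tpow A q) A) r)"
  by (rule Hom_ch_comm_group[OF tpow_graded_group graded_group_axioms])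

lemma hoch_cochains_mult:
  "(D \<otimes>\<^bsub>grp (hoch_cochains A) l\<^esub> D') q = D q \<otimes>\<^bsub>grp (Hom_ch (tpow A q) A) (l + int q)\<^esub> D' q"
  by (simp add: hoch_cochains_def)

lemma hoch_cochains_mult_closed:
  assumes "D \<in> carrier (grp (hoch_cochains A) l)" "D' \<in> carrier (grp (hoch_cochains A) l)"
  shows "D \<otimes>\<^bsub>grp (hoch_cochains A) l\<^esub> D' \<in> carrier (grp (hoch_cochains A) l)"
proof -
  interpret G: comm_group "grp (Hom_ch (tpow A q) A) r" for q r by (rule Hom_A_group)
  show ?thesis using assms by (simp add: hoch_cochains_carrier hoch_cochains_mult)
qed

end

lemma (in prop_functor) cap_nat_mult:
  assumes D: "D \<in> carrier (grp (hoch_cochains A) l)" and D': "D' \<in> carrier (grp (hoch_cochains A) l)"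
  shows "cap_nat A l (D \<otimes>\<^bsub>grp (hoch_cochains A) l\<^esub> D') \<Phi> =
    cap_nat A l D \<Phi> \<otimes>\<^bsub>grp (Hom_ch (hoch A \<Phi>) (hoch A \<Phi>)) l\<^esub> cap_nat A l D' \<Phi>"
proof -
  let ?DD = "D \<otimes>\<^bsub>grp (hoch_cochains A) l\<^esub> D'"
  interpret H: comm_group "grp (Hom_ch (hoch A \<Phi>) (hoch A \<Phi>)) r" for r
    by (rule Hom_ch_comm_group[OF hoch_graded_group hoch_graded_group])
  interpret HG: comm_group "grp (hoch A \<Phi>) k" for k by (rule hoch_group)
  have DD: "?DD \<in> carrier (grp (hoch_cochains A) l)" by (rule hoch_cochains_mult_closed[OF D D'])
  show ?thesis
  proof (rule Hom_ch_eqI[OF cap_nat_Hom[OF DD] H.m_closed[OF cap_nat_Hom[OF D] cap_nat_Hom[OF D']]])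
    fix k x assume x: "x \<in> carrier (grp (hoch A \<Phi>) k)"
    obtain N where N: "\<And>n. n \<ge> N \<Longrightarrow> x n = \<one>\<^bsub>grp (obj \<Phi> n) (k - int n + 1)\<^esub>" using hoch_support[OF x] by metis
    show "cap_nat A l ?DD \<Phi> k x = (cap_nat A l D \<Phi> \<otimes>\<^bsub>grp (Hom_ch (hoch A \<Phi>) (hoch A \<Phi>)) l\<^esub> cap_nat A l D' \<Phi>) k x"
      unfolding Hom_ch_mult_apply[OF x]
    proof (rule hoch_eqI)
      fix m :: nat assume m: "m \<ge> 1"
      let ?T = "grp (obj \<Phi> m) (k + l - int m + 1)"
      interpret T: comm_group ?T by (rule obj_group)
      have "cap_term A \<Phi> l ?DD k x m q = cap_term A \<Phi> l D k x m q \<otimes>\<^bsub>?T\<^esub> cap_term A \<Phi> l D' k x m q" for q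
      proof -
        have mq: "m + q \<ge> 1" using m by simp
        have Dq: "D q \<in> carrier (grp (Hom_ch (tpow A q) A) (l + int q))" "D' q \<in> carrier (grp (Hom_ch (tpow A q) A) (l + int q))"
          using D D' by (simp_all add: hoch_cochains_carrier)
        show ?thesis
          unfolding cap_term_def hoch_cochains_mult hom_mult[OF cap_mor_hom[OF m] Dq]
          by (rule hom_mult[OF act_hom_left[OF hoch_component[OF x mq refl]] cap_mor_closed[OF Dq(1) m] cap_mor_closed[OF Dq(2) m]]) simp
      qed
      then have e: "cap_term A \<Phi> l ?DD k x m = (\<lambda>q. cap_term A \<Phi> l D k x m q \<otimes>\<^bsub>?T\<^esub> cap_term A \<Phi> l D' k x m q)" by blast
      have "cap_nat A l ?DD \<Phi> k x m = finprod ?T (cap_term A \<Phi> l ?DD k x m) {..<N}"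
        by (rule cap_nat_component[OF DD x m]) (rule N)
      also have "\<dots> = finprod ?T (cap_term A \<Phi> l D k x m) {..<N} \<otimes>\<^bsub>?T\<^esub> finprod ?T (cap_term A \<Phi> l D' k x m) {..<N}"
        unfolding e by (rule T.finprod_mult) (use cap_term_closed[OF D x m] cap_term_closed[OF D' x m] in auto)
      also have "finprod ?T (cap_term A \<Phi> l D k x m) {..<N} = cap_nat A l D \<Phi> k x m"
        by (rule cap_nat_component[OF D x m, symmetric]) (rule N)
      also have "finprod ?T (cap_term A \<Phi> l D' k x m) {..<N} = cap_nat A l D' \<Phi> k x m"
        by (rule cap_nat_component[OF D' x m, symmetric]) (rule N)
      finally show "cap_nat A l ?DD \<Phi> k x m = (cap_nat A l D \<Phi> k x \<otimes>\<^bsub>grp (hoch A \<Phi>) (k + l)\<^esub> cap_nat A l D' \<Phi> k x) m"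
        unfolding hoch_mult[OF m] .
    qed (rule cap_nat_extensional[OF x], rule hoch_extensional[OF HG.m_closed[OF cap_nat_closed[OF D x] cap_nat_closed[OF D' x]]])
  qed
qed


section \<open>Compatibility with the differentials\<close>

lemma (in dga) hoch_cochains_dif:
  "dif (hoch_cochains A) l D 0 = hcoch_int A 0 l (D 0)"
  "dif (hoch_cochains A) l D (Suc q) =
     hcoch_int A (Suc q) (l + int q + 1) (D (Suc q)) \<otimes>\<^bsub>grp (Hom_ch (tpow A (Suc q)) A) (l + int q)\<^esub>
       kos (grp (Hom_ch (tpow A (Suc q)) A) (l + int q)) (l + int q) (hcoch_ext A q (l + int q) (D q))"
  by (simp_all add: hoch_cochains_def algebra_simps)

lemma (in dga) hoch_cochains_dif_closed:
  assumes D: "D \<in> carrier (grp (hoch_cochains A) l)"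
  shows "dif (hoch_cochains A) l D \<in> carrier (grp (hoch_cochains A) (l - 1))"
  unfolding hoch_cochains_carrier
proof
  fix q
  interpret G: comm_group "grp (Hom_ch (tpow A q0) A) r0" for q0 r0 by (rule Hom_A_group)
  have Dq: "D q \<in> carrier (grp (Hom_ch (tpow A q) A) (l + int q))" for q
    using D by (simp add: hoch_cochains_carrier)
  show "dif (hoch_cochains A) l D q \<in> carrier (grp (Hom_ch (tpow A q) A) (l - 1 + int q))"
  proof (cases q)
    case 0
    then show ?thesis using hcoch_int_closed[OF Dq[of 0]] by (simp add: hoch_cochains_dif)
  next
    case (Suc p)
    have d: "l - 1 + int q = l + int p" "l + int q = l + int p + 1" using Suc by simp_all
    have 1: "hcoch_int A (Suc p) (l + int p + 1) (D (Suc p)) \<in> carrier (grp (Hom_ch (tpow A (Suc p)) A) (l + int p))"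
      using hcoch_int_closed[OF Dq[of "Suc p"]] by (simp add: algebra_simps)
    have 2: "hcoch_ext A p (l + int p) (D p) \<in> carrier (grp (Hom_ch (tpow A (Suc p)) A) (l + int p))"
      using hcoch_ext_closed[OF Dq[of p]] by simp
    show ?thesis unfolding d(1) using 1 2 by (simp add: Suc hoch_cochains_dif)
  qed
qed

context prop_functor
begin

lemma hoch_dif_component:
  assumes "n \<ge> 1"
  shows "dif (hoch A \<Phi>) k x n = dif (obj \<Phi> n) (k - int n + 1) (x n) \<otimes>\<^bsub>grp (obj \<Phi> n) (k - int n)\<^esub>
        finprod (grp (obj \<Phi> n) (k - int n))
          (\<lambda>i. kos (grp (obj \<Phi> n) (k - int n)) ((k - int n) + (int (n + 1) - int i))
             (mor \<Phi> (n + 1) n 0 (face A (n + 1) i) (k - int n) (x (n + 1))))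
          {..<n + 1}"
  using assms by (simp add: hoch_def)

lemma face_in_E: "i < n + 1 \<Longrightarrow> n \<ge> 1 \<Longrightarrow> face A (n + 1) i \<in> carrier (grp (E (n + 1) n) 0)"
  using face_closed[of i "n + 1"] by simp

lemma hoch_dif_closed:
  assumes x: "x \<in> carrier (grp (hoch A \<Phi>) k)"
  shows "dif (hoch A \<Phi>) k x \<in> carrier (grp (hoch A \<Phi>) (k - 1))"
proof -
  interpret G: comm_group "grp (obj \<Phi> n0) k0" for n0 k0 by (rule obj_group)
  obtain N where N: "\<And>n. n \<ge> N \<Longrightarrow> x n = \<one>\<^bsub>grp (obj \<Phi> n) (k - int n + 1)\<^esub>" using hoch_support[OF x] by metis
  have d: "k - 1 - int n + 1 = k - int n" for n by simp
  show ?thesis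
  proof (rule hoch_carrierI[of _ _ N], unfold d)
    show "dif (hoch A \<Phi>) k x \<in> extensional {1..}" by (simp add: hoch_def)
    fix n :: nat assume n: "n \<ge> 1"
    have f: "mor \<Phi> (n + 1) n 0 (face A (n + 1) i) (k - int n) (x (n + 1)) \<in> carrier (grp (obj \<Phi> n) (k - int n))"
      if "i < n + 1" for i
      by (rule act_closed[OF face_in_E[OF that n] hoch_component[OF x]]) simp_all
    show "dif (hoch A \<Phi>) k x n \<in> carrier (grp (obj \<Phi> n) (k - int n))"
      unfolding hoch_dif_component[OF n] using f
      by (intro G.m_closed dif_closed[OF obj_complex hoch_component[OF x n]] G.finprod_in G.kos_closed) auto
    assume "n \<ge> N"
    have "x (n + 1) = \<one>\<^bsub>grp (obj \<Phi> (n + 1)) (k - int n)\<^esub>" using N[of "n + 1"] \<open>n \<ge> N\<close> by simp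
    then have "mor \<Phi> (n + 1) n 0 (face A (n + 1) i) (k - int n) (x (n + 1)) = \<one>\<^bsub>grp (obj \<Phi> n) (k - int n)\<^esub>"
      if "i < n + 1" for i using act_one[OF face_in_E[OF that n]] by simp
    moreover have "dif (obj \<Phi> n) (k - int n + 1) (x n) = \<one>\<^bsub>grp (obj \<Phi> n) (k - int n)\<^esub>"
      unfolding N[OF \<open>n \<ge> N\<close>] by (rule hom_one[OF dif_hom[OF obj_complex] G.is_group G.is_group]) simp
    moreover from calculation have "finprod (grp (obj \<Phi> n) (k - int n))
          (\<lambda>i. kos (grp (obj \<Phi> n) (k - int n)) ((k - int n) + (int (n + 1) - int i))
             (mor \<Phi> (n + 1) n 0 (face A (n + 1) i) (k - int n) (x (n + 1)))) {..<n + 1} = \<one>\<^bsub>grp (obj \<Phi> n) (k - int n)\<^esub>"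
      by (intro G.finprod_one_eqI) simp
    ultimately show "dif (hoch A \<Phi>) k x n = \<one>\<^bsub>grp (obj \<Phi> n) (k - int n)\<^esub>"
      unfolding hoch_dif_component[OF n] by simp
  qed
qed

text \<open>The two identities in the prop, carried over by the dg-functor \<open>\<Phi>\<close>.\<close>

lemma act_hcoch_int:
  assumes D: "D \<in> carrier (grp (Hom_ch (tpow A q) A) r)" and m: "m \<ge> 1"
    and x: "x \<in> carrier (grp (obj \<Phi> (m + q)) j)"
  shows "mor \<Phi> (m + q) m (r - 1) (cap_mor A m q (r - 1) (hcoch_int A q r D)) j x =
    kos (grp (obj \<Phi> m) (j + r - 1)) (j + int m + int q - 1)
      (dif (obj \<Phi> m) (j + r) (mor \<Phi> (m + q) m r (cap_mor A m q r D) j x) \<otimes>\<^bsub>grp (obj \<Phi> m) (j + r - 1)\<^esub>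
       inv\<^bsub>grp (obj \<Phi> m) (j + r - 1)\<^esub>
         (mor \<Phi> (m + q) m r (cap_mor A m q r D) (j - 1) (dif (obj \<Phi> (m + q)) j x)))"
proof -
  let ?T = "grp (obj \<Phi> m) (j + r - 1)"
  interpret G: comm_group "grp (obj \<Phi> n0) k0" for n0 k0 by (rule obj_group)
  interpret EG: comm_group "grp (E p0 q0) r0" for p0 q0 r0 by (rule E_group)
  let ?c = "cap_mor A m q r D" and ?ci = "cap_mor A m q (r - 1) (hcoch_int A q r D)"
  let ?s = "int m + int q - 1"
  have c: "?c \<in> carrier (grp (E (m + q) m) r)" by (rule cap_mor_closed[OF D m])
  have ci: "?ci \<in> carrier (grp (E (m + q) m) (r - 1))" by (rule cap_mor_closed[OF hcoch_int_closed[OF D] m])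
  have hl: "(\<lambda>f. mor \<Phi> (m + q) m (r - 1) f j x) \<in> hom (grp (E (m + q) m) (r - 1)) ?T"
    by (rule act_hom_left[OF x]) simp
  define y where "y = dif (obj \<Phi> m) (j + r) (mor \<Phi> (m + q) m r ?c j x) \<otimes>\<^bsub>?T\<^esub>
      inv\<^bsub>?T\<^esub> (mor \<Phi> (m + q) m r ?c (j - 1) (dif (obj \<Phi> (m + q)) j x))"
  have y: "y \<in> carrier ?T"
    unfolding y_def
    by (intro G.m_closed G.inv_closed dif_closed[OF obj_complex act_closed[OF c x]]
        act_closed[OF c dif_closed[OF obj_complex x]]) simp_all
  have "kos ?T ?s (mor \<Phi> (m + q) m (r - 1) ?ci j x) =
      mor \<Phi> (m + q) m (r - 1) (kos (grp (E (m + q) m) (r - 1)) ?s ?ci) j x"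
    by (rule hom_kos[OF hl EG.is_group G.is_group ci, symmetric])
  also have "\<dots> = mor \<Phi> (m + q) m (r - 1) (dif (E (m + q) m) r ?c) j x"
    unfolding cap_mor_hcoch_int[OF D m] ..
  also have "\<dots> = kos ?T j y"
    unfolding mor_dif[OF c] Hom_ch_dif_apply[OF x] y_def ..
  finally have "kos ?T ?s (kos ?T ?s (mor \<Phi> (m + q) m (r - 1) ?ci j x)) = kos ?T (?s + j) y"
    using y by (simp add: G.kos_kos)
  moreover have "kos ?T ?s (kos ?T ?s (mor \<Phi> (m + q) m (r - 1) ?ci j x)) = mor \<Phi> (m + q) m (r - 1) ?ci j x"
    using G.kos_cong[of "?s + ?s" 0] hom_in_carrier[OF hl ci] by (simp add: G.kos_kos)
  moreover have "?s + j = j + int m + int q - 1" by simp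
  ultimately show ?thesis by (simp only: y_def)
qed

lemma act_hcoch_ext:
  assumes D: "D \<in> carrier (grp (Hom_ch (tpow A q) A) r)" and m: "m \<ge> 1"
    and x: "x \<in> carrier (grp (obj \<Phi> (m + q + 1)) j)"
  defines "T \<equiv> grp (obj \<Phi> m) (j + r)"
  shows "kos T r (mor \<Phi> (m + q + 1) m r (cap_mor A m (q + 1) r (hcoch_ext A q r D)) j x) =
    finprod T (\<lambda>i. kos T (int q + r + 1 + int i)
      (mor \<Phi> (m + 1) m 0 (face A (m + 1) i) (j + r) (mor \<Phi> (m + q + 1) (m + 1) r (cap_mor A (m + 1) q r D) j x))) {..<m + 1}
    \<otimes>\<^bsub>T\<^esub> finprod T (\<lambda>i. kos T (int i)
      (mor \<Phi> (m + q) m r (cap_mor A m q r D) j (mor \<Phi> (m + q + 1) (m + q) 0 (face A (m + q + 1) i) j x))) {..<m + q + 1}"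
proof -
  let ?N = "m + q + 1"
  let ?G = "grp (E ?N m) r"
  interpret G: comm_group "grp (obj \<Phi> n0) k0" for n0 k0 by (rule obj_group)
  interpret T: comm_group T unfolding T_def by (rule obj_group)
  interpret EG: comm_group "grp (E p0 q0) r0" for p0 q0 r0 by (rule E_group)
  let ?h = "\<lambda>f. mor \<Phi> ?N m r f j x"
  have h: "?h \<in> hom ?G T" unfolding T_def by (rule act_hom_left[OF x refl])
  let ?l = "\<lambda>i. hcomp (tpow A ?N) r (face A (m + 1) i) (cap_mor A (m + 1) q r D)"
  let ?r = "\<lambda>i. hcomp (tpow A ?N) 0 (cap_mor A m q r D) (face A ?N i)"
  have c1: "cap_mor A (m + 1) q r D \<in> carrier (grp (E ?N (m + 1)) r)" using cap_mor_closed[OF D, of "m + 1"] by simp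
  have c2: "cap_mor A m q r D \<in> carrier (grp (E (m + q) m) r)" by (rule cap_mor_closed[OF D m])
  have c3: "cap_mor A m (q + 1) r (hcoch_ext A q r D) \<in> carrier ?G"
    using cap_mor_closed[OF hcoch_ext_closed[OF D] m] by simp
  have f1: "face A (m + 1) i \<in> carrier (grp (E (m + 1) m) 0)" if "i \<in> {..<m + 1}" for i
    using face_in_E[of i m] that m by simp
  have f2: "face A ?N i \<in> carrier (grp (E ?N (m + q)) 0)" if "i \<in> {..<?N}" for i
    using face_in_E[of i "m + q"] that m by simp
  have l: "?l i \<in> carrier ?G" if "i \<in> {..<m + 1}" for i
    by (rule hcomp_closed[OF tpow_graded_group c1 f1[OF that]]) simp
  have r: "?r i \<in> carrier ?G" if "i \<in> {..<?N}" for i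
    by (rule hcomp_closed[OF tpow_graded_group f2[OF that] c2]) simp
  have hk: "?h (kos ?G a f) = kos T a (?h f)" if "f \<in> carrier ?G" for a f
    by (rule hom_kos[OF h EG.is_group T.is_group that])
  have hl: "?h (?l i) = mor \<Phi> (m + 1) m 0 (face A (m + 1) i) (j + r) (mor \<Phi> ?N (m + 1) r (cap_mor A (m + 1) q r D) j x)"
    if "i \<in> {..<m + 1}" for i
    using mor_comp[OF c1 f1[OF that]] hcomp_apply[OF x] by simp
  have hr: "?h (?r i) = mor \<Phi> (m + q) m r (cap_mor A m q r D) j (mor \<Phi> ?N (m + q) 0 (face A ?N i) j x)"
    if "i \<in> {..<?N}" for i
    using mor_comp[OF f2[OF that] c2] hcomp_apply[OF x, of 0] by simp
  let ?L = "finprod ?G (\<lambda>i. kos ?G (int q + r + 1 + int i) (?l i)) {..<m + 1}"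
  let ?R = "finprod ?G (\<lambda>i. kos ?G (int i) (?r i)) {..<?N}"
  have LR: "?L \<in> carrier ?G" "?R \<in> carrier ?G" using l r by (auto intro!: EG.finprod_in)
  have "kos T r (?h (cap_mor A m (q + 1) r (hcoch_ext A q r D))) = ?h (kos ?G r (cap_mor A m (q + 1) r (hcoch_ext A q r D)))"
    by (rule hk[OF c3, symmetric])
  also have "\<dots> = ?h (?L \<otimes>\<^bsub>?G\<^esub> ?R)" by (subst cap_mor_hcoch_ext[OF D m]) (rule refl)
  also have "\<dots> = ?h ?L \<otimes>\<^bsub>T\<^esub> ?h ?R" by (rule hom_mult[OF h LR])
  also have "?h ?L = finprod T (\<lambda>i. kos T (int q + r + 1 + int i) (?h (?l i))) {..<m + 1}"
    by (rule hom_finprod_kos[OF h EG.comm_group_axioms T.comm_group_axioms l])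
  also have "\<dots> = finprod T (\<lambda>i. kos T (int q + r + 1 + int i)
      (mor \<Phi> (m + 1) m 0 (face A (m + 1) i) (j + r) (mor \<Phi> ?N (m + 1) r (cap_mor A (m + 1) q r D) j x))) {..<m + 1}"
    using hom_in_carrier[OF h l] by (intro T.finprod_eq) (simp_all only: hl T.kos_closed flip: hl)
  also have "?h ?R = finprod T (\<lambda>i. kos T (int i) (?h (?r i))) {..<?N}"
    by (rule hom_finprod_kos[OF h EG.comm_group_axioms T.comm_group_axioms r])
  also have "\<dots> = finprod T (\<lambda>i. kos T (int i)
      (mor \<Phi> (m + q) m r (cap_mor A m q r D) j (mor \<Phi> ?N (m + q) 0 (face A ?N i) j x))) {..<?N}"
    using hom_in_carrier[OF h r] by (intro T.finprod_eq) (simp_all only: hr T.kos_closed flip: hr)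
  finally show ?thesis .
qed


text \<open>
  The arity \<open>q\<close> part \<open>D\<^sub>q\<close> of the cochain contributes to both sides through the component \<open>x\<^bsub>m+q\<^esub>\<close>, by its
  internal differential, and through \<open>x\<^bsub>m+q+1\<^esub>\<close>, by its Hochschild coboundary. The two identities above
  match these contributions for each \<open>q\<close> separately.
\<close>

lemma cap_nat_dif_component:
  assumes D: "D \<in> carrier (grp (hoch_cochains A) l)" and x: "x \<in> carrier (grp (hoch A \<Phi>) k)" and m: "m \<ge> 1"
  defines "T \<equiv> grp (obj \<Phi> m) (k + l - int m)"
  shows "cap_nat A (l - 1) (dif (hoch_cochains A) l D) \<Phi> k x m =
    kos T k (dif (hoch A \<Phi>) (k + l) (cap_nat A l D \<Phi> k x) m \<otimes>\<^bsub>T\<^esub>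
      inv\<^bsub>T\<^esub> (cap_nat A l D \<Phi> (k - 1) (dif (hoch A \<Phi>) k x) m))"
proof -
  let ?dD = "dif (hoch_cochains A) l D" and ?dx = "dif (hoch A \<Phi>) k x" and ?Fx = "cap_nat A l D \<Phi> k x"
  interpret G: comm_group "grp (obj \<Phi> n0) k0" for n0 k0 by (rule obj_group)
  interpret T: comm_group T unfolding T_def by (rule obj_group)
  interpret EG: comm_group "grp (E p0 q0) r0" for p0 q0 r0 by (rule E_group)
  interpret CG: comm_group "grp (Hom_ch (tpow A q0) A) r0" for q0 r0 by (rule Hom_A_group)
  have dD: "?dD \<in> carrier (grp (hoch_cochains A) (l - 1))" by (rule hoch_cochains_dif_closed[OF D])
  have dx: "?dx \<in> carrier (grp (hoch A \<Phi>) (k - 1))" by (rule hoch_dif_closed[OF x])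
  have Fx: "?Fx \<in> carrier (grp (hoch A \<Phi>) (k + l))" by (rule cap_nat_closed[OF D x])
  \<comment> \<open>a common bound \<open>N\<close> of the supports of \<open>x\<close> and of its boundary makes all sums over \<open>q\<close> finite\<close>
  obtain N1 where N1: "\<And>n. n \<ge> N1 \<Longrightarrow> x n = \<one>\<^bsub>grp (obj \<Phi> n) (k - int n + 1)\<^esub>" using hoch_support[OF x] by metis
  obtain N2 where N2: "\<And>n. n \<ge> N2 \<Longrightarrow> ?dx n = \<one>\<^bsub>grp (obj \<Phi> n) (k - 1 - int n + 1)\<^esub>" using hoch_support[OF dx] by metis
  define N where "N = N1 + N2"
  have N: "x n = \<one>\<^bsub>grp (obj \<Phi> n) (k - int n + 1)\<^esub>" "?dx n = \<one>\<^bsub>grp (obj \<Phi> n) (k - 1 - int n + 1)\<^esub>"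
    if "n \<ge> N" for n
    using that N1 N2 by (auto simp: N_def)
  have Dq: "D q \<in> carrier (grp (Hom_ch (tpow A q) A) (l + int q))" for q
    using D by (simp add: hoch_cochains_carrier)
  define c where "c m q = cap_mor A m q (l + int q) (D q)" for m q
  have c: "c m q \<in> carrier (grp (E (m + q) m) (l + int q))" if "m \<ge> 1" for m q
    unfolding c_def by (rule cap_mor_closed[OF Dq that])
  define j where "j q = k - int (m + q) + 1" for q
  have jdeg: "j q + (l + int q) = k + l - int m + 1" "j q - 1 + (l + int q) = k + l - int m"
    "j q + (l + int q) - 1 = k + l - int m" "j q - 1 = k - 1 - int (m + q) + 1" "k - int (m + q) = j q - 1" for q
    by (simp_all add: j_def)
  have xq: "x (m + q) \<in> carrier (grp (obj \<Phi> (m + q)) (j q))" for q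
    by (rule hoch_component[OF x]) (use m in \<open>simp_all add: j_def\<close>)
  have xq1: "x (m + q + 1) \<in> carrier (grp (obj \<Phi> (m + q + 1)) (j q - 1))" for q
    by (rule hoch_component[OF x]) (use m in \<open>simp_all add: j_def\<close>)
  have mq: "m + q \<ge> 1" for q using m by simp

  \<comment> \<open>\<open>a q\<close> and \<open>b q\<close>: internal and Hochschild part of the boundary of the cap product with \<open>D q\<close>\<close>
  define t where "t = cap_term A \<Phi> l D k x m"
  define t1 where "t1 = cap_term A \<Phi> l D k x (m + 1)"
  have tc: "t q \<in> carrier (grp (obj \<Phi> m) (k + l - int m + 1))" for q
    unfolding t_def by (rule cap_term_closed[OF D x m])
  have deg1: "k + l - int (m + 1) + 1 = k + l - int m" by simp
  have t1c: "t1 q \<in> carrier (grp (obj \<Phi> (m + 1)) (k + l - int m))" for q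
    using cap_term_closed[OF D x, of "m + 1" q] unfolding deg1 t1_def by simp
  define a where "a q = dif (obj \<Phi> m) (k + l - int m + 1) (t q)" for q
  define f where "f i = mor \<Phi> (m + 1) m 0 (face A (m + 1) i) (k + l - int m)" for i
  define b where "b q = finprod T (\<lambda>i. kos T ((k + l - int m) + (int (m + 1) - int i)) (f i (t1 q))) {..<m + 1}" for q
  have dh: "dif (obj \<Phi> m) (k + l - int m + 1) \<in> hom (grp (obj \<Phi> m) (k + l - int m + 1)) T"
    unfolding T_def by (rule dif_hom[OF obj_complex]) simp
  have fh: "f i \<in> hom (grp (obj \<Phi> (m + 1)) (k + l - int m)) T" if "i < m + 1" for i
    unfolding f_def T_def by (rule act_hom_right[OF face_in_E[OF that m]]) simp
  have ac: "a q \<in> carrier T" for q unfolding a_def by (rule hom_in_carrier[OF dh tc])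
  have fc: "f i (t1 q) \<in> carrier T" if "i < m + 1" for i q by (rule hom_in_carrier[OF fh[OF that] t1c])
  have bc: "b q \<in> carrier T" for q unfolding b_def using fc by (intro T.finprod_in T.kos_closed) auto
  have Fm: "?Fx m = finprod (grp (obj \<Phi> m) (k + l - int m + 1)) t {..<N}"
    unfolding t_def by (rule cap_nat_component[OF D x m]) (rule N(1))
  have Fm1: "?Fx (m + 1) = finprod (grp (obj \<Phi> (m + 1)) (k + l - int m)) t1 {..<N}"
    using cap_nat_component[OF D x, of "m + 1" N] N(1) unfolding deg1 t1_def by simp
  have "dif (hoch A \<Phi>) (k + l) ?Fx m = finprod T a {..<N} \<otimes>\<^bsub>T\<^esub> finprod T b {..<N}"
  proof -
    have 1: "dif (obj \<Phi> m) (k + l - int m + 1) (?Fx m) = finprod T a {..<N}"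
      unfolding Fm a_def by (rule hom_finprod[OF dh obj_group T.comm_group_axioms tc])
    have "finprod T (\<lambda>i. kos T ((k + l - int m) + (int (m + 1) - int i)) (f i (?Fx (m + 1)))) {..<m + 1} =
      finprod T (\<lambda>i. finprod T (\<lambda>q. kos T ((k + l - int m) + (int (m + 1) - int i)) (f i (t1 q))) {..<N}) {..<m + 1}"
    proof (rule T.finprod_eq)
      fix i assume "i \<in> {..<m + 1}"
      then have i: "i < m + 1" by simp
      show "finprod T (\<lambda>q. kos T ((k + l - int m) + (int (m + 1) - int i)) (f i (t1 q))) {..<N} \<in> carrier T"
        using fc[OF i] by (intro T.finprod_in T.kos_closed)
      have "f i (?Fx (m + 1)) = finprod T (\<lambda>q. f i (t1 q)) {..<N}"
        unfolding Fm1 by (rule hom_finprod[OF fh[OF i] obj_group T.comm_group_axioms t1c])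
      then show "kos T ((k + l - int m) + (int (m + 1) - int i)) (f i (?Fx (m + 1))) =
          finprod T (\<lambda>q. kos T ((k + l - int m) + (int (m + 1) - int i)) (f i (t1 q))) {..<N}"
        using fc[OF i] by (simp only:) (rule T.kos_finprod, auto)
    qed
    also have "\<dots> = finprod T b {..<N}"
      unfolding b_def using fc by (intro T.finprod_swap T.kos_closed) auto
    finally show ?thesis
      unfolding hoch_dif_component[OF m] 1 T_def[symmetric] f_def[symmetric] by simp
  qed
  note A = this

  \<comment> \<open>\<open>a' q\<close> and \<open>b' q\<close>: cap product of \<open>D q\<close> with the internal and the Hochschild part of the boundary\<close>
  define a' where "a' q = mor \<Phi> (m + q) m (l + int q) (c m q) (j q - 1) (dif (obj \<Phi> (m + q)) (j q) (x (m + q)))" for q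
  define g where "g q i = mor \<Phi> (m + q) m (l + int q) (c m q) (j q - 1)
      (mor \<Phi> (m + q + 1) (m + q) 0 (face A (m + q + 1) i) (j q - 1) (x (m + q + 1)))" for q i
  define b' where "b' q = finprod T (\<lambda>i. kos T ((j q - 1) + (int (m + q + 1) - int i)) (g q i)) {..<m + q + 1}" for q
  have ch: "mor \<Phi> (m + q) m (l + int q) (c m q) (j q - 1) \<in> hom (grp (obj \<Phi> (m + q)) (j q - 1)) T" for q
    unfolding T_def by (rule act_hom_right[OF c[OF m]]) (simp add: jdeg)
  have dxq: "dif (obj \<Phi> (m + q)) (j q) (x (m + q)) \<in> carrier (grp (obj \<Phi> (m + q)) (j q - 1))" for q
    by (rule dif_closed[OF obj_complex xq refl])
  have fxq: "mor \<Phi> (m + q + 1) (m + q) 0 (face A (m + q + 1) i) (j q - 1) (x (m + q + 1)) \<in> carrier (grp (obj \<Phi> (m + q)) (j q - 1))"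
    if "i < m + q + 1" for q i
    by (rule act_closed[OF face_in_E[OF that mq] xq1]) simp
  have a'c: "a' q \<in> carrier T" for q unfolding a'_def by (rule hom_in_carrier[OF ch dxq])
  have gc: "g q i \<in> carrier T" if "i < m + q + 1" for q i unfolding g_def by (rule hom_in_carrier[OF ch fxq[OF that]])
  have b'c: "b' q \<in> carrier T" for q unfolding b'_def using gc by (intro T.finprod_in T.kos_closed) auto
  have B: "cap_nat A l D \<Phi> (k - 1) ?dx m = finprod T (\<lambda>q. a' q \<otimes>\<^bsub>T\<^esub> b' q) {..<N}"
  proof -
    have "cap_term A \<Phi> l D (k - 1) ?dx m q = a' q \<otimes>\<^bsub>T\<^esub> b' q" for q
    proof -
      let ?S = "grp (obj \<Phi> (m + q)) (j q - 1)"
      let ?s = "\<lambda>i. (j q - 1) + (int (m + q + 1) - int i)"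
      let ?z = "\<lambda>i. mor \<Phi> (m + q + 1) (m + q) 0 (face A (m + q + 1) i) (j q - 1) (x (m + q + 1))"
      let ?y = "finprod ?S (\<lambda>i. kos ?S (?s i) (?z i)) {..<m + q + 1}"
      have zc: "?z i \<in> carrier ?S" if "i \<in> {..<m + q + 1}" for i
        using fxq[of i q] that by simp
      have "?dx (m + q) = dif (obj \<Phi> (m + q)) (j q) (x (m + q)) \<otimes>\<^bsub>?S\<^esub> ?y"
        using hoch_dif_component[OF mq, of k x q] unfolding jdeg(5) diff_add_cancel .
      then have "cap_term A \<Phi> l D (k - 1) ?dx m q = mor \<Phi> (m + q) m (l + int q) (c m q) (j q - 1)
          (dif (obj \<Phi> (m + q)) (j q) (x (m + q)) \<otimes>\<^bsub>?S\<^esub> ?y)"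
        by (simp only: cap_term_def c_def jdeg(4))
      also have "\<dots> = a' q \<otimes>\<^bsub>T\<^esub> mor \<Phi> (m + q) m (l + int q) (c m q) (j q - 1) ?y"
        unfolding a'_def by (rule hom_mult[OF ch dxq]) (rule G.finprod_in[OF G.kos_closed[OF zc]])
      also have "mor \<Phi> (m + q) m (l + int q) (c m q) (j q - 1) ?y = b' q"
        unfolding b'_def g_def by (rule hom_finprod_kos[OF ch obj_group T.comm_group_axioms zc])
      finally show ?thesis .
    qed
    then have e: "cap_term A \<Phi> l D (k - 1) ?dx m = (\<lambda>q. a' q \<otimes>\<^bsub>T\<^esub> b' q)" by blast
    have "cap_nat A l D \<Phi> (k - 1) ?dx m =
        finprod (grp (obj \<Phi> m) (k - 1 + l - int m + 1)) (cap_term A \<Phi> l D (k - 1) ?dx m) {..<N}"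
      by (rule cap_nat_component[OF D dx m]) (rule N(2))
    also have "k - 1 + l - int m + 1 = k + l - int m" by simp
    finally show ?thesis unfolding e T_def .
  qed

  \<comment> \<open>\<open>I q\<close> and \<open>J q\<close>: cap product with the internal differential and with the coboundary of \<open>D q\<close>\<close>
  define I where "I q = mor \<Phi> (m + q) m (l + int q - 1)
      (cap_mor A m q (l + int q - 1) (hcoch_int A q (l + int q) (D q))) (j q) (x (m + q))" for q
  define J where "J q = kos T (l + int q) (mor \<Phi> (m + q + 1) m (l + int q)
      (cap_mor A m (q + 1) (l + int q) (hcoch_ext A q (l + int q) (D q))) (j q - 1) (x (m + q + 1)))" for q
  have Ie: "I q = kos T k (a q \<otimes>\<^bsub>T\<^esub> inv\<^bsub>T\<^esub> (a' q))" for q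
  proof -
    have "j q + int m + int q - 1 = k" by (simp add: j_def)
    then have "I q = kos T k (dif (obj \<Phi> m) (k + l - int m + 1) (mor \<Phi> (m + q) m (l + int q) (c m q) (j q) (x (m + q)))
        \<otimes>\<^bsub>T\<^esub> inv\<^bsub>T\<^esub> (a' q))"
      using act_hcoch_int[OF Dq m xq, of q] unfolding jdeg I_def T_def a'_def c_def by simp
    then show ?thesis by (simp only: a_def t_def cap_term_def c_def j_def)
  qed
  have Je: "J q = kos T k (b q \<otimes>\<^bsub>T\<^esub> inv\<^bsub>T\<^esub> (b' q))" for q
  proof -
    have t1e: "mor \<Phi> (m + q + 1) (m + 1) (l + int q) (cap_mor A (m + 1) q (l + int q) (D q)) (j q - 1) (x (m + q + 1)) = t1 q"
      by (simp add: t1_def cap_term_def j_def algebra_simps)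
    have "J q = finprod T (\<lambda>i. kos T (int q + (l + int q) + 1 + int i) (f i (t1 q))) {..<m + 1}
        \<otimes>\<^bsub>T\<^esub> finprod T (\<lambda>i. kos T (int i) (g q i)) {..<m + q + 1}"
      using act_hcoch_ext[OF Dq m xq1, of q] unfolding jdeg(2) t1e J_def T_def f_def g_def c_def .
    also have "finprod T (\<lambda>i. kos T (int q + (l + int q) + 1 + int i) (f i (t1 q))) {..<m + 1} = kos T k (b q)"
      unfolding b_def using fc by (intro T.kos_finprod_kos[symmetric]) auto
    also have "finprod T (\<lambda>i. kos T (int i) (g q i)) {..<m + q + 1} = kos T (k + 1) (b' q)"
      unfolding b'_def using gc by (intro T.kos_finprod_kos[symmetric]) (auto simp: j_def)
    also have "kos T k (b q) \<otimes>\<^bsub>T\<^esub> kos T (k + 1) (b' q) = kos T k (b q \<otimes>\<^bsub>T\<^esub> inv\<^bsub>T\<^esub> (b' q))"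
      using bc b'c by (simp add: T.kos_mult T.inv_eq_kos T.kos_kos)
    finally show ?thesis .
  qed
  have Ic: "I q \<in> carrier T" and Jc: "J q \<in> carrier T" for q
    unfolding Ie Je using ac a'c bc b'c by simp_all
  \<comment> \<open>the coboundary raises the arity, so that \<open>J p\<close> belongs to the component of arity \<open>Suc p\<close>\<close>
  define J' where "J' q = (case q of 0 \<Rightarrow> \<one>\<^bsub>T\<^esub> | Suc p \<Rightarrow> J p)" for q
  have J'c: "J' q \<in> carrier T" for q using Jc by (cases q) (simp_all add: J'_def)
  have termq: "cap_term A \<Phi> (l - 1) ?dD k x m q = I q \<otimes>\<^bsub>T\<^esub> J' q" for q
  proof (cases q)
    case 0
    then show ?thesis using Ic[of 0] by (simp add: cap_term_def hoch_cochains_dif I_def J'_def j_def)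
  next
    case (Suc p)
    have d: "l - 1 + int (Suc p) = l + int p" "l + int (Suc p) - 1 = l + int p" "l + int (Suc p) = l + int p + 1" by simp_all
    let ?i = "hcoch_int A (Suc p) (l + int p + 1) (D (Suc p))" and ?e = "hcoch_ext A p (l + int p) (D p)"
    let ?C = "grp (Hom_ch (tpow A (Suc p)) A) (l + int p)" and ?H = "grp (E (m + Suc p) m) (l + int p)"
    have ic: "?i \<in> carrier ?C" using hcoch_int_closed[OF Dq[of "Suc p"]] unfolding d add_diff_cancel_right' .
    have ec: "?e \<in> carrier ?C" using hcoch_ext_closed[OF Dq[of p]] by simp
    have h: "(\<lambda>D. mor \<Phi> (m + Suc p) m (l + int p) (cap_mor A m (Suc p) (l + int p) D) (j (Suc p)) (x (m + Suc p))) \<in> hom ?C T"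
      unfolding T_def by (rule hom_comp[OF cap_mor_hom[OF m] act_hom_left[OF xq]]) (simp add: j_def)
    have "cap_term A \<Phi> (l - 1) ?dD k x m (Suc p) =
        mor \<Phi> (m + Suc p) m (l + int p) (cap_mor A m (Suc p) (l + int p) (?i \<otimes>\<^bsub>?C\<^esub> kos ?C (l + int p) ?e)) (j (Suc p)) (x (m + Suc p))"
      unfolding cap_term_def hoch_cochains_dif d(1) j_def ..
    also have "\<dots> = mor \<Phi> (m + Suc p) m (l + int p) (cap_mor A m (Suc p) (l + int p) ?i) (j (Suc p)) (x (m + Suc p)) \<otimes>\<^bsub>T\<^esub>
        mor \<Phi> (m + Suc p) m (l + int p) (cap_mor A m (Suc p) (l + int p) (kos ?C (l + int p) ?e)) (j (Suc p)) (x (m + Suc p))"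
      by (rule hom_mult[OF h ic CG.kos_closed[OF ec]])
    also have "mor \<Phi> (m + Suc p) m (l + int p) (cap_mor A m (Suc p) (l + int p) (kos ?C (l + int p) ?e)) (j (Suc p)) (x (m + Suc p)) =
        kos T (l + int p) (mor \<Phi> (m + Suc p) m (l + int p) (cap_mor A m (Suc p) (l + int p) ?e) (j (Suc p)) (x (m + Suc p)))"
      by (rule hom_kos[OF h CG.is_group T.is_group ec])
    also have "\<dots> = J' (Suc p)"
    proof -
      have "j (Suc p) = j p - 1" by (simp add: j_def)
      then show ?thesis by (simp add: J'_def J_def)
    qed
    also have "mor \<Phi> (m + Suc p) m (l + int p) (cap_mor A m (Suc p) (l + int p) ?i) (j (Suc p)) (x (m + Suc p)) = I (Suc p)"
      unfolding I_def d(2) d(3) add_diff_cancel_right' ..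
    finally show ?thesis using Suc by simp
  qed
  \<comment> \<open>the bound \<open>Suc N\<close> leaves room for this shift; the surplus internal term \<open>I N\<close> is trivial\<close>
  have "cap_nat A (l - 1) ?dD \<Phi> k x m = finprod (grp (obj \<Phi> m) (k + (l - 1) - int m + 1)) (cap_term A \<Phi> (l - 1) ?dD k x m) {..<Suc N}"
    by (rule cap_nat_component[OF dD x m]) (use N(1) in simp)
  also have "k + (l - 1) - int m + 1 = k + l - int m" by simp
  also have "finprod (grp (obj \<Phi> m) (k + l - int m)) (cap_term A \<Phi> (l - 1) ?dD k x m) {..<Suc N} =
      finprod T (\<lambda>q. I q \<otimes>\<^bsub>T\<^esub> J' q) {..<Suc N}"
    unfolding termq T_def ..
  also have "\<dots> = finprod T I {..<Suc N} \<otimes>\<^bsub>T\<^esub> finprod T J' {..<Suc N}"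
    using Ic J'c by (intro T.finprod_mult)
  also have "finprod T I {..<Suc N} = finprod T I {..<N}"
  proof -
    have xN: "x (m + N) = \<one>\<^bsub>grp (obj \<Phi> (m + N)) (j N)\<^esub>" using N(1)[of "m + N"] by (simp add: j_def)
    have "I N = \<one>\<^bsub>T\<^esub>"
      unfolding I_def xN T_def
      by (rule act_one[OF cap_mor_closed[OF hcoch_int_closed[OF Dq] m]]) (simp add: j_def)
    then show ?thesis using Ic by (simp add: lessThan_Suc Pi_iff)
  qed
  also have "finprod T J' {..<Suc N} = finprod T J {..<N}"
    using T.finprod_lessThan_Suc_shift[of N J'] J'c Jc by (simp add: J'_def T.finprod_in)
  also have "finprod T I {..<N} \<otimes>\<^bsub>T\<^esub> finprod T J {..<N} =
      kos T k ((finprod T a {..<N} \<otimes>\<^bsub>T\<^esub> finprod T b {..<N}) \<otimes>\<^bsub>T\<^esub> inv\<^bsub>T\<^esub> (finprod T (\<lambda>q. a' q \<otimes>\<^bsub>T\<^esub> b' q) {..<N}))"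
    unfolding Ie Je using ac bc a'c b'c by (intro T.finprod_quotient[symmetric])
  finally show ?thesis unfolding A B .
qed

lemma cap_nat_dif:
  assumes D: "D \<in> carrier (grp (hoch_cochains A) l)"
  shows "cap_nat A (l - 1) (dif (hoch_cochains A) l D) \<Phi> = dif (Hom_ch (hoch A \<Phi>) (hoch A \<Phi>)) l (cap_nat A l D \<Phi>)"
proof
  fix k
  let ?dD = "dif (hoch_cochains A) l D"
  interpret HG: comm_group "grp (hoch A \<Phi>) k0" for k0 by (rule hoch_group)
  have dD: "?dD \<in> carrier (grp (hoch_cochains A) (l - 1))" by (rule hoch_cochains_dif_closed[OF D])
  show "cap_nat A (l - 1) ?dD \<Phi> k = dif (Hom_ch (hoch A \<Phi>) (hoch A \<Phi>)) l (cap_nat A l D \<Phi>) k"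
  proof (rule extensionalityI[of _ "carrier (grp (hoch A \<Phi>) k)"])
    show "cap_nat A (l - 1) ?dD \<Phi> k \<in> extensional (carrier (grp (hoch A \<Phi>) k))"
      using cap_nat_Hom[OF dD] by (simp add: Hom_ch_carrier)
    show "dif (Hom_ch (hoch A \<Phi>) (hoch A \<Phi>)) l (cap_nat A l D \<Phi>) k \<in> extensional (carrier (grp (hoch A \<Phi>) k))"
      by (simp add: Hom_ch_def)
    fix x assume x: "x \<in> carrier (grp (hoch A \<Phi>) k)"
    let ?H = "grp (hoch A \<Phi>) (k + l - 1)"
    let ?u = "dif (hoch A \<Phi>) (k + l) (cap_nat A l D \<Phi> k x)" and ?v = "cap_nat A l D \<Phi> (k - 1) (dif (hoch A \<Phi>) k x)"
    have u: "?u \<in> carrier ?H" by (rule hoch_dif_closed[OF cap_nat_closed[OF D x]])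
    have v: "?v \<in> carrier ?H"
      using cap_nat_closed[OF D hoch_dif_closed[OF x]] by (simp add: algebra_simps)
    have R: "dif (Hom_ch (hoch A \<Phi>) (hoch A \<Phi>)) l (cap_nat A l D \<Phi>) k x = kos ?H k (?u \<otimes>\<^bsub>?H\<^esub> inv\<^bsub>?H\<^esub> ?v)"
      by (rule Hom_ch_dif_apply[OF x])
    show "cap_nat A (l - 1) ?dD \<Phi> k x = dif (Hom_ch (hoch A \<Phi>) (hoch A \<Phi>)) l (cap_nat A l D \<Phi>) k x"
      unfolding R
    proof (rule hoch_eqI)
      show "cap_nat A (l - 1) ?dD \<Phi> k x \<in> extensional {1..}" by (rule cap_nat_extensional[OF x])
      show "kos ?H k (?u \<otimes>\<^bsub>?H\<^esub> inv\<^bsub>?H\<^esub> ?v) \<in> extensional {1..}"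
        by (rule hoch_extensional[of _ "k + l - 1"]) (use u v in simp)
      fix m :: nat assume m: "m \<ge> 1"
      have d: "k + l - 1 - int m + 1 = k + l - int m" by simp
      have uv: "?u \<otimes>\<^bsub>?H\<^esub> kos ?H 1 ?v \<in> carrier ?H" using u v by simp
      interpret T: comm_group "grp (obj \<Phi> m) (k + l - int m)" by (rule obj_group)
      show "cap_nat A (l - 1) ?dD \<Phi> k x m = kos ?H k (?u \<otimes>\<^bsub>?H\<^esub> inv\<^bsub>?H\<^esub> ?v) m"
        unfolding cap_nat_dif_component[OF D x m] HG.inv_eq_kos hoch_kos[OF uv m] hoch_mult[OF m] hoch_kos[OF v m] d
          T.inv_eq_kos ..
    qed
  qed
qed

end

lemma (in dga) cap_nat_chain_map:
  "cap_nat A \<in> chain_maps (hoch_cochains A)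
     (Nat_End A :: ((nat, int \<Rightarrow> 'a tens \<Rightarrow> 'a tens, 'u) dgfun \<Rightarrow> int \<Rightarrow> (nat \<Rightarrow> 'u) \<Rightarrow> (nat \<Rightarrow> 'u)) ch)"
proof -
  let ?ob = "{\<Phi> :: (nat, int \<Rightarrow> 'a tens \<Rightarrow> 'a tens, 'u) dgfun. dg_functor (End_cat A) \<Phi>}"
  have F: "prop_functor A \<Phi>" if "\<Phi> \<in> ?ob" for \<Phi> :: "(nat, int \<Rightarrow> 'a tens \<Rightarrow> 'a tens, 'u) dgfun"
    using that dga_axioms by (simp add: prop_functor_def prop_functor_axioms_def)
  have obj: "obj (hoch_fun A) = hoch A" by (simp add: hoch_fun_def)
  have ext: "(cap_nat A l D :: (nat, int \<Rightarrow> 'a tens \<Rightarrow> 'a tens, 'u) dgfun \<Rightarrow> _) \<in> extensional ?ob" for l D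
    by (simp add: cap_nat_def)
  show ?thesis
    unfolding chain_maps_def
  proof (intro CollectI allI conjI homI ballI)
    fix l D assume D: "D \<in> carrier (grp (hoch_cochains A) l)"
    show "cap_nat A l D \<in> carrier (grp (Nat_End A :: ((nat, int \<Rightarrow> 'a tens \<Rightarrow> 'a tens, 'u) dgfun \<Rightarrow> _) ch) l)"
      using ext prop_functor.cap_nat_Hom[OF F D] cap_nat_natural[OF F F _ D]
      by (auto simp: Nat_End_def fun_cat_def nat_ch_def[of "\<lparr>ob = ?ob, homc = _, cmp = _, ident = _\<rparr>"] obj)
    show "cap_nat A (l - 1) (dif (hoch_cochains A) l D) = dif (Nat_End A :: ((nat, int \<Rightarrow> 'a tens \<Rightarrow> 'a tens, 'u) dgfun \<Rightarrow> _) ch) l (cap_nat A l D)"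
      by (rule extensionalityI[OF ext])
        (use prop_functor.cap_nat_dif[OF F D] in \<open>simp_all add: Nat_End_def fun_cat_def nat_ch_def[of "\<lparr>ob = ?ob, homc = _, cmp = _, ident = _\<rparr>"] obj\<close>)
    fix D' assume D': "D' \<in> carrier (grp (hoch_cochains A) l)"
    show "cap_nat A l (D \<otimes>\<^bsub>grp (hoch_cochains A) l\<^esub> D') =
        cap_nat A l D \<otimes>\<^bsub>grp (Nat_End A :: ((nat, int \<Rightarrow> 'a tens \<Rightarrow> 'a tens, 'u) dgfun \<Rightarrow> _) ch) l\<^esub> cap_nat A l D'"
      by (rule extensionalityI[OF ext])
        (use prop_functor.cap_nat_mult[OF F D D'] in \<open>simp_all add: Nat_End_def fun_cat_def nat_ch_def[of "\<lparr>ob = ?ob, homc = _, cmp = _, ident = _\<rparr>"] obj\<close>)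
  qed
qed


section \<open>The tautological algebra and its transports\<close>

lemma grp_ch_image:
  "carrier (grp (ch_image e V) k) = e ` carrier (grp V k)"
  "\<one>\<^bsub>grp (ch_image e V) k\<^esub> = e \<one>\<^bsub>grp V k\<^esub>"
  "inj e \<Longrightarrow> e x \<otimes>\<^bsub>grp (ch_image e V) k\<^esub> e y = e (x \<otimes>\<^bsub>grp V k\<^esub> y)"
  "inj e \<Longrightarrow> dif (ch_image e V) k (e x) = e (dif V k x)"
  by (simp_all add: ch_image_def the_inv_f_f)

lemma ch_image_hom: "inj e \<Longrightarrow> e \<in> hom (grp V k) (grp (ch_image e V) k)"
  by (simp add: hom_def grp_ch_image)

lemma ch_image_comm_group:
  assumes "inj e" "comm_group (grp V k)"
  shows "comm_group (grp (ch_image e V) k)"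
proof -
  interpret comm_group "grp V k" by fact
  show ?thesis
  proof (rule comm_groupI)
    fix x assume "x \<in> carrier (grp (ch_image e V) k)"
    then obtain v where v: "v \<in> carrier (grp V k)" "x = e v" by (auto simp: grp_ch_image)
    then show "\<exists>y\<in>carrier (grp (ch_image e V) k). y \<otimes>\<^bsub>grp (ch_image e V) k\<^esub> x = \<one>\<^bsub>grp (ch_image e V) k\<^esub>"
      using assms(1) by (intro bexI[of _ "e (inv\<^bsub>grp V k\<^esub> v)"]) (auto simp: grp_ch_image)
  qed (use assms(1) in \<open>auto simp: grp_ch_image m_ac\<close>)
qed

lemma ch_image_complex:
  assumes e: "inj e" and V: "chain_complex V"
  shows "chain_complex (ch_image e V)"
  unfolding chain_complex_def
proof (intro allI conjI ballI)
  fix k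
  have g: "comm_group (grp V j)" for j using V by (simp add: chain_complex_def)
  show "comm_group (grp (ch_image e V) k)" by (rule ch_image_comm_group[OF e g])
  show "dif (ch_image e V) k \<in> hom (grp (ch_image e V) k) (grp (ch_image e V) (k - 1))"
    using e dif_hom[OF V refl, of k] by (auto simp: hom_def grp_ch_image)
  fix x assume "x \<in> carrier (grp (ch_image e V) k)"
  then show "dif (ch_image e V) (k - 1) (dif (ch_image e V) k x) = \<one>\<^bsub>grp (ch_image e V) (k - 2)\<^esub>"
    using e V by (auto simp: grp_ch_image chain_complex_def)
qed

definition conj_image :: "('b \<Rightarrow> 'u) \<Rightarrow> 'b ch \<Rightarrow> (int \<Rightarrow> 'b \<Rightarrow> 'b) \<Rightarrow> int \<Rightarrow> 'u \<Rightarrow> 'u" where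
  "conj_image e V f = (\<lambda>k. \<lambda>v\<in>carrier (grp (ch_image e V) k). e (f k (the_inv e v)))"

lemma conj_image_apply: "inj e \<Longrightarrow> x \<in> carrier (grp V k) \<Longrightarrow> conj_image e V f k (e x) = e (f k x)"
  by (simp add: conj_image_def grp_ch_image the_inv_f_f)

lemma conj_image_closed:
  assumes "inj e" "f \<in> carrier (grp (Hom_ch V W) r)" "graded_group V"
  shows "conj_image e V f \<in> carrier (grp (Hom_ch (ch_image e V) (ch_image e W)) r)"
proof -
  interpret V: graded_group V by fact
  interpret Vg: comm_group "grp V k0" for k0 by (rule V.groups)
  have h: "f k \<in> hom (grp V k) (grp W (k + r))" for k using Hom_ch_hom[OF assms(2) refl] .
  show ?thesis
    unfolding Hom_ch_carrier
  proof (intro allI conjI homI)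
    fix k x y assume "x \<in> carrier (grp (ch_image e V) k)" "y \<in> carrier (grp (ch_image e V) k)"
    then show "conj_image e V f k (x \<otimes>\<^bsub>grp (ch_image e V) k\<^esub> y) =
        conj_image e V f k x \<otimes>\<^bsub>grp (ch_image e W) (k + r)\<^esub> conj_image e V f k y"
      using assms(1) by (auto simp: grp_ch_image conj_image_apply hom_mult[OF h])
  next
    fix k x assume "x \<in> carrier (grp (ch_image e V) k)"
    then show "conj_image e V f k x \<in> carrier (grp (ch_image e W) (k + r))"
      using assms(1) hom_in_carrier[OF h] by (auto simp: grp_ch_image conj_image_apply)
  qed (simp add: conj_image_def)
qed

lemma dgfun_image_functor:
  assumes e: "inj e" and F: "dg_functor C \<Phi>"
  shows "dg_functor C (dgfun_image e \<Phi>)"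
proof -
  have cx: "chain_complex (obj \<Phi> x)" if "x \<in> ob C" for x using F that by (simp add: dg_functor_def)
  have gg: "graded_group (obj \<Phi> x)" if "x \<in> ob C" for x by (rule chain_complex_graded_group[OF cx[OF that]])
  have gi: "graded_group (ch_image e (obj \<Phi> x))" if "x \<in> ob C" for x
    by (rule chain_complex_graded_group[OF ch_image_complex[OF e cx[OF that]]])
  have mor: "mor (dgfun_image e \<Phi>) x y r f = conj_image e (obj \<Phi> x) (mor \<Phi> x y r f)" for x y r f
    by (simp add: dgfun_image_def conj_image_def)
  have obj: "obj (dgfun_image e \<Phi>) x = ch_image e (obj \<Phi> x)" for x by (simp add: dgfun_image_def)
  have chm: "mor \<Phi> x y \<in> chain_maps (homc C x y) (Hom_ch (obj \<Phi> x) (obj \<Phi> y))" if "x \<in> ob C" "y \<in> ob C" for x y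
    using F that by (simp add: dg_functor_def)
  have mh: "mor \<Phi> x y r \<in> hom (grp (homc C x y) r) (grp (Hom_ch (obj \<Phi> x) (obj \<Phi> y)) r)"
    if "x \<in> ob C" "y \<in> ob C" for x y r using chm[OF that] by (simp add: chain_maps_def)
  have mc: "mor \<Phi> x y r f \<in> carrier (grp (Hom_ch (obj \<Phi> x) (obj \<Phi> y)) r)"
    if "x \<in> ob C" "y \<in> ob C" "f \<in> carrier (grp (homc C x y) r)" for x y r f
    using hom_in_carrier[OF mh[OF that(1,2)] that(3)] .
  show ?thesis
    unfolding dg_functor_def obj mor
  proof (intro conjI ballI allI)
    fix x assume x: "x \<in> ob C"
    show "chain_complex (ch_image e (obj \<Phi> x))" by (rule ch_image_complex[OF e cx[OF x]])
    have "mor \<Phi> x x 0 (ident C x) = hid (obj \<Phi> x)" using F x by (simp add: dg_functor_def)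
    then show "conj_image e (obj \<Phi> x) (mor \<Phi> x x 0 (ident C x)) = hid (ch_image e (obj \<Phi> x))"
      using e by (auto simp: conj_image_def hid_def grp_ch_image the_inv_f_f intro!: ext)
    fix y assume y: "y \<in> ob C"
    let ?V = "obj \<Phi> x" and ?W = "obj \<Phi> y"
    let ?H = "\<lambda>r. grp (Hom_ch (ch_image e ?V) (ch_image e ?W)) r"
    interpret H: comm_group "?H r0" for r0 by (rule Hom_ch_comm_group[OF gi[OF x] gi[OF y]])
    have cc: "conj_image e ?V (mor \<Phi> x y r f) \<in> carrier (?H r)" if "f \<in> carrier (grp (homc C x y) r)" for r f
      by (rule conj_image_closed[OF e mc[OF x y that] gg[OF x]])
    show "(\<lambda>r f. conj_image e ?V (mor \<Phi> x y r f)) \<in> chain_maps (homc C x y) (Hom_ch (ch_image e ?V) (ch_image e ?W))"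
      unfolding chain_maps_def mem_Collect_eq
    proof (intro allI conjI homI ballI)
      fix r f assume f: "f \<in> carrier (grp (homc C x y) r)"
      show "conj_image e ?V (mor \<Phi> x y r f) \<in> carrier (?H r)" by (rule cc[OF f])
      have md: "mor \<Phi> x y (r - 1) (dif (homc C x y) r f) = dif (Hom_ch ?V ?W) r (mor \<Phi> x y r f)"
        using chm[OF x y] f by (simp add: chain_maps_def)
      note dc = Hom_ch_dif_closed[OF cx[OF x] cx[OF y] mc[OF x y f]]
      show "conj_image e ?V (mor \<Phi> x y (r - 1) (dif (homc C x y) r f)) =
          dif (Hom_ch (ch_image e ?V) (ch_image e ?W)) r (conj_image e ?V (mor \<Phi> x y r f))"
        unfolding md
      proof (rule Hom_ch_eqI[OF conj_image_closed[OF e dc gg[OF x]]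
            Hom_ch_dif_closed[OF ch_image_complex[OF e cx[OF x]] ch_image_complex[OF e cx[OF y]] cc[OF f]]])
        fix k v assume v': "v \<in> carrier (grp (ch_image e ?V) k)"
        then obtain w where w: "w \<in> carrier (grp ?V k)" "v = e w" by (auto simp: grp_ch_image)
        let ?m = "mor \<Phi> x y r f" and ?T = "grp ?W (k + r - 1)" and ?I = "grp (ch_image e ?W) (k + r - 1)"
        interpret T: comm_group ?T by (rule graded_group.groups[OF gg[OF y]])
        interpret I: comm_group ?I by (rule graded_group.groups[OF gi[OF y]])
        have dw: "dif ?V k w \<in> carrier (grp ?V (k - 1))" by (rule dif_closed[OF cx[OF x] w(1) refl])
        have c1: "dif ?W (k + r) (?m k w) \<in> carrier ?T"
          by (rule dif_closed[OF cx[OF y] Hom_ch_closed[OF mc[OF x y f] w(1) refl] refl])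
        have c2: "?m (k - 1) (dif ?V k w) \<in> carrier ?T"
          by (rule Hom_ch_closed[OF mc[OF x y f] dw]) simp
        note eh = ch_image_hom[OF e]
        have "conj_image e ?V (dif (Hom_ch ?V ?W) r ?m) k v =
            e (kos ?T k (dif ?W (k + r) (?m k w) \<otimes>\<^bsub>?T\<^esub> inv\<^bsub>?T\<^esub> ?m (k - 1) (dif ?V k w)))"
          using e w by (simp add: conj_image_apply Hom_ch_dif_apply)
        also have "\<dots> = kos ?I k (e (dif ?W (k + r) (?m k w)) \<otimes>\<^bsub>?I\<^esub> inv\<^bsub>?I\<^esub> e (?m (k - 1) (dif ?V k w)))"
          using c1 c2 by (simp add: hom_kos[OF eh T.is_group I.is_group] hom_mult[OF eh] hom_m_inv[OF eh T.is_group I.is_group])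
        also have "\<dots> = dif (Hom_ch (ch_image e ?V) (ch_image e ?W)) r (conj_image e ?V ?m) k v"
          using e w dw v' by (simp add: Hom_ch_dif_apply conj_image_apply grp_ch_image)
        finally show "conj_image e ?V (dif (Hom_ch ?V ?W) r ?m) k v =
            dif (Hom_ch (ch_image e ?V) (ch_image e ?W)) r (conj_image e ?V ?m) k v" .
      qed
      fix g assume g: "g \<in> carrier (grp (homc C x y) r)"
      have "mor \<Phi> x y r (f \<otimes>\<^bsub>grp (homc C x y) r\<^esub> g) = mor \<Phi> x y r f \<otimes>\<^bsub>grp (Hom_ch ?V ?W) r\<^esub> mor \<Phi> x y r g"
        by (rule hom_mult[OF mh[OF x y] f g])
      moreover have "mor \<Phi> x y r f \<otimes>\<^bsub>grp (Hom_ch ?V ?W) r\<^esub> mor \<Phi> x y r g \<in> carrier (grp (Hom_ch ?V ?W) r)"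
        using Hom_ch_comm_group[OF gg[OF x] gg[OF y]] mc[OF x y f] mc[OF x y g]
        by (intro monoid.m_closed group.is_monoid comm_group.axioms(2))
      ultimately show "conj_image e ?V (mor \<Phi> x y r (f \<otimes>\<^bsub>grp (homc C x y) r\<^esub> g)) =
          conj_image e ?V (mor \<Phi> x y r f) \<otimes>\<^bsub>?H r\<^esub> conj_image e ?V (mor \<Phi> x y r g)"
        using e by (intro Hom_ch_eqI[OF _ H.m_closed[OF cc[OF f] cc[OF g]]])
          (auto simp: conj_image_closed gg[OF x] Hom_ch_mult_apply grp_ch_image conj_image_apply)
    qed
    fix z r s f g assume z: "z \<in> ob C" and f: "f \<in> carrier (grp (homc C x y) r)" and g: "g \<in> carrier (grp (homc C y z) s)"
    have "mor \<Phi> x z (r + s) (cmp C x y z s r g f) = hcomp ?V r (mor \<Phi> y z s g) (mor \<Phi> x y r f)"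
      using F x y z f g unfolding dg_functor_def by blast
    then show "conj_image e ?V (mor \<Phi> x z (r + s) (cmp C x y z s r g f)) =
        hcomp (ch_image e ?V) r (conj_image e ?W (mor \<Phi> y z s g)) (conj_image e ?V (mor \<Phi> x y r f))"
      using e Hom_ch_closed[OF mc[OF x y f] _ refl]
      by (auto simp: hcomp_def conj_image_apply grp_ch_image the_inv_f_f fun_eq_iff conj_image_def restrict_def)
  qed
qed

context dga
begin

lemma taut_functor: "dg_functor (End_cat A) (taut A)"
  by (auto simp: dg_functor_def taut_def End_cat_def tpow_complex chain_maps_def hom_def)

lemma taut_prop_functor: "prop_functor A (taut A)"
  using taut_functor dga_axioms by (simp add: prop_functor_def prop_functor_axioms_def)

lemma image_taut_prop_functor: "inj e \<Longrightarrow> prop_functor A (dgfun_image e (taut A))"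
  using dgfun_image_functor[OF _ taut_functor] dga_axioms by (simp add: prop_functor_def prop_functor_axioms_def)

lemma obj_taut [simp]: "obj (taut A) = tpow A"
  by (simp add: taut_def)

lemma cap_hom_closed:
  assumes "D \<in> carrier (grp (hoch_cochains A) l)" "x \<in> carrier (grp (hoch_chains A) k)" "m \<ge> 1"
  shows "cap_hom A (m + q - 1) q (l + int q) (D q) (k - int (m + q) + 1) (x (m + q)) \<in> carrier (tgrp A m (k + l - int m + 1))"
proof -
  interpret P: prop_functor A "taut A" by (rule taut_prop_functor)
  show ?thesis
    using P.cap_term_closed[OF assms(1) assms(2)[unfolded hoch_chains_def] assms(3), of q]
    by (simp add: cap_term_def taut_def cap_mor_def)
qed

text \<open>The injection \<open>e\<close> is an isomorphism onto the transported groups, hence commutes with the sum over \<open>q\<close>.\<close>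

lemma cap_nat_taut:
  assumes e: "inj e" and x: "x \<in> carrier (grp (hoch_chains A) k)" and D: "D \<in> carrier (grp (hoch_cochains A) l)"
  shows "cap_nat A l D (dgfun_image e (taut A)) k (push e x) = push e (cap A k l x D)"
proof -
  let ?\<Phi> = "dgfun_image e (taut A)"
  interpret P: prop_functor A "taut A" by (rule taut_prop_functor)
  interpret Q: prop_functor A ?\<Phi> by (rule image_taut_prop_functor[OF e])
  have obj: "obj ?\<Phi> n = ch_image e (tpow A n)" for n by (simp add: dgfun_image_def)
  have x': "x \<in> carrier (grp (hoch A (taut A)) k)" using x by (simp add: hoch_chains_def)
  have xc: "x n \<in> carrier (tgrp A n (k - int n + 1))" if "n \<ge> 1" for n
    using P.hoch_component[OF x' that refl] by simp
  obtain N where N: "\<And>n. n \<ge> N \<Longrightarrow> x n = \<one>\<^bsub>grp (obj (taut A) n) (k - int n + 1)\<^esub>" using P.hoch_support[OF x'] by metis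
  have px: "push e x \<in> carrier (grp (hoch A ?\<Phi>) k)"
    using xc N by (intro Q.hoch_carrierI[of _ _ N]) (auto simp: push_def obj grp_ch_image)
  show ?thesis
  proof (rule P.hoch_eqI)
    show "cap_nat A l D ?\<Phi> k (push e x) \<in> extensional {1..}" by (rule Q.cap_nat_extensional[OF px])
    show "push e (cap A k l x D) \<in> extensional {1..}" by (simp add: push_def)
    fix m :: nat assume m: "m \<ge> 1"
    let ?T = "tgrp A m (k + l - int m + 1)" and ?I = "grp (ch_image e (tpow A m)) (k + l - int m + 1)"
    let ?f = "\<lambda>q. cap_hom A (m + q - 1) q (l + int q) (D q) (k - int (m + q) + 1) (x (m + q))"
    have fc: "?f q \<in> carrier ?T" for q by (rule cap_hom_closed[OF D x m])
    have "cap_term A ?\<Phi> l D k (push e x) m q = e (?f q)" for q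
    proof -
      have mq: "m + q \<ge> 1" using m by simp
      then show ?thesis
        using e xc[OF mq] by (simp add: cap_term_def dgfun_image_def push_def grp_ch_image the_inv_f_f taut_def cap_mor_def)
    qed
    then have t: "cap_term A ?\<Phi> l D k (push e x) m = (\<lambda>q. e (?f q))" by blast
    have "cap_nat A l D ?\<Phi> k (push e x) m = gfinprod ?I (\<lambda>q. e (?f q)) UNIV"
      using Q.dg_functor px m by (simp add: cap_nat_def t obj)
    also have "\<dots> = e (gfinprod ?T ?f UNIV)"
    proof -
      have "e (?f q) = e \<one>\<^bsub>?T\<^esub> \<longleftrightarrow> ?f q = \<one>\<^bsub>?T\<^esub>" for q using e by (simp add: inj_eq)
      moreover have "finprod ?I (\<lambda>q. e (?f q)) S = e (finprod ?T ?f S)" for S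
        using ch_image_hom[OF e, of "tpow A m"] Q.obj_group[of m] fc
        by (intro hom_finprod[symmetric]) (auto simp: obj tgrp_comm_group)
      ultimately show ?thesis by (simp add: gfinprod_def grp_ch_image)
    qed
    also have "\<dots> = push e (cap A k l x D) m" using m by (simp add: push_def cap_def)
    finally show "cap_nat A l D ?\<Phi> k (push e x) m = push e (cap A k l x D) m" .
  qed
qed

end

section \<open>Injectivity\<close>

context dga
begin

text \<open>The homomorphism \<open>A\<^bsup>\<otimes>1\<^esup> \<rightarrow> A\<close> that reads off the only entry separates these pure tensors.\<close>

lemma pure_singleton_inj:
  assumes "a \<in> carrier (grp A i)" "b \<in> carrier (grp A i)" "pure A [(i, a)] = pure A [(i, b)]"
  shows "a = b"
proof -
  have m: "multiadditive A 1 i (grp A i) (\<lambda>xs. snd (hd xs))"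
    using homogeneous_op_snd[OF hd_homogeneous_op, of i] by simp
  have t: "[(i, a)] \<in> tgens A 1 i" "[(i, b)] \<in> tgens A 1 i" using assms(1,2) by (auto simp: tgens_Cons)
  show ?thesis
    using tlift_pure[OF groups m t(1)] tlift_pure[OF groups m t(2)] assms(3) by simp
qed

text \<open>
  The test chain is \<open>a \<otimes> a\<^sub>1 \<otimes> \<dots> \<otimes> a\<^sub>q\<close>: only the part \<open>D\<^sub>q\<close> of \<open>D\<close> contributes to the component in \<open>A\<close> of its cap
  product with \<open>D\<close>, by \<open>\<plusminus> aD\<^sub>q(a\<^sub>1,\<dots>,a\<^sub>q)\<close>.
\<close>

lemma cap_nat_eq_imp:
  fixes e :: "'a tens \<Rightarrow> 'u"
  assumes e: "inj e" and D: "D \<in> carrier (grp (hoch_cochains A) l)" and D': "D' \<in> carrier (grp (hoch_cochains A) l)"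
    and eq: "(cap_nat A l D :: (nat, int \<Rightarrow> 'a tens \<Rightarrow> 'a tens, 'u) dgfun \<Rightarrow> _) = cap_nat A l D'"
    and as: "as \<in> tgens A q w" and a: "a \<in> carrier (grp A i)"
  shows "mul A i (w + (l + int q)) a (D q w (pure A as)) = mul A i (w + (l + int q)) a (D' q w (pure A as))"
proof -
  interpret P: prop_functor A "taut A" by (rule taut_prop_functor)
  interpret T: comm_group "tgrp A n0 k0" for n0 k0 by (rule tgrp_comm_group)
  \<comment> \<open>the degree of the test chain in the Hochschild complex\<close>
  define k where "k = i + w + int q"
  define x where "x = (\<lambda>n\<in>{1..}. if n = q + 1 then pure A ((i, a) # as) else \<one>\<^bsub>tgrp A n (k - int n + 1)\<^esub>)"
  have g: "(i, a) # as \<in> tgens A (q + 1) (i + w)" using as a by (simp add: tgens_Cons)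
  have x: "x \<in> carrier (grp (hoch_chains A) k)"
    unfolding hoch_chains_def using pure_closed[OF g]
    by (intro P.hoch_carrierI[of _ _ "q + 2"]) (auto simp: x_def k_def)
  have val: "cap A k l x E 1 = kos (tgrp A 1 (k + l)) ((i + w + int q - i) * (l + int q))
      (pure A [(i + (w + (l + int q)), mul A i (w + (l + int q)) a (E q w (pure A as)))])"
    if E: "E \<in> carrier (grp (hoch_cochains A) l)" for E
  proof -
    let ?f = "\<lambda>p. cap_hom A (1 + p - 1) p (l + int p) (E p) (k - int (1 + p) + 1) (x (1 + p))"
    have fc: "?f p \<in> carrier (tgrp A 1 (k + l))" for p using cap_hom_closed[OF E x, of 1 p] by simp
    have f1: "?f p = \<one>\<^bsub>tgrp A 1 (k + l)\<^esub>" if "p \<noteq> q" for p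
      using P.cap_term_one[OF E, of 1 x p k] that
      by (simp add: cap_term_def taut_def cap_mor_def x_def)
    have "cap A k l x E 1 = gfinprod (tgrp A 1 (k + l)) ?f UNIV" by (simp add: cap_def)
    also have "\<dots> = gfinprod (tgrp A 1 (k + l)) ?f {q}"
      using fc f1 by (intro T.gfinprod_mono_neutral_cong_right) auto
    also have "\<dots> = ?f q" using fc[of q] by simp
    also have "\<dots> = cap_mor A 1 q (l + int q) (E q) (i + w) (pure A ((i, a) # as @ []))"
      by (simp add: cap_mor_def x_def k_def)
    also have "\<dots> = kos (tgrp A 1 (k + l)) ((i + w + int 1 + int q - 1 - fst (i, a)) * (l + int q))
        (pure A [mulh A (i, a) (app A (l + int q) (E q) as)])"
      using g tgens_length[OF as] E
      by (intro cap_mor_pure) (auto simp: hoch_cochains_carrier k_def)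
    finally show ?thesis using tgens_wt[OF as] by (simp add: mulh_def app_def)
  qed
  have "push e (cap A k l x D) = push e (cap A k l x D')"
    using cap_nat_taut[OF e x D] cap_nat_taut[OF e x D'] eq by simp
  then have "e (cap A k l x D 1) = e (cap A k l x D' 1)" by (auto simp: push_def dest: fun_cong[of _ _ 1])
  then have c: "cap A k l x D 1 = cap A k l x D' 1" using e by (simp add: inj_eq)
  have v: "mul A i (w + (l + int q)) a (E q w (pure A as)) \<in> carrier (grp A (i + (w + (l + int q))))"
    if E: "E \<in> carrier (grp (hoch_cochains A) l)" for E
  proof (rule mul_closed[OF a _ refl])
    have "E q \<in> carrier (grp (Hom_ch (tpow A q) A) (l + int q))" using E by (simp add: hoch_cochains_carrier)
    then show "E q w (pure A as) \<in> carrier (grp A (w + (l + int q)))"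
      by (rule Hom_ch_closed[OF _ _ refl]) (use pure_closed[OF as] in simp)
  qed
  have p: "pure A [(i + (w + (l + int q)), mul A i (w + (l + int q)) a (E q w (pure A as)))] \<in> carrier (tgrp A 1 (k + l))"
    if "E \<in> carrier (grp (hoch_cochains A) l)" for E
    using v[OF that] by (intro pure_closed) (simp add: tgens_Cons k_def)
  show ?thesis
    using c unfolding val[OF D] val[OF D'] T.kos_eq_iff[OF p[OF D] p[OF D']]
    by (rule pure_singleton_inj[OF v[OF D] v[OF D']])
qed

text \<open>
  If \<open>Ax = 0\<close>, then capping with the cochain \<open>x\<close> of arity \<open>0\<close>, that is \<open>a\<^sub>0 \<otimes> a\<^sub>1 \<otimes> \<dots> \<mapsto> \<plusminus> a\<^sub>0x \<otimes> a\<^sub>1 \<otimes> \<dots>\<close>, is zero as a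
  morphism of the prop, hence for every functor.
\<close>

lemma cap_nat_inj_iff:
  fixes e :: "'a tens \<Rightarrow> 'u"
  assumes e: "inj e"
  shows "(\<forall>l. inj_on (cap_nat A l :: _ \<Rightarrow> (nat, int \<Rightarrow> 'a tens \<Rightarrow> 'a tens, 'u) dgfun \<Rightarrow> _) (carrier (grp (hoch_cochains A) l))) \<longleftrightarrow>
     (\<forall>i. \<forall>x\<in>carrier (grp A i).
        (\<forall>j. \<forall>a\<in>carrier (grp A j). mul A j i a x = \<one>\<^bsub>grp A (j + i)\<^esub>) \<longrightarrow> x = \<one>\<^bsub>grp A i\<^esub>)"
    (is "?inj \<longleftrightarrow> ?nd")
proof
  interpret Ag: comm_group "grp A k0" for k0 by (rule groups)
  assume inj: ?inj
  show ?nd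
  proof (intro allI ballI impI)
    fix i x assume x: "x \<in> carrier (grp A i)"
      and ax: "\<forall>j. \<forall>a\<in>carrier (grp A j). mul A j i a x = \<one>\<^bsub>grp A (j + i)\<^esub>"
    interpret H: comm_group "grp (Hom_ch (tpow A q0) A) r0" for q0 r0 by (rule Hom_A_group)
    \<comment> \<open>\<open>A\<^bsup>\<otimes>0\<^esup>\<close> is generated by the empty tensor, which \<open>Dx\<close> sends to \<open>x\<close>\<close>
    define Dx where "Dx = (\<lambda>k. tlift A 0 k (grp A (k + i)) (\<lambda>_. x))"
    have mx: "multiadditive A 0 k (grp A (k + i)) (\<lambda>_. x)" for k
      using x by (intro multiadditiveI) (auto simp: tgens_def wt_def)
    have Dx: "Dx \<in> carrier (grp (Hom_ch (tpow A 0) A) i)"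
      unfolding Dx_def by (rule tlift_Hom_ch[OF graded_group_axioms mx])
    have Dx0: "Dx 0 (pure A []) = x"
      using tlift_pure[OF groups mx, of "[]" 0] by (simp add: Dx_def)
    define One where "One = (\<lambda>q. \<one>\<^bsub>grp (Hom_ch (tpow A q) A) (i + int q)\<^esub>)"
    define D where "D = One(0 := Dx)"
    have One: "One \<in> carrier (grp (hoch_cochains A) i)" by (simp add: hoch_cochains_carrier One_def)
    have D: "D \<in> carrier (grp (hoch_cochains A) i)" using Dx One by (auto simp: hoch_cochains_carrier D_def)
    have "cap_mor A m q (i + int q) (D q) = cap_mor A m q (i + int q) (One q)" if m: "m \<ge> 1" for m q
    proof (cases "q = 0")
      case True
      note gg = tpow_graded_group
      have "cap_mor A m 0 i Dx = \<one>\<^bsub>grp (Hom_ch (tpow A (m + 0)) (tpow A m)) i\<^esub>"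
      proof (rule tpow_Hom_ch_eqI[OF cap_mor_closed[OF Dx m] monoid.one_closed gg])
        show "monoid (grp (Hom_ch (tpow A (m + 0)) (tpow A m)) i)"
          by (intro group.is_monoid comm_group.axioms(2) Hom_ch_comm_group gg)
        fix k xs assume xs: "xs \<in> tgens A (m + 0) k"
        obtain a bs where ab: "xs = a # bs" using tgens_length[OF xs] m by (cases xs) auto
        interpret T: comm_group "tgrp A m (k + i)" by (rule tgrp_comm_group)
        have a: "snd a \<in> carrier (grp A (fst a))" and bs: "bs \<in> tgens A (m - 1) (k - fst a)"
          using xs by (simp_all add: ab tgens_Cons')
        have t: "[] @ (fst a + i, \<one>\<^bsub>grp A (fst a + i)\<^esub>) # bs \<in> tgens A m (k + i)"
          using bs m by (simp add: tgens_Cons algebra_simps)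
        have "mulh A a (app A i Dx []) = (fst a + i, \<one>\<^bsub>grp A (fst a + i)\<^esub>)"
          using ax a by (simp add: mulh_def app_def Dx0)
        then have "pure A (mulh A a (app A i Dx []) # bs) = \<one>\<^bsub>tgrp A m (k + i)\<^esub>"
          using multiadditive_one[OF pure_multiadditive tgrp_comm_group t] by simp
        then have "cap_mor A m 0 i Dx k (pure A xs) = \<one>\<^bsub>tgrp A m (k + i)\<^esub>"
          using cap_mor_pure[OF Dx m, of a "[]" bs k "k + i"] xs by (simp add: ab)
        then show "cap_mor A m 0 i Dx k (pure A xs) = \<one>\<^bsub>grp (Hom_ch (tpow A (m + 0)) (tpow A m)) i\<^esub> k (pure A xs)"
          using pure_closed[OF xs] by (simp add: Hom_ch_one_apply)
      qed
      moreover have "cap_mor A m 0 i (One 0) = \<one>\<^bsub>grp (Hom_ch (tpow A (m + 0)) (tpow A m)) i\<^esub>"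
        unfolding One_def
        using hom_one[OF cap_mor_hom[OF m, of 0 i] H.is_group] Hom_ch_comm_group[OF gg gg]
        by (simp add: comm_group.axioms(2))
      ultimately show ?thesis using True by (simp add: D_def)
    qed (simp add: D_def)
    then have "(cap_nat A i D :: (nat, int \<Rightarrow> 'a tens \<Rightarrow> 'a tens, 'u) dgfun \<Rightarrow> _) = cap_nat A i One"
      unfolding cap_nat_def cap_term_def by (intro restrict_ext ext) (simp cong: restrict_cong)
    then have "D = One" using inj D One by (auto simp: inj_on_def)
    then have "Dx = One 0" by (metis D_def fun_upd_same)
    then show "x = \<one>\<^bsub>grp A i\<^esub>"
      using Dx0 pure_closed[of "[]" 0 0] by (simp add: One_def Hom_ch_one_apply)
  qed
next
  interpret Ag: comm_group "grp A k0" for k0 by (rule groups)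
  assume nd: ?nd
  show ?inj
  proof (intro allI inj_onI)
    fix l D D' assume D: "D \<in> carrier (grp (hoch_cochains A) l)" and D': "D' \<in> carrier (grp (hoch_cochains A) l)"
      and eq: "(cap_nat A l D :: (nat, int \<Rightarrow> 'a tens \<Rightarrow> 'a tens, 'u) dgfun \<Rightarrow> _) = cap_nat A l D'"
    show "D = D'"
    proof
      fix q
      have Dq: "D q \<in> carrier (grp (Hom_ch (tpow A q) A) (l + int q))" "D' q \<in> carrier (grp (Hom_ch (tpow A q) A) (l + int q))"
        using D D' by (simp_all add: hoch_cochains_carrier)
      show "D q = D' q"
      proof (rule tpow_Hom_ch_eqI[OF Dq graded_group_axioms])
        fix w as assume as: "as \<in> tgens A q w"
        let ?r = "w + (l + int q)"
        let ?y = "D q w (pure A as)" and ?y' = "D' q w (pure A as)"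
        have y: "?y \<in> carrier (grp A ?r)" "?y' \<in> carrier (grp A ?r)"
          using Hom_ch_closed[OF Dq(1) _ refl] Hom_ch_closed[OF Dq(2) _ refl] pure_closed[OF as] by simp_all
        have "mul A j ?r a (?y \<otimes>\<^bsub>grp A ?r\<^esub> inv\<^bsub>grp A ?r\<^esub> ?y') = \<one>\<^bsub>grp A (j + ?r)\<^esub>"
          if a: "a \<in> carrier (grp A j)" for j a
        proof -
          note h = mul_hom_right[OF a, of ?r]
          have "mul A j ?r a (?y \<otimes>\<^bsub>grp A ?r\<^esub> inv\<^bsub>grp A ?r\<^esub> ?y') =
              mul A j ?r a ?y \<otimes>\<^bsub>grp A (j + ?r)\<^esub> inv\<^bsub>grp A (j + ?r)\<^esub> (mul A j ?r a ?y')"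
            using y by (simp add: hom_mult[OF h] hom_m_inv[OF h Ag.is_group Ag.is_group])
          then show ?thesis
            using cap_nat_eq_imp[OF e D D' eq as a] hom_in_carrier[OF h y(2)] by simp
        qed
        then have "?y \<otimes>\<^bsub>grp A ?r\<^esub> inv\<^bsub>grp A ?r\<^esub> ?y' = \<one>\<^bsub>grp A ?r\<^esub>"
          using nd y by (metis Ag.inv_closed Ag.m_closed)
        then show "?y = ?y'" using y by (metis Ag.inv_closed Ag.inv_equality Ag.inv_inv)
      qed
    qed
  qed
qed

end

theorem proposition2p14:
  fixes A :: "'a dga" and e :: "'a tens \<Rightarrow> 'u"
  assumes "dg_algebra A" and "inj e"
  shows "\<exists>F. F \<in> chain_maps (hoch_cochains A) (Nat_End A) \<and>
    ((\<forall>l. inj_on (F l) (carrier (grp (hoch_cochains A) l))) \<longleftrightarrow>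
     (\<forall>i. \<forall>x\<in>carrier (grp A i).
        (\<forall>j. \<forall>a\<in>carrier (grp A j). mul A j i a x = \<one>\<^bsub>grp A (j + i)\<^esub>) \<longrightarrow> x = \<one>\<^bsub>grp A i\<^esub>)) \<and>
    (\<forall>k l. \<forall>x\<in>carrier (grp (hoch_chains A) k). \<forall>D\<in>carrier (grp (hoch_cochains A) l).
       F l D (dgfun_image e (taut A)) k (push e x) = push e (cap A k l x D))"
proof -
  interpret dga A using assms(1) by unfold_locales
  show ?thesis
    using cap_nat_chain_map cap_nat_inj_iff[OF assms(2)] cap_nat_taut[OF assms(2)]
    by (intro exI[of _ "cap_nat A"] conjI allI ballI) auto
qed

end
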